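(* Let $\varphi(t,\mathbf x)$ and $\mathbf A(t,\mathbf x)$ be defined and twice continuously differentiable in a domain $D\subset\mathbb R\times\mathbb R^3$. Assume that the steady-state equation $-\nabla^2\mathring\psi_1+G_1'(|\mathring\psi_1|^2)\mathring\psi_1=0$ on $\mathbb R^3$ has a positive radial solution $\mathring\psi_1=\mathring\psi_1(|\mathbf x|)$, twice continuously differentiable and square integrable, such that $\theta^2|\mathring\psi_1(\theta)|\le C$ and $\theta^3|\mathring\psi_1'(\theta)|\le C$ as $\theta\to\infty$. Then a trajectory $\mathbf r:[T_-,T_+]\to\mathbb R^3$ that lies in $D$ (i.e. $(t,\mathbf r(t))\in D$ for all $t\in[T_-,T_+]$) is a concentration trajectory of asymptotic solutions of the NLS equation with potentials $\varphi,\mathbf A$ if and only if it satisfies Newton's law $$m\,\partial_t^2\mathbf r=q\,\mathbf E(t,\mathbf r)+\frac q{\mathrm c}\,\partial_t\mathbf r\times\mathbf B(t,\mathbf r),\qquad \mathbf E=-\nabla\varphi-\frac1{\mathrm c}\partial_t\mathbf A,\quad \mathbf B=\nabla\times\mathbf A.$$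
   Context: **NLS equation and densities.** $m,q,\chi,\mathrm c>0$ are fixed constants. Given real $\varphi(t,\mathbf x)$ and $\mathbf A(t,\mathbf x)\in\mathbb R^3$ put $\tilde\partial_t=\partial_t+\frac{iq}{\chi}\varphi$, $\tilde\nabla=\nabla-\frac{iq}{\chi\mathrm c}\mathbf A$ (components $\tilde\partial_j$), $\tilde\partial_t^*=\partial_t-\frac{iq}{\chi}\varphi$, $\tilde\nabla^*=\nabla+\frac{iq}{\chi\mathrm c}\mathbf A$, $\mathbf E=-\nabla\varphi-\frac1{\mathrm c}\partial_t\mathbf A$, $\mathbf B=\nabla\times\mathbf A$. The NLS equation with size parameter $a>0$ is $i\tilde\partial_t\psi=\frac{\chi}{2m}\left[-\tilde\nabla^2\psi+G_a'(\psi^*\psi)\psi\right]$, where $\psi$ is complex valued, $G_a'(s)=a^{-2}G_1'(a^3s)$, $G_a(s)=\int_0^sG_a'(s')\,ds'$. Standing condition on the nonlinearity: $G_1'$ is real valued and continuous for $s>0$, it is the derivative of $G_1$, which is differentiable for $s>0$ and continuous for $s\ge0$; $\psi\mapsto G_1(\psi^*\psi)$ is differentiable on $\mathbb C$ with differential $g(\psi)\,d\psi^*+g^*(\psi)\,d\psi$, where $g(\psi)=G_1'(\psi^*\psi)\psi$ for $\psi\ne0$, $g(0)=0$, and $g$ is continuous on $\mathbb C$. Define $\rho=q\psi\psi^*$, $\mathbf J=-\frac{iq\chi}{2m}(\psi^*\tilde\nabla\psi-\psi\tilde\nabla^*\psi^* )$, $\mathbf P=\frac{i\chi}{2}(\psi\tilde\nabla^*\psi^*-\psi^*\tilde\nabla\psi)$,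 $\mathbf f=\rho\mathbf E+\frac1{\mathrm c}\mathbf J\times\mathbf B$, $u=\frac{\chi^2}{2m}\left[|\tilde\nabla\psi|^2+G_a(|\psi|^2)\right]$, and for $i,j\in\{1,2,3\}$: $T^{ij}=\frac{\chi^2}{2m}(\tilde\partial_i\psi\,\tilde\partial_j^*\psi^*+\tilde\partial_j\psi\,\tilde\partial_i^*\psi^* )$ if $i\ne j$; $T^{ii}=-u+\frac{\chi^2}{m}\tilde\partial_i\psi\,\tilde\partial_i^*\psi^*+\frac{i\chi}{2}(\psi^*\tilde\partial_t\psi-\psi\tilde\partial_t^*\psi^* )$ (no sum). **Trajectories and neighborhoods.** A trajectory is a $C^2$ function $\hat{\mathbf r}:[T_-,T_+]\to\mathbb R^3$ with bounded first and second derivatives; $\hat{\mathbf v}=\partial_t\hat{\mathbf r}$. For $R_n\to0$ let $\Omega_n=\Omega_n(t)=\{\mathbf x:|\mathbf x-\hat{\mathbf r}(t)|\le R_n\}$ and $\hat\Omega_n=\{(t,\mathbf x):T_-\le t\le T_+,\ \mathbf x\in\Omega_n(t)\}$; $\bar{\mathbf n}$ is the outer unit normal to $\partial\Omega_n$, $d\sigma$ surface measure. $C$ denotes constants independent of $n$. **Concentration trajectory of asymptotic solutions (fixed potentials $\varphi,\mathbf A$).** Put $\mathbf E_\infty(t)=\mathbf E(t,\hat{\mathbf r}(t))$, $\mathbf B_\infty(t)=\mathbf B(t,\hat{\mathbf r}(t))$. The trajectory $\hat{\mathbf r}$ is a concentration trajectory of asymptotic solutions of the NLS equation if the condition on the nonlinearity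 holds and there exist sequences $a_n\to0$, $R_n\to0$ with $R_n/a_n\to\infty$, and functions $\psi_n\in C^2(\hat\Omega_n)$ such that the following hold, where all densities are computed from $\psi_n$, the restrictions of $\varphi,\mathbf A$ to $\hat\Omega_n$, and $a=a_n$; $\bar\rho_n(t)=\int_{\Omega_n}\rho_n\,d\mathbf x$, and $\mathbf r=\mathbf r_n(t)=\frac1{\bar\rho_n}\int_{\Omega_n}\mathbf x\rho_n\,d\mathbf x$ (in the conditions below $\mathbf r$ denotes this charge center): (i$'$) There are perturbation terms $\rho',\mathbf J',\mathbf P',T^{ij\prime},\mathbf f'$ (depending on $n$) on $\hat\Omega_n$ such that $\partial_t\rho+\partial_t\rho'+\nabla\cdot\mathbf J+\nabla\cdot\mathbf J'=0$ and $\partial_t\mathbf P+\partial_t\mathbf P'+\partial_iT^{ij}+\partial_iT^{ij\prime}=\mathbf f+\mathbf f'$ in $\hat\Omega_n$ (component $j$, sum over $i$), and $Q_0',Q_2',Q_3'\to0$ uniformly on $[T_-,T_+]$, where $Q_0'=\int_{\Omega_n(t)}\mathbf P'(t)d\mathbf x-\int_{\Omega_n(t_0)}\mathbf P'(t_0)d\mathbf x-\int_{t_0}^t\int_{\partial\Omega_n}\mathbf P'\,\hat{\mathbf v}\cdot\bar{\mathbf n}\,d\sigma dt'+\int_{t_0}^t\int_{\Omega_n}\partial_iT^{ij\prime}d\mathbf xdt'-\int_{t_0}^t\int_{\Omega_n}\mathbf f'd\mathbf xdt'$, $Q_2'=\int_{\Omega_n}\partial_t((\mathbf x-\mathbf r)\rho')d\mathbf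 x+\partial_t\mathbf r\int_{\Omega_n}\rho'd\mathbf x+\int_{\partial\Omega_n}(\mathbf x-\mathbf r)\,\bar{\mathbf n}\cdot\mathbf J'd\sigma-\int_{\Omega_n}\mathbf J'd\mathbf x$, $Q_3'=\bar\rho'(t)-\bar\rho'(t_0)-\int_{t_0}^t\int_{\partial\Omega_n}\hat{\mathbf v}\cdot\bar{\mathbf n}\rho'd\sigma dt'+\int_{t_0}^t\int_{\partial\Omega_n}\bar{\mathbf n}\cdot\mathbf J'd\sigma dt'$, with $\bar\rho'=\int_{\Omega_n}\rho'd\mathbf x$. (ii) $\left|\int_{\Omega_n}\mathbf P_n(t)\,d\mathbf x\right|\le C$ for $T_-\le t\le T_+$. (iii) $C\ge\bar\rho_n(t)\ge c_0>0$ for $n\ge n_0$, $T_-\le t\le T_+$. (iv) There is $t_0\in[T_-,T_+]$ with $\bar\rho_n(t_0)\to\bar\rho_\infty$. (v) Uniformly on $[T_-,T_+]$ the following tend to $0$: $Q_0=\int_{t_0}^t\int_{\partial\Omega_n}\bar{\mathbf n}_iT^{ij}d\sigma dt'$; $Q_{01}=\int_{t_0}^t\int_{\partial\Omega_n}\mathbf P\,\hat{\mathbf v}\cdot\bar{\mathbf n}\,d\sigma dt'$; $Q_{20}=-\int_{\partial\Omega_n}(\mathbf x-\mathbf r)\hat{\mathbf v}\cdot\bar{\mathbf n}\,\rho\,d\sigma$; $Q_{22}=\int_{\partial\Omega_n}(\mathbf x-\mathbf r)\bar{\mathbf n}\cdot\mathbf J\,d\sigma$; $Q_{23}=\int_{t_0}^t\int_{\partial\Omega_n}\hat{\mathbf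 v}\cdot\bar{\mathbf n}\,\rho\,d\sigma dt'-\int_{t_0}^t\int_{\partial\Omega_n}\bar{\mathbf n}\cdot\mathbf J\,d\sigma dt'$. (vi) With $Q_{30}=\int_{\Omega_n}(\mathbf E-\mathbf E_\infty)\rho\,d\mathbf x$ and $Q_{31}=\int_{\Omega_n}\frac1{\mathrm c}\mathbf J\times(\mathbf B-\mathbf B_\infty)\,d\mathbf x$, $\int_{t_0}^t(Q_{30}+Q_{31})dt'\to0$ uniformly on $[T_-,T_+]$. *)

theory Defs
  imports "HOL-Analysis.Analysis"
begin

subsection \<open>Derivatives on open sets and on closed regions\<close>

text \<open>Derivatives are taken within the domain \<open>S\<close> of the function.  For an open \<open>S\<close> this is the
  ordinary derivative; on a compact interval and on the compact tubes used below it is the derivative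
  up to the boundary (one-sided where necessary), and it is unique there, because at every point
  these sets contain the initial segments of an open cone of directions.\<close>

definition pd :: "'a::real_normed_vector set \<Rightarrow> 'a \<Rightarrow> ('a \<Rightarrow> 'b::real_normed_vector) \<Rightarrow> 'a \<Rightarrow> 'b" where
  "pd S v f p = frechet_derivative f (at p within S) v"

primrec Ck :: "nat \<Rightarrow> 'a::real_normed_vector set \<Rightarrow> ('a \<Rightarrow> 'b::real_normed_vector) \<Rightarrow> bool" where
  "Ck 0 S f \<longleftrightarrow> continuous_on S f"
| "Ck (Suc k) S f \<longleftrightarrow> f differentiable_on S \<and> (\<forall>v. Ck k S (pd S v f))"

type_synonym spacetime = "real \<times> (real^3)"

definition dt :: "spacetime set \<Rightarrow> (spacetime \<Rightarrow> 'b::real_normed_vector) \<Rightarrow> spacetime \<Rightarrow> 'b" where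
  "dt S f = pd S (1, 0) f"

definition dx :: "spacetime set \<Rightarrow> 3 \<Rightarrow> (spacetime \<Rightarrow> 'b::real_normed_vector) \<Rightarrow> spacetime \<Rightarrow> 'b" where
  "dx S j f = pd S (0, axis j 1) f"

definition grad :: "spacetime set \<Rightarrow> (spacetime \<Rightarrow> real) \<Rightarrow> spacetime \<Rightarrow> real^3" where
  "grad S f p = (\<chi> j. dx S j f p)"

definition div3 :: "spacetime set \<Rightarrow> (spacetime \<Rightarrow> real^3) \<Rightarrow> spacetime \<Rightarrow> real" where
  "div3 S F p = (\<Sum>j\<in>UNIV. dx S j (\<lambda>p. F p $ j) p)"

definition curl :: "spacetime set \<Rightarrow> (spacetime \<Rightarrow> real^3) \<Rightarrow> spacetime \<Rightarrow> real^3" where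
  "curl S F p = vector
    [dx S 2 (\<lambda>p. F p $ 3) p - dx S 3 (\<lambda>p. F p $ 2) p,
     dx S 3 (\<lambda>p. F p $ 1) p - dx S 1 (\<lambda>p. F p $ 3) p,
     dx S 1 (\<lambda>p. F p $ 2) p - dx S 2 (\<lambda>p. F p $ 1) p]"

definition div_tensor :: "spacetime set \<Rightarrow> (3 \<Rightarrow> 3 \<Rightarrow> spacetime \<Rightarrow> real) \<Rightarrow> spacetime \<Rightarrow> real^3" where
  "div_tensor S T p = (\<chi> j. \<Sum>i\<in>UNIV. dx S i (T i j) p)"

definition laplacian :: "(real^3 \<Rightarrow> real) \<Rightarrow> real^3 \<Rightarrow> real" where
  "laplacian f x = (\<Sum>j\<in>UNIV. pd UNIV (axis j 1) (pd UNIV (axis j 1) f) x)"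


subsection \<open>Surface measure on a sphere\<close>

text \<open>The usual measure-theoretic definition: a Borel set \<open>U\<close> of the unit sphere has surface measure
  \<open>3\<close> times the volume of the cone \<open>{s u | 0 < s < 1, u \<in> U}\<close>, and the sphere of radius \<open>R\<close>
  about \<open>z\<close> carries the image scaled by \<open>R\<^sup>2\<close>.  (The origin of the unit ball, which is sent to \<open>z\<close>,
  is a null set.)\<close>

definition sphere_measure :: "real^3 \<Rightarrow> real \<Rightarrow> (real^3) measure" where
  "sphere_measure z R =
     distr (density lborel (\<lambda>y. ennreal (3 * R\<^sup>2) * indicator (ball 0 1) y)) borel
           (\<lambda>y. z + R *\<^sub>R sgn y)"

lemma measurable_sgn_affine: "(\<lambda>y::real^3. z + R *\<^sub>R sgn y) \<in> borel_measurable borel"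
  unfolding sgn_div_norm by measurable

lemma emeasure_sphere_measure:
  assumes "R > 0"
  shows "emeasure (sphere_measure z R) (sphere z R) = ennreal (4 * pi * R\<^sup>2)"
proof -
  let ?N = "density lborel (\<lambda>y::real^3. ennreal (3 * R\<^sup>2) * indicator (ball 0 1) y)"
  have pre: "(\<lambda>y::real^3. z + R *\<^sub>R sgn y) -` sphere z R \<inter> space ?N = - {0}"
    using assms by (auto simp: dist_norm norm_sgn)
  have meas: "(\<lambda>y::real^3. z + R *\<^sub>R sgn y) \<in> ?N \<rightarrow>\<^sub>M borel"
    using measurable_sgn_affine[of z R] by simp
  have "emeasure (sphere_measure z R) (sphere z R) = emeasure ?N (- {0})"
    unfolding sphere_measure_def by (subst emeasure_distr[OF meas]) (simp_all only: pre, simp)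
  also have "\<dots> = (\<integral>\<^sup>+ y\<in>-{0}. ennreal (3 * R\<^sup>2) * indicator (ball (0::real^3) 1) y \<partial>lborel)"
    by (rule emeasure_density) (auto intro!: borel_measurable_times_ennreal borel_measurable_indicator)
  also have "\<dots> = (\<integral>\<^sup>+ y. ennreal (3 * R\<^sup>2) * indicator (ball (0::real^3) 1) y \<partial>lborel)"
  proof (rule nn_integral_cong_AE)
    show "AE y in lborel. ennreal (3 * R\<^sup>2) * indicator (ball 0 1) y * indicator (- {0}) y =
      ennreal (3 * R\<^sup>2) * indicator (ball (0::real^3) 1) y"
      using AE_lborel_singleton[of "0::real^3"] by eventually_elim (auto simp: indicator_def)
  qed
  also have "\<dots> = ennreal (3 * R\<^sup>2) * emeasure lborel (ball (0::real^3) 1)"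
    by (rule nn_integral_cmult_indicator) auto
  also have "\<dots> = ennreal (3 * R\<^sup>2) * ennreal (unit_ball_vol 3)"
    by (subst emeasure_ball) simp_all
  also have "\<dots> = ennreal (4 * pi * R\<^sup>2)"
    by (subst ennreal_mult[symmetric]) (auto simp: unit_ball_vol_3)
  finally show ?thesis .
qed


subsection \<open>The nonlinearity\<close>

text \<open>\<open>G1'\<close> is a function of a positive argument; its value at \<open>0\<close> plays no role, and \<open>G1' s\<close> may be
  unbounded as \<open>s\<close> tends to \<open>0\<close>.\<close>

definition Ga' :: "(real \<Rightarrow> real) \<Rightarrow> real \<Rightarrow> real \<Rightarrow> real" where
  "Ga' G1' a s = G1' (a ^ 3 * s) / a\<^sup>2"

definition Ga :: "(real \<Rightarrow> real) \<Rightarrow> real \<Rightarrow> real \<Rightarrow> real" where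
  "Ga G1' a s = integral {0..s} (Ga' G1' a)"

definition nonlin_g :: "(real \<Rightarrow> real) \<Rightarrow> complex \<Rightarrow> complex" where
  "nonlin_g G1' z = (if z = 0 then 0 else of_real (G1' ((cmod z)\<^sup>2)) * z)"

text \<open>The primitive \<open>G1\<close> is \<open>Ga G1' 1\<close>.  If \<open>G1'\<close> were not integrable at \<open>0\<close>, that integral would
  be the default value \<open>0\<close> for every \<open>s > 0\<close>, and the second conjunct would then give \<open>G1' s = 0\<close> for
  every \<open>s > 0\<close>; so the condition includes integrability.\<close>

definition nonlinearity_condition :: "(real \<Rightarrow> real) \<Rightarrow> bool" where
  "nonlinearity_condition G1' \<longleftrightarrow>
     continuous_on {0<..} G1' \<and>
     (\<forall>s>0. (Ga G1' 1 has_real_derivative G1' s) (at s)) \<and>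
     continuous_on {0..} (Ga G1' 1) \<and>
     (\<forall>z. ((\<lambda>z. complex_of_real (Ga G1' 1 ((cmod z)\<^sup>2))) has_derivative
             (\<lambda>h. nonlin_g G1' z * cnj h + cnj (nonlin_g G1' z) * h)) (at z)) \<and>
     continuous_on UNIV (nonlin_g G1')"

definition steady_state :: "(real \<Rightarrow> real) \<Rightarrow> (real^3 \<Rightarrow> real) \<Rightarrow> bool" where
  "steady_state G1' u \<longleftrightarrow> (\<forall>x. - laplacian u x + G1' (\<bar>u x\<bar>\<^sup>2) * u x = 0)"


subsection \<open>Trajectories\<close>

definition velocity :: "real \<Rightarrow> real \<Rightarrow> (real \<Rightarrow> real^3) \<Rightarrow> real \<Rightarrow> real^3" where
  "velocity Tm Tp r t = vector_derivative r (at t within {Tm..Tp})"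

definition acceleration :: "real \<Rightarrow> real \<Rightarrow> (real \<Rightarrow> real^3) \<Rightarrow> real \<Rightarrow> real^3" where
  "acceleration Tm Tp r t = vector_derivative (velocity Tm Tp r) (at t within {Tm..Tp})"

definition trajectory :: "real \<Rightarrow> real \<Rightarrow> (real \<Rightarrow> real^3) \<Rightarrow> bool" where
  "trajectory Tm Tp r \<longleftrightarrow> Ck 2 {Tm..Tp} r \<and>
     bounded (velocity Tm Tp r ` {Tm..Tp}) \<and> bounded (acceleration Tm Tp r ` {Tm..Tp})"


subsection \<open>Densities and concentration of asymptotic solutions\<close>

locale nls =
  fixes m q chi c :: real
    and G1' :: "real \<Rightarrow> real"
    and D :: "spacetime set"
    and \<phi> :: "spacetime \<Rightarrow> real"
    and A :: "spacetime \<Rightarrow> real^3"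
    and Tm Tp :: real
    and r :: "real \<Rightarrow> real^3"
begin

definition E :: "spacetime \<Rightarrow> real^3" where
  "E p = - grad D \<phi> p - (1 / c) *\<^sub>R dt D A p"

definition B :: "spacetime \<Rightarrow> real^3" where
  "B p = curl D A p"

definition tube :: "real \<Rightarrow> spacetime set" where
  "tube R = {(t, x). t \<in> {Tm..Tp} \<and> x \<in> cball (r t) R}"

definition ball_int :: "real \<Rightarrow> real \<Rightarrow> (spacetime \<Rightarrow> 'b::euclidean_space) \<Rightarrow> 'b" where
  "ball_int R t F = integral (cball (r t) R) (\<lambda>x. F (t, x))"

text \<open>The integrand receives the outer unit normal as its first argument.\<close>

definition sphere_int ::
  "real \<Rightarrow> real \<Rightarrow> (real^3 \<Rightarrow> spacetime \<Rightarrow> 'b::euclidean_space) \<Rightarrow> 'b" where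
  "sphere_int R t F =
     (LINT x : sphere (r t) R | sphere_measure (r t) R. F ((1 / R) *\<^sub>R (x - r t)) (t, x))"

abbreviation v :: "real \<Rightarrow> real^3" where
  "v \<equiv> velocity Tm Tp r"

text \<open>Covariant derivatives of fields on \<open>tube R\<close>; the starred ones are applied to \<open>cnj \<circ> \<psi>\<close>.\<close>

definition cov_t :: "real \<Rightarrow> (spacetime \<Rightarrow> complex) \<Rightarrow> spacetime \<Rightarrow> complex" where
  "cov_t R f p = dt (tube R) f p + \<i> * of_real (q / chi * \<phi> p) * f p"

definition cov_t_star :: "real \<Rightarrow> (spacetime \<Rightarrow> complex) \<Rightarrow> spacetime \<Rightarrow> complex" where
  "cov_t_star R f p = dt (tube R) f p - \<i> * of_real (q / chi * \<phi> p) * f p"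

definition cov_x :: "real \<Rightarrow> 3 \<Rightarrow> (spacetime \<Rightarrow> complex) \<Rightarrow> spacetime \<Rightarrow> complex" where
  "cov_x R j f p = dx (tube R) j f p - \<i> * of_real (q / (chi * c) * (A p $ j)) * f p"

definition cov_x_star :: "real \<Rightarrow> 3 \<Rightarrow> (spacetime \<Rightarrow> complex) \<Rightarrow> spacetime \<Rightarrow> complex" where
  "cov_x_star R j f p = dx (tube R) j f p + \<i> * of_real (q / (chi * c) * (A p $ j)) * f p"

text \<open>The complex expressions under \<open>Re\<close> below are real; \<open>Re\<close> only changes their type.\<close>

definition \<rho> :: "(spacetime \<Rightarrow> complex) \<Rightarrow> spacetime \<Rightarrow> real" where
  "\<rho> \<psi> p = Re (of_real q * \<psi> p * cnj (\<psi> p))"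

definition J :: "real \<Rightarrow> (spacetime \<Rightarrow> complex) \<Rightarrow> spacetime \<Rightarrow> real^3" where
  "J R \<psi> p = (\<chi> j. Re (- \<i> * of_real (q * chi / (2 * m)) *
     (cnj (\<psi> p) * cov_x R j \<psi> p - \<psi> p * cov_x_star R j (cnj \<circ> \<psi>) p)))"

definition P :: "real \<Rightarrow> (spacetime \<Rightarrow> complex) \<Rightarrow> spacetime \<Rightarrow> real^3" where
  "P R \<psi> p = (\<chi> j. Re (\<i> * of_real (chi / 2) *
     (\<psi> p * cov_x_star R j (cnj \<circ> \<psi>) p - cnj (\<psi> p) * cov_x R j \<psi> p)))"

definition f :: "real \<Rightarrow> (spacetime \<Rightarrow> complex) \<Rightarrow> spacetime \<Rightarrow> real^3" where
  "f R \<psi> p = \<rho> \<psi> p *\<^sub>R E p + (1 / c) *\<^sub>R cross3 (J R \<psi> p) (B p)"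

definition u :: "real \<Rightarrow> real \<Rightarrow> (spacetime \<Rightarrow> complex) \<Rightarrow> spacetime \<Rightarrow> real" where
  "u R a \<psi> p = chi\<^sup>2 / (2 * m) *
     ((\<Sum>j\<in>UNIV. (cmod (cov_x R j \<psi> p))\<^sup>2) + Ga G1' a ((cmod (\<psi> p))\<^sup>2))"

definition T :: "real \<Rightarrow> real \<Rightarrow> (spacetime \<Rightarrow> complex) \<Rightarrow> 3 \<Rightarrow> 3 \<Rightarrow> spacetime \<Rightarrow> real" where
  "T R a \<psi> i j p =
     (if i \<noteq> j
      then Re (of_real (chi\<^sup>2 / (2 * m)) *
             (cov_x R i \<psi> p * cov_x_star R j (cnj \<circ> \<psi>) p +
              cov_x R j \<psi> p * cov_x_star R i (cnj \<circ> \<psi>) p))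
      else - u R a \<psi> p +
           Re (of_real (chi\<^sup>2 / m) * cov_x R i \<psi> p * cov_x_star R i (cnj \<circ> \<psi>) p +
               \<i> * of_real (chi / 2) *
                 (cnj (\<psi> p) * cov_t R \<psi> p - \<psi> p * cov_t_star R (cnj \<circ> \<psi>) p)))"

definition charge :: "real \<Rightarrow> (spacetime \<Rightarrow> complex) \<Rightarrow> real \<Rightarrow> real" where
  "charge R \<psi> t = ball_int R t (\<rho> \<psi>)"

definition center :: "real \<Rightarrow> (spacetime \<Rightarrow> complex) \<Rightarrow> real \<Rightarrow> real^3" where
  "center R \<psi> t = (1 / charge R \<psi> t) *\<^sub>R ball_int R t (\<lambda>p. \<rho> \<psi> p *\<^sub>R snd p)"

definition Q0 :: "real \<Rightarrow> real \<Rightarrow> (spacetime \<Rightarrow> complex) \<Rightarrow> real \<Rightarrow> real \<Rightarrow> real^3" where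
  "Q0 R a \<psi> t0 t = (LBINT s=ereal t0..ereal t.
     sphere_int R s (\<lambda>n p. \<chi> j. \<Sum>i\<in>UNIV. n $ i * T R a \<psi> i j p))"

definition Q01 :: "real \<Rightarrow> (spacetime \<Rightarrow> complex) \<Rightarrow> real \<Rightarrow> real \<Rightarrow> real^3" where
  "Q01 R \<psi> t0 t = (LBINT s=ereal t0..ereal t. sphere_int R s (\<lambda>n p. (v s \<bullet> n) *\<^sub>R P R \<psi> p))"

definition Q20 :: "real \<Rightarrow> (spacetime \<Rightarrow> complex) \<Rightarrow> real \<Rightarrow> real^3" where
  "Q20 R \<psi> t = - sphere_int R t (\<lambda>n p. ((v t \<bullet> n) * \<rho> \<psi> p) *\<^sub>R (snd p - center R \<psi> t))"

definition Q22 :: "real \<Rightarrow> (spacetime \<Rightarrow> complex) \<Rightarrow> real \<Rightarrow> real^3" where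
  "Q22 R \<psi> t = sphere_int R t (\<lambda>n p. (n \<bullet> J R \<psi> p) *\<^sub>R (snd p - center R \<psi> t))"

definition Q23 :: "real \<Rightarrow> (spacetime \<Rightarrow> complex) \<Rightarrow> real \<Rightarrow> real \<Rightarrow> real" where
  "Q23 R \<psi> t0 t =
     (LBINT s=ereal t0..ereal t. sphere_int R s (\<lambda>n p. (v s \<bullet> n) * \<rho> \<psi> p)) -
     (LBINT s=ereal t0..ereal t. sphere_int R s (\<lambda>n p. n \<bullet> J R \<psi> p))"

definition Q30 :: "real \<Rightarrow> (spacetime \<Rightarrow> complex) \<Rightarrow> real \<Rightarrow> real^3" where
  "Q30 R \<psi> t = ball_int R t (\<lambda>p. \<rho> \<psi> p *\<^sub>R (E p - E (t, r t)))"

definition Q31 :: "real \<Rightarrow> (spacetime \<Rightarrow> complex) \<Rightarrow> real \<Rightarrow> real^3" where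
  "Q31 R \<psi> t = ball_int R t (\<lambda>p. (1 / c) *\<^sub>R cross3 (J R \<psi> p) (B p - B (t, r t)))"

definition Q0' ::
  "real \<Rightarrow> (spacetime \<Rightarrow> real^3) \<Rightarrow> (3 \<Rightarrow> 3 \<Rightarrow> spacetime \<Rightarrow> real) \<Rightarrow> (spacetime \<Rightarrow> real^3) \<Rightarrow>
   real \<Rightarrow> real \<Rightarrow> real^3" where
  "Q0' R P' T' f' t0 t =
     ball_int R t P' - ball_int R t0 P'
     - (LBINT s=ereal t0..ereal t. sphere_int R s (\<lambda>n p. (v s \<bullet> n) *\<^sub>R P' p))
     + (LBINT s=ereal t0..ereal t. ball_int R s (div_tensor (tube R) T'))
     - (LBINT s=ereal t0..ereal t. ball_int R s f')"

definition Q2' ::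
  "real \<Rightarrow> (spacetime \<Rightarrow> complex) \<Rightarrow> (spacetime \<Rightarrow> real) \<Rightarrow> (spacetime \<Rightarrow> real^3) \<Rightarrow> real \<Rightarrow> real^3" where
  "Q2' R \<psi> \<rho>' J' t =
     ball_int R t (dt (tube R) (\<lambda>p. \<rho>' p *\<^sub>R (snd p - center R \<psi> (fst p))))
     + ball_int R t \<rho>' *\<^sub>R vector_derivative (center R \<psi>) (at t within {Tm..Tp})
     + sphere_int R t (\<lambda>n p. (n \<bullet> J' p) *\<^sub>R (snd p - center R \<psi> t))
     - ball_int R t J'"

definition Q3' ::
  "real \<Rightarrow> (spacetime \<Rightarrow> real) \<Rightarrow> (spacetime \<Rightarrow> real^3) \<Rightarrow> real \<Rightarrow> real \<Rightarrow> real" where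
  "Q3' R \<rho>' J' t0 t =
     ball_int R t \<rho>' - ball_int R t0 \<rho>'
     - (LBINT s=ereal t0..ereal t. sphere_int R s (\<lambda>n p. (v s \<bullet> n) * \<rho>' p))
     + (LBINT s=ereal t0..ereal t. sphere_int R s (\<lambda>n p. n \<bullet> J' p))"

text \<open>The perturbed conservation laws.  The perturbation terms are taken regular enough for all the
  expressions formed from them to be classical.\<close>

definition perturbed_laws ::
  "real \<Rightarrow> real \<Rightarrow> (spacetime \<Rightarrow> complex) \<Rightarrow> (spacetime \<Rightarrow> real) \<Rightarrow> (spacetime \<Rightarrow> real^3) \<Rightarrow>
   (spacetime \<Rightarrow> real^3) \<Rightarrow> (3 \<Rightarrow> 3 \<Rightarrow> spacetime \<Rightarrow> real) \<Rightarrow> (spacetime \<Rightarrow> real^3) \<Rightarrow> bool" where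
  "perturbed_laws R a \<psi> \<rho>' J' P' T' f' \<longleftrightarrow>
     Ck 1 (tube R) \<rho>' \<and> Ck 1 (tube R) J' \<and> Ck 1 (tube R) P' \<and> (\<forall>i j. Ck 1 (tube R) (T' i j)) \<and>
     continuous_on (tube R) f' \<and>
     (\<forall>p\<in>tube R. dt (tube R) (\<rho> \<psi>) p + dt (tube R) \<rho>' p
        + div3 (tube R) (J R \<psi>) p + div3 (tube R) J' p = 0) \<and>
     (\<forall>p\<in>tube R. dt (tube R) (P R \<psi>) p + dt (tube R) P' p
        + div_tensor (tube R) (T R a \<psi>) p + div_tensor (tube R) T' p = f R \<psi> p + f' p)"

definition tends_to_0 :: "(nat \<Rightarrow> real \<Rightarrow> 'b::real_normed_vector) \<Rightarrow> bool" where
  "tends_to_0 Q \<longleftrightarrow> uniform_limit {Tm..Tp} Q (\<lambda>_. 0) sequentially"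

definition concentration_trajectory :: bool where
  "concentration_trajectory \<longleftrightarrow>
     nonlinearity_condition G1' \<and>
     (\<exists>(a :: nat \<Rightarrow> real) (R :: nat \<Rightarrow> real) (\<psi> :: nat \<Rightarrow> spacetime \<Rightarrow> complex) (t0 :: real).
       (\<forall>n. a n > 0) \<and> (\<forall>n. R n > 0) \<and>
       a \<longlonglongrightarrow> 0 \<and> R \<longlonglongrightarrow> 0 \<and> filterlim (\<lambda>n. R n / a n) at_top sequentially \<and>
       (\<forall>n. tube (R n) \<subseteq> D) \<and> (\<forall>n. Ck 2 (tube (R n)) (\<psi> n)) \<and> t0 \<in> {Tm..Tp} \<and>
       (\<exists>\<rho>' J' P' T' f'.
          (\<forall>n. perturbed_laws (R n) (a n) (\<psi> n) (\<rho>' n) (J' n) (P' n) (T' n) (f' n)) \<and>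
          tends_to_0 (\<lambda>n. Q0' (R n) (P' n) (T' n) (f' n) t0) \<and>
          tends_to_0 (\<lambda>n. Q2' (R n) (\<psi> n) (\<rho>' n) (J' n)) \<and>
          tends_to_0 (\<lambda>n. Q3' (R n) (\<rho>' n) (J' n) t0)) \<and>
       (\<exists>C. \<forall>n. \<forall>t\<in>{Tm..Tp}. norm (ball_int (R n) t (P (R n) (\<psi> n))) \<le> C) \<and>
       (\<exists>C c0 n0. c0 > 0 \<and>
          (\<forall>n\<ge>n0. \<forall>t\<in>{Tm..Tp}. c0 \<le> charge (R n) (\<psi> n) t \<and> charge (R n) (\<psi> n) t \<le> C)) \<and>
       (\<exists>\<rho>inf. (\<lambda>n. charge (R n) (\<psi> n) t0) \<longlonglongrightarrow> \<rho>inf) \<and>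
       tends_to_0 (\<lambda>n. Q0 (R n) (a n) (\<psi> n) t0) \<and>
       tends_to_0 (\<lambda>n. Q01 (R n) (\<psi> n) t0) \<and>
       tends_to_0 (\<lambda>n. Q20 (R n) (\<psi> n)) \<and>
       tends_to_0 (\<lambda>n. Q22 (R n) (\<psi> n)) \<and>
       tends_to_0 (\<lambda>n. Q23 (R n) (\<psi> n) t0) \<and>
       tends_to_0 (\<lambda>n t. LBINT s=ereal t0..ereal t. Q30 (R n) (\<psi> n) s + Q31 (R n) (\<psi> n) s))"

definition newton_law :: bool where
  "newton_law \<longleftrightarrow> (\<forall>t\<in>{Tm..Tp}. m *\<^sub>R acceleration Tm Tp r t =
     q *\<^sub>R E (t, r t) + (q / c) *\<^sub>R cross3 (v t) (B (t, r t)))"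

end

end

(* Integrating the perturbed conservation laws over the moving balls gives exact balances for the
   momentum, the charge and the charge center.  In the limit the momentum is m/q times the charge times
   the velocity of the center, so the velocities converge, up to their initial values, to the integral
   of the Lorentz force along the trajectory; integrating once more, and using that the centers
   converge to the trajectory, yields Newton's law.

   Conversely, the laws need only hold up to perturbations whose integrated effect vanishes, so it
   suffices to take wave packets that vanish to second order on the boundary of the moving ball, with
   a phase whose gradient is close to m v + (q/c) A on the trajectory: all surface terms are zero, the
   residual of the momentum law is put into f', and its time integral tends to 0 precisely by Newton's
   law. *)

theory Submission
  imports Defs
begin

subsection \<open>Derivatives within a set and the classes Ck\<close>

text \<open>Fields live on closed, curved tubes, so derivatives are one-sided at the boundary. Their
  uniqueness (\<open>solid\<close>) has to come first; it makes \<open>pd\<close> computable by the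
  usual rules.

  The surface measure is defined by cones in the unit ball, and the divergence theorem is derived
  from that: the derivative of a function times a radial cutoff has integral zero, and the shell
  where the cutoff varies is then shrunk.

  In the direct part, positivity of the charge density forces the centers to converge, but nothing
  forces their velocities to. Hence the magnetic term is integrated by parts, and the limit of the
  initial velocities is recovered last, from the displacement at one second time.

  In the converse, a packet carried rigidly by the trajectory transports its charge with velocity v,
  so J' = rho v - J makes the charge law exact with rho' = 0. The target for the phase gradient is a
  function of time with too few derivatives; polynomials approximate it uniformly. Their derivatives
  are uncontrolled, but they are absorbed in f', whose integral the exact momentum balance evaluates
  without estimating them.\<close>

text \<open>Uniqueness of derivatives within \<open>S\<close>.  A definition cannot quantify over the type of the values,
  so it is stated for real-valued functions; \<open>solid_unique\<close> is the general case.\<close>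

definition solid :: "'a::real_normed_vector set \<Rightarrow> bool" where
  "solid S \<longleftrightarrow> (\<forall>p\<in>S. \<forall>L::'a \<Rightarrow> real. ((\<lambda>_. 0) has_derivative L) (at p within S) \<longrightarrow> L = (\<lambda>_. 0))"

text \<open>Pairing with the fixed vector \<open>L1 h - L2 h\<close> reduces the claim to a scalar
  derivative of the zero function; the inner product on the target supplies the functional.\<close>

lemma solid_unique:
  fixes F :: "'a::real_normed_vector \<Rightarrow> 'b::real_inner"
  assumes "solid S" "p \<in> S"
    and L1: "(F has_derivative L1) (at p within S)" and L2: "(F has_derivative L2) (at p within S)"
  shows "L1 = L2"
proof
  fix h
  have "((\<lambda>x. (F x - F x) \<bullet> (L1 h - L2 h)) has_derivative (\<lambda>k. (L1 k - L2 k) \<bullet> (L1 h - L2 h)))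
      (at p within S)"
    by (intro has_derivative_inner_left has_derivative_diff L1 L2)
  then have "(\<lambda>k. (L1 k - L2 k) \<bullet> (L1 h - L2 h)) = (\<lambda>_. 0)"
    using assms(1,2) unfolding solid_def by simp
  from fun_cong[OF this, of h] have "(L1 h - L2 h) \<bullet> (L1 h - L2 h) = 0" .
  then show "L1 h = L2 h" by simp
qed

lemma solid_open:
  assumes "open S" shows "solid S"
  unfolding solid_def
proof (intro ballI allI impI)
  fix p and L :: "'a \<Rightarrow> real"
  assume "p \<in> S" and "((\<lambda>_. 0) has_derivative L) (at p within S)"
  then have "((\<lambda>_. 0) has_derivative L) (at p)"
    using assms by (simp only: at_within_open)
  then show "L = (\<lambda>_. 0)" by (rule has_derivative_unique[OF _ has_derivative_const])
qed

text \<open>Along a segment from \<open>p\<close> into \<open>S\<close>, \<open>L\<close> is a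
  one-sided derivative of a constant, so it vanishes on all \<open>x - p\<close> with
  \<open>x\<close> in \<open>S\<close>. Around an interior point, differences of such vectors fill a
  ball and hence span the space.\<close>

lemma solid_convex:
  assumes "convex S" "interior S \<noteq> {}" shows "solid S"
  unfolding solid_def
proof (intro ballI allI impI)
  fix p and L :: "'a \<Rightarrow> real"
  assume p: "p \<in> S" and D: "((\<lambda>_. 0) has_derivative L) (at p within S)"
  interpret L: bounded_linear L using D by (rule has_derivative_bounded_linear)
  have seg: "L (x - p) = 0" if x: "x \<in> S" for x
  proof -
    have img: "(\<lambda>s::real. p + s *\<^sub>R (x - p)) ` {0..1} \<subseteq> S"
    proof
      fix y assume "y \<in> (\<lambda>s::real. p + s *\<^sub>R (x - p)) ` {0..1}"
      then obtain s where s: "s \<in> {0..1}" "y = p + s *\<^sub>R (x - p)" by auto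
      then have "y = (1 - s) *\<^sub>R p + s *\<^sub>R x" by (simp add: algebra_simps)
      then show "y \<in> S" using s convexD[OF assms(1) p x, of "1 - s" s] by auto
    qed
    have "((\<lambda>s::real. p + s *\<^sub>R (x - p)) has_derivative (\<lambda>s. s *\<^sub>R (x - p))) (at 0 within {0..1})"
      by (auto intro!: derivative_eq_intros)
    from has_derivative_in_compose[OF this, of "\<lambda>_. 0" L]
    have "((\<lambda>_. 0) has_derivative (\<lambda>s. L (s *\<^sub>R (x - p)))) (at (0::real) within {0..1})"
      using has_derivative_subset[OF D img] by simp
    then have "((\<lambda>_. 0) has_vector_derivative L (x - p)) (at (0::real) within {0..1})"
      by (simp add: has_vector_derivative_def L.scaleR)
    moreover have "((\<lambda>_. 0) has_vector_derivative (0::real)) (at (0::real) within {0..1})" by simp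
    ultimately show ?thesis
      using vector_derivative_unique_within_closed_interval[of 0 1 0 "\<lambda>_. 0" "L (x - p)" 0] by simp
  qed
  from assms(2) obtain x0 where "x0 \<in> interior S" by auto
  then obtain e where e: "e > 0" "cball x0 e \<subseteq> S"
    by (meson mem_interior_cball)
  show "L = (\<lambda>_. 0)"
  proof
    fix h :: 'a
    show "L h = 0"
    proof (cases "h = 0")
      case False
      \<comment> \<open>\<open>h\<close> is rescaled to length \<open>e\<close>, so that
        \<open>x0\<close> and \<open>x0 + k\<close> both lie in \<open>S\<close>; only directions
        matter for \<open>L\<close>.\<close>
      define k where "k = (e / norm h) *\<^sub>R h"
      have "x0 + k \<in> S" "x0 \<in> S" using e by (auto simp: k_def dist_norm False)
      then have "L ((x0 + k) - p) - L (x0 - p) = 0" using seg by simp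
      then have "L k = 0" by (simp add: L.diff[symmetric])
      then show ?thesis using e False by (simp add: k_def L.scaleR)
    qed (simp add: L.zero)
  qed
qed

lemma solid_cball:
  fixes z :: "'a::euclidean_space"
  assumes "R > 0" shows "solid (cball z R)"
proof (rule solid_convex[OF convex_cball])
  have "z \<in> interior (cball z R)" using assms by (simp only: interior_cball centre_in_ball)
  then show "interior (cball z R) \<noteq> {}" by blast
qed

lemma solid_interval:
  fixes a b :: real
  assumes "a < b" shows "solid {a..b}"
proof (rule solid_convex)
  have "(a + b) / 2 \<in> interior {a..b}" using assms by (simp only: interior_atLeastAtMost_real) simp
  then show "interior {a..b} \<noteq> {}" by blast
qed (rule convex_real_interval)

lemma solid_UNIV [simp]: "solid (UNIV :: 'a::real_normed_vector set)"
  by (rule solid_open[OF open_UNIV])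

lemma pd_eq:
  fixes F :: "'a::real_normed_vector \<Rightarrow> 'b::real_inner"
  assumes "solid S" "p \<in> S" "(F has_derivative F') (at p within S)"
  shows "pd S h F p = F' h"
proof -
  have "(F has_derivative frechet_derivative F (at p within S)) (at p within S)"
    using differentiableI[OF assms(3)] by (simp only: frechet_derivative_works)
  from solid_unique[OF assms(1,2) this assms(3)] show ?thesis by (simp add: pd_def)
qed

text \<open>No differentiability is assumed: \<open>frechet_derivative\<close> is a choice among all
  derivatives, and \<open>F\<close> and \<open>G\<close> have the same ones at
  \<open>p\<close>.\<close>

lemma pd_cong:
  assumes "\<And>x. x \<in> S \<Longrightarrow> F x = G x" "p \<in> S"
  shows "pd S h F p = pd S h G p"
proof -
  have "(F has_derivative L) (at p within S) \<longleftrightarrow> (G has_derivative L) (at p within S)" for L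
    using assms by (metis has_derivative_transform)
  then show ?thesis by (simp add: pd_def frechet_derivative_def)
qed

lemma Ck_cong:
  assumes "\<And>x. x \<in> S \<Longrightarrow> F x = G x" and "Ck k S F"
  shows "Ck k S G"
  using assms
proof (induction k arbitrary: F G)
  case 0
  then show ?case by (auto intro: continuous_on_eq)
next
  case (Suc k)
  have "G differentiable_on S"
    using Suc.prems unfolding Ck.simps differentiable_on_def by (metis differentiable_transform_within zero_less_one)
  moreover have "Ck k S (pd S h G)" for h
    using Suc.IH[OF pd_cong[of S F G]] Suc.prems by auto
  ultimately show ?case by simp
qed

text \<open>The way all closure properties are proved: on a solid set an explicit formula for the
  derivative may replace the chosen one in \<open>pd\<close>.\<close>

lemma Ck_SucI:
  fixes F :: "'a::real_normed_vector \<Rightarrow> 'b::real_inner"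
  assumes "solid S" "\<And>p. p \<in> S \<Longrightarrow> (F has_derivative F' p) (at p within S)"
    and "\<And>h. Ck k S (\<lambda>p. F' p h)"
  shows "Ck (Suc k) S F"
proof -
  have "F differentiable_on S"
    using assms(2) by (auto simp: differentiable_on_def differentiable_def)
  moreover have "Ck k S (pd S h F)" for h
    by (rule Ck_cong[OF _ assms(3)[of h]]) (simp add: pd_eq[OF assms(1) _ assms(2)])
  ultimately show ?thesis by simp
qed

lemma Ck_Suc_deriv:
  assumes "Ck (Suc k) S F" "p \<in> S"
  shows "(F has_derivative (\<lambda>h. pd S h F p)) (at p within S)"
  using assms by (simp add: pd_def differentiable_on_def frechet_derivative_works)

lemma Ck_Suc_imp: "Ck (Suc k) S F \<Longrightarrow> Ck k S F"
proof (induction k arbitrary: F)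
  case 0
  then show ?case by (simp add: differentiable_imp_continuous_on)
qed auto

lemma Ck_imp_continuous: "Ck k S F \<Longrightarrow> continuous_on S F"
  by (induction k) (auto simp: differentiable_imp_continuous_on)

text \<open>\<open>Ck\<close> speaks of fixed directions. When the direction itself depends on the
  point, as in the chain rule, it is expanded into finitely many fixed ones.\<close>

lemma pd_Basis:
  fixes F :: "'a::euclidean_space \<Rightarrow> 'b::real_normed_vector"
  assumes "Ck (Suc k) S F" "p \<in> S"
  shows "pd S h F p = (\<Sum>b\<in>Basis. (h \<bullet> b) *\<^sub>R pd S b F p)"
proof -
  interpret bounded_linear "\<lambda>h. pd S h F p"
    using Ck_Suc_deriv[OF assms] by (rule has_derivative_bounded_linear)
  have "pd S h F p = pd S (\<Sum>b\<in>Basis. (h \<bullet> b) *\<^sub>R b) F p"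
    by (simp add: euclidean_representation)
  then show ?thesis by (simp only: sum scaleR)
qed

lemma Ck_const:
  fixes z :: "'b::real_inner"
  assumes "solid S" shows "Ck k S (\<lambda>_. z)"
proof (induction k arbitrary: z)
  case (Suc k)
  show ?case by (rule Ck_SucI[OF assms, where F' = "\<lambda>_ _. 0"]) (auto intro: Suc)
qed simp

lemma Ck_id:
  fixes S :: "'a::real_inner set"
  assumes "solid S" shows "Ck k S (\<lambda>p. p)"
proof (cases k)
  case (Suc j)
  show ?thesis unfolding Suc
    by (rule Ck_SucI[OF assms, where F' = "\<lambda>_ h. h"]) (auto intro: Ck_const assms)
qed simp

lemma Ck_linear:
  fixes F :: "'a::real_normed_vector \<Rightarrow> 'b::real_inner" and L :: "'b \<Rightarrow> 'c::real_inner"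
  assumes "solid S" "bounded_linear L" "Ck k S F"
  shows "Ck k S (\<lambda>p. L (F p))"
  using assms(3)
proof (induction k arbitrary: F)
  case 0
  then show ?case using bounded_linear.continuous_on[OF assms(2)] by auto
next
  case (Suc k)
  show ?case
    by (rule Ck_SucI[OF assms(1) bounded_linear.has_derivative[OF assms(2) Ck_Suc_deriv[OF Suc.prems]]])
       (use Suc in auto)
qed

lemma pd_linear:
  fixes F :: "'a::real_normed_vector \<Rightarrow> 'b::real_inner" and L :: "'b \<Rightarrow> 'c::real_inner"
  assumes "solid S" "bounded_linear L" "Ck (Suc k) S F" "p \<in> S"
  shows "pd S h (\<lambda>p. L (F p)) p = L (pd S h F p)"
  by (rule pd_eq[OF assms(1,4) bounded_linear.has_derivative[OF assms(2) Ck_Suc_deriv[OF assms(3,4)]]])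

lemma Ck_add:
  fixes F G :: "'a::real_normed_vector \<Rightarrow> 'b::real_inner"
  assumes "solid S" "Ck k S F" "Ck k S G"
  shows "Ck k S (\<lambda>p. F p + G p)"
  using assms(2,3)
proof (induction k arbitrary: F G)
  case 0
  then show ?case by (simp add: continuous_on_add)
next
  case (Suc k)
  show ?case
    by (rule Ck_SucI[OF assms(1) has_derivative_add[OF Ck_Suc_deriv[OF Suc.prems(1)] Ck_Suc_deriv[OF Suc.prems(2)]]])
       (use Suc in auto)
qed

lemma Ck_minus:
  fixes F :: "'a::real_normed_vector \<Rightarrow> 'b::real_inner"
  assumes "solid S" "Ck k S F"
  shows "Ck k S (\<lambda>p. - F p)"
  by (rule Ck_linear[OF assms(1) _ assms(2)]) (rule bounded_linear_minus[OF bounded_linear_ident])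

lemma Ck_diff:
  fixes F G :: "'a::real_normed_vector \<Rightarrow> 'b::real_inner"
  assumes "solid S" "Ck k S F" "Ck k S G"
  shows "Ck k S (\<lambda>p. F p - G p)"
  using Ck_add[OF assms(1,2) Ck_minus[OF assms(1,3)]] by simp

lemma Ck_sum:
  fixes F :: "'i \<Rightarrow> 'a::real_normed_vector \<Rightarrow> 'b::real_inner"
  assumes "solid S" "\<And>i. i \<in> I \<Longrightarrow> Ck k S (F i)"
  shows "Ck k S (\<lambda>p. \<Sum>i\<in>I. F i p)"
  using assms(2) by (induction I rule: infinite_finite_induct) (auto intro: Ck_const Ck_add assms(1))

text \<open>Real and complex products, scalings and inner products are all instances of this one
  product rule.\<close>

lemma Ck_bilinear:
  fixes F :: "'a::real_normed_vector \<Rightarrow> 'b::real_inner" and G :: "'a \<Rightarrow> 'c::real_inner"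
    and bil :: "'b \<Rightarrow> 'c \<Rightarrow> 'd::real_inner"
  assumes "solid S" "bounded_bilinear bil" "Ck k S F" "Ck k S G"
  shows "Ck k S (\<lambda>p. bil (F p) (G p))"
  using assms(3,4)
proof (induction k arbitrary: F G)
  case 0
  then show ?case using bounded_bilinear.continuous_on[OF assms(2)] by auto
next
  case (Suc k)
  show ?case
  proof (rule Ck_SucI[OF assms(1) bounded_bilinear.FDERIV[OF assms(2)
            Ck_Suc_deriv[OF Suc.prems(1)] Ck_Suc_deriv[OF Suc.prems(2)]]])
    fix h
    show "Ck k S (\<lambda>p. bil (F p) (pd S h G p) + bil (pd S h F p) (G p))"
      using Suc.prems Ck_Suc_imp[OF Suc.prems(1)] Ck_Suc_imp[OF Suc.prems(2)]
      by (intro Ck_add[OF assms(1)] Suc.IH) auto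
  qed
qed

lemma pd_bilinear:
  fixes F :: "'a::real_normed_vector \<Rightarrow> 'b::real_inner" and G :: "'a \<Rightarrow> 'c::real_inner"
    and bil :: "'b \<Rightarrow> 'c \<Rightarrow> 'd::real_inner"
  assumes "solid S" "bounded_bilinear bil" "Ck (Suc k) S F" "Ck (Suc k) S G" "p \<in> S"
  shows "pd S h (\<lambda>p. bil (F p) (G p)) p = bil (F p) (pd S h G p) + bil (pd S h F p) (G p)"
  by (rule pd_eq[OF assms(1,5) bounded_bilinear.FDERIV[OF assms(2)
        Ck_Suc_deriv[OF assms(3,5)] Ck_Suc_deriv[OF assms(4,5)]]])

text \<open>The inner derivative enters as a direction of \<open>pd\<close> that varies with the
  point. Expanding it in \<open>Basis\<close> leaves products of functions of class
  \<open>k\<close>, to which the induction hypothesis applies.\<close>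

lemma Ck_comp:
  fixes G :: "'a::real_normed_vector \<Rightarrow> 'b::euclidean_space" and F :: "'b \<Rightarrow> 'c::real_inner"
  assumes "solid S" "Ck k S G" "Ck k U F" "G ` S \<subseteq> U"
  shows "Ck k S (\<lambda>p. F (G p))"
  using assms(2,3)
proof (induction k arbitrary: F)
  case 0
  then show ?case using continuous_on_compose2[of U F S G] assms(4) by simp
next
  case (Suc k)
  have deriv: "((\<lambda>p. F (G p)) has_derivative (\<lambda>h. pd U (pd S h G p) F (G p))) (at p within S)"
    if "p \<in> S" for p
    using has_derivative_in_compose[OF Ck_Suc_deriv[OF Suc.prems(1) that]
        has_derivative_subset[OF Ck_Suc_deriv[OF Suc.prems(2)] assms(4)]] assms(4) that by auto
  have lin: "pd U y F (G p) = (\<Sum>b\<in>Basis. (y \<bullet> b) *\<^sub>R pd U b F (G p))" if "p \<in> S" for p y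
    by (rule pd_Basis[OF Suc.prems(2)]) (use assms(4) that in auto)
  show ?case
  proof (rule Ck_SucI[OF assms(1) deriv])
    fix h
    have "Ck k S (\<lambda>p. \<Sum>b\<in>Basis. (pd S h G p \<bullet> b) *\<^sub>R pd U b F (G p))"
      using Suc.prems Ck_Suc_imp[OF Suc.prems(1)]
      by (intro Ck_sum[OF assms(1)] Ck_bilinear[OF assms(1) bounded_bilinear_scaleR]
          Ck_linear[OF assms(1) bounded_linear_inner_left] Suc.IH) auto
    then show "Ck k S (\<lambda>p. pd U (pd S h G p) F (G p))"
      by (rule Ck_cong[rotated]) (simp add: lin)
  qed
qed

lemma pd_comp:
  fixes G :: "'a::real_normed_vector \<Rightarrow> 'b::euclidean_space" and F :: "'b \<Rightarrow> 'c::real_inner"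
  assumes "solid S" "Ck (Suc k) S G" "Ck (Suc k) U F" "G ` S \<subseteq> U" "p \<in> S"
  shows "pd S h (\<lambda>p. F (G p)) p = pd U (pd S h G p) F (G p)"
proof -
  have "((\<lambda>p. F (G p)) has_derivative (\<lambda>h. pd U (pd S h G p) F (G p))) (at p within S)"
    using has_derivative_in_compose[OF Ck_Suc_deriv[OF assms(2,5)]
        has_derivative_subset[OF Ck_Suc_deriv[OF assms(3)] assms(4)]] assms(4,5) by auto
  from pd_eq[OF assms(1,5) this] show ?thesis .
qed

lemma Ck_subset:
  fixes F :: "'a::euclidean_space \<Rightarrow> 'b::real_inner"
  assumes "solid S" "Ck k U F" "S \<subseteq> U"
  shows "Ck k S F"
  using Ck_comp[OF assms(1) Ck_id[OF assms(1)] assms(2)] assms(3) by simp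

lemma Ck_exp: "Ck k UNIV (exp :: complex \<Rightarrow> complex)"
proof (induction k)
  case (Suc k)
  show ?case
  proof (rule Ck_SucI[where F' = "\<lambda>z h. exp z * h"])
    show "(exp has_derivative (\<lambda>h. exp z * h)) (at z within UNIV)" for z :: complex
      using DERIV_exp[of z] by (simp add: has_field_derivative_def)
    show "Ck k UNIV (\<lambda>z. exp z * h)" for h :: complex
      using Ck_linear[OF solid_UNIV bounded_linear_mult_left Suc] .
  qed simp
qed (unfold Ck.simps, rule continuous_on_exp[OF continuous_on_id])

lemma Ck_polynomial:
  fixes F :: "real \<Rightarrow> 'b::euclidean_space"
  assumes "solid S" "polynomial_function F"
  shows "Ck k S F"
  using assms(2)
proof (induction k arbitrary: F)
  case 0
  then show ?case by (simp add: continuous_on_polymonial_function)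
next
  case (Suc k)
  from has_vector_derivative_polynomial_function[OF Suc.prems] obtain F' where
    F': "polynomial_function F'" "\<And>x. (F has_vector_derivative F' x) (at x)" by metis
  show ?case
  proof (rule Ck_SucI[OF assms(1)])
    show "(F has_derivative (\<lambda>h. h *\<^sub>R F' x)) (at x within S)" for x
      using F'(2)[of x] by (auto simp: has_vector_derivative_def intro: has_derivative_at_withinI)
    show "Ck k S (\<lambda>x. h *\<^sub>R F' x)" for h
      by (intro Ck_linear[OF assms(1) bounded_linear_scaleR_right] Suc.IH F')
  qed
qed

section \<open>Bounds, Lipschitz constants and difference quotients\<close>

lemma bounded_on_compact:
  fixes F :: "'a::metric_space \<Rightarrow> 'b::real_normed_vector"
  assumes "compact S" "continuous_on S F"
  obtains M where "M \<ge> 0" "\<And>x. x \<in> S \<Longrightarrow> norm (F x) \<le> M"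
proof -
  have "bounded (F ` S)"
    using compact_continuous_image[OF assms(2,1)] by (rule compact_imp_bounded)
  then obtain M where "\<forall>x\<in>S. norm (F x) \<le> M" unfolding bounded_iff by blast
  then show ?thesis using that[of "max M 0"] by (meson max.cobounded2 max.coboundedI1)
qed

text \<open>Compactness bounds the finitely many basis derivatives, convexity allows the mean value
  inequality. The constant later dominates difference quotients and compares values across thin
  shells.\<close>

lemma Ck_lipschitz:
  fixes F :: "'a::euclidean_space \<Rightarrow> 'b::euclidean_space"
  assumes S: "compact S" "convex S" and F: "Ck (Suc k) S F"
  obtains L where "L \<ge> 0" "\<And>x y. x \<in> S \<Longrightarrow> y \<in> S \<Longrightarrow> norm (F x - F y) \<le> L * norm (x - y)"
proof -
  have "\<exists>M. \<forall>x\<in>S. norm (pd S b F x) \<le> M" for b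
  proof -
    have "continuous_on S (pd S b F)" using F by (auto intro: Ck_imp_continuous)
    from bounded_on_compact[OF S(1) this] show ?thesis by metis
  qed
  then obtain M where M: "\<And>b x. x \<in> S \<Longrightarrow> norm (pd S b F x) \<le> M b" by metis
  define L where "L = (\<Sum>b\<in>Basis. \<bar>M b\<bar>)"
  have on: "onorm (\<lambda>h. pd S h F x) \<le> L" if x: "x \<in> S" for x
  proof (rule onorm_bound)
    show "0 \<le> L" by (simp add: L_def sum_nonneg)
    fix h
    have "norm (pd S h F x) \<le> (\<Sum>b\<in>Basis. norm ((h \<bullet> b) *\<^sub>R pd S b F x))"
      by (subst pd_Basis[OF F x]) (rule norm_sum)
    also have "\<dots> \<le> (\<Sum>b\<in>Basis. norm h * \<bar>M b\<bar>)"
    proof (rule sum_mono)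
      fix b :: 'a assume "b \<in> Basis"
      then show "norm ((h \<bullet> b) *\<^sub>R pd S b F x) \<le> norm h * \<bar>M b\<bar>"
        unfolding norm_scaleR using M[OF x, of b] by (intro mult_mono) (auto simp: Basis_le_norm)
    qed
    also have "\<dots> = L * norm h" by (simp add: L_def sum_distrib_left mult.commute)
    finally show "norm (pd S h F x) \<le> L * norm h" .
  qed
  have "norm (F x - F y) \<le> L * norm (x - y)" if "x \<in> S" "y \<in> S" for x y
    by (rule differentiable_bound[OF S(2) Ck_Suc_deriv[OF F] on that])
  moreover have "0 \<le> L" by (simp add: L_def sum_nonneg)
  ultimately show ?thesis using that by blast
qed

text \<open>Dominated convergence is a statement about sequences; this form lets it act directly on
  difference quotients, including one-sided ones.\<close>

lemma has_vector_derivative_iff_sequentially: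
  "(F has_vector_derivative D) (at x within S) \<longleftrightarrow>
   (\<forall>X. (\<forall>i. X i \<in> S - {x}) \<longrightarrow> X \<longlonglongrightarrow> x \<longrightarrow> (\<lambda>i. (F (X i) - F x) /\<^sub>R (X i - x)) \<longlonglongrightarrow> D)"
proof -
  have eq: "norm (((F y - F x) - (y - x) *\<^sub>R D) /\<^sub>R norm (y - x)) = norm ((F y - F x) /\<^sub>R (y - x) - D)"
    if "y \<noteq> x" for y
  proof -
    have "(F y - F x) /\<^sub>R (y - x) - D = ((F y - F x) - (y - x) *\<^sub>R D) /\<^sub>R (y - x)"
      using that by (simp add: scaleR_diff_right)
    then show ?thesis by (simp only: norm_scaleR abs_inverse real_norm_def abs_abs)
  qed
  have "(F has_vector_derivative D) (at x within S) \<longleftrightarrow>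
    ((\<lambda>y. ((F y - F x) - (y - x) *\<^sub>R D) /\<^sub>R norm (y - x)) \<longlongrightarrow> 0) (at x within S)"
    by (simp add: has_vector_derivative_def has_derivative_at_within bounded_linear_scaleR_left)
  also have "\<dots> \<longleftrightarrow> ((\<lambda>y. norm (((F y - F x) - (y - x) *\<^sub>R D) /\<^sub>R norm (y - x))) \<longlongrightarrow> 0) (at x within S)"
    by (simp only: tendsto_norm_zero_iff)
  also have "\<dots> \<longleftrightarrow> ((\<lambda>y. norm ((F y - F x) /\<^sub>R (y - x) - D)) \<longlongrightarrow> 0) (at x within S)"
    by (rule tendsto_cong, unfold eventually_at_filter, rule always_eventually) (use eq in blast)
  also have "\<dots> \<longleftrightarrow> ((\<lambda>y. (F y - F x) /\<^sub>R (y - x)) \<longlongrightarrow> D) (at x within S)"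
    by (simp only: tendsto_norm_zero_iff LIM_zero_iff)
  finally show ?thesis by (simp add: tendsto_at_iff_sequentially o_def)
qed

section \<open>Directional derivatives of compactly supported Lipschitz functions\<close>

lemma lborel_integral_shift:
  fixes g :: "'a::euclidean_space \<Rightarrow> 'b::euclidean_space"
  assumes "g \<in> borel_measurable borel"
  shows "(\<integral>x. g (x + a) \<partial>lborel) = (\<integral>x. g x \<partial>lborel)"
    and "integrable lborel g \<Longrightarrow> integrable lborel (\<lambda>x. g (x + a))"
proof -
  have "(\<integral>x. g x \<partial>distr lborel borel ((+) a)) = (\<integral>x. g (a + x) \<partial>lborel)"
    using assms by (intro integral_distr) auto
  then show "(\<integral>x. g (x + a) \<partial>lborel) = (\<integral>x. g x \<partial>lborel)"
    by (simp only: lborel_distr_plus add.commute)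
  have "integrable (distr lborel borel ((+) a)) g \<longleftrightarrow> integrable lborel (\<lambda>x. g (a + x))"
    using assms by (intro integrable_distr_eq) auto
  then show "integrable lborel (\<lambda>x. g (x + a))" if "integrable lborel g"
    using that by (simp only: lborel_distr_plus add.commute)
qed

text \<open>By translation invariance, all difference quotients of \<open>g\<close> have integral zero.\<close>

lemma integral_directional_derivative_zero:
  fixes g g' :: "'a::euclidean_space \<Rightarrow> 'b::euclidean_space"
  assumes L: "L \<ge> 0" and lip: "\<And>x y. norm (g x - g y) \<le> L * norm (x - y)"
    and supp: "\<And>x. norm x > R \<Longrightarrow> g x = 0"
    and g': "g' \<in> borel_measurable lborel"
    and deriv: "AE x in lborel. \<exists>G. (g has_derivative G) (at x) \<and> G e = g' x"
  shows "(\<integral>x. g' x \<partial>lborel) = 0"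
proof -
  define s where "s k = inverse (real (Suc k))" for k
  have s: "s k > 0" "s k \<le> 1" "s k \<noteq> 0" for k by (auto simp: s_def field_simps)
  define Dq where "Dq k x = (g (x + s k *\<^sub>R e) - g x) /\<^sub>R s k" for k x
  have "L-lipschitz_on UNIV g" using lip L by (intro lipschitz_onI) (auto simp: dist_norm)
  then have cont: "continuous_on UNIV g" by (rule lipschitz_on_continuous_on)
  then have meas: "g \<in> borel_measurable borel" by (rule borel_measurable_continuous_onI)
  have "integrable lborel (\<lambda>x. indicator (cball 0 R) x *\<^sub>R g x)"
    using cont by (intro borel_integrable_compact) (auto intro: continuous_on_subset)
  also have "(\<lambda>x. indicator (cball 0 R) x *\<^sub>R g x) = g"
    using supp by (auto simp: indicator_def)
  finally have int: "integrable lborel g" .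
  have int0: "(\<integral>x. Dq k x \<partial>lborel) = 0" for k
    unfolding Dq_def using int lborel_integral_shift[OF meas, of "s k *\<^sub>R e"] by simp
  have "(\<lambda>k. \<integral>x. Dq k x \<partial>lborel) \<longlonglongrightarrow> (\<integral>x. g' x \<partial>lborel)"
  proof (rule integral_dominated_convergence)
    show "g' \<in> borel_measurable lborel" by fact
    show "Dq k \<in> borel_measurable lborel" for k
      unfolding Dq_def using int lborel_integral_shift[OF meas, of "s k *\<^sub>R e"] by simp
    \<comment> \<open>Since \<open>s k \<le> 1\<close>, for \<open>norm x > R + norm e\<close> both
      \<open>x\<close> and \<open>x + s k e\<close> lie outside the support; elsewhere the Lipschitz
      constant bounds the quotient for every \<open>k\<close>.\<close>
    show "integrable lborel (\<lambda>x. indicator (cball 0 (R + norm e)) x *\<^sub>R (L * norm e))"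
      by (rule borel_integrable_compact) auto
    show "AE x in lborel. norm (Dq k x) \<le> indicator (cball 0 (R + norm e)) x *\<^sub>R (L * norm e)" for k
    proof (rule AE_I2)
      fix x
      show "norm (Dq k x) \<le> indicator (cball 0 (R + norm e)) x *\<^sub>R (L * norm e)"
      proof (cases "norm x \<le> R + norm e")
        case True
        have "norm (g (x + s k *\<^sub>R e) - g x) \<le> L * norm (s k *\<^sub>R e)"
          using lip[of "x + s k *\<^sub>R e" x] by simp
        then have "norm (g (x + s k *\<^sub>R e) - g x) / s k \<le> L * norm e"
          using s[of k] by (simp add: pos_divide_le_eq mult.assoc mult.commute[of "norm e"])
        then show ?thesis using True s[of k] by (simp add: Dq_def divide_inverse mult.commute)
      next
        case False
        have "s k * norm e \<le> 1 * norm e" using s(2)[of k] by (intro mult_right_mono) auto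
        moreover have "norm x \<le> norm (x + s k *\<^sub>R e) + norm (s k *\<^sub>R e)"
          using norm_triangle_ineq4[of "x + s k *\<^sub>R e" "s k *\<^sub>R e"] by simp
        ultimately have "norm (x + s k *\<^sub>R e) > R" using False s(1)[of k] by simp
        moreover have "norm x > R" using False norm_ge_zero[of e] by linarith
        ultimately show ?thesis using False supp by (simp add: Dq_def)
      qed
    qed
    show "AE x in lborel. (\<lambda>k. Dq k x) \<longlonglongrightarrow> g' x"
      using deriv
    proof eventually_elim
      fix x assume "\<exists>G. (g has_derivative G) (at x) \<and> G e = g' x"
      then obtain G where G: "(g has_derivative G) (at x)" "G e = g' x" by auto
      interpret G: bounded_linear G using G(1) by (rule has_derivative_bounded_linear)
      have "((\<lambda>t::real. g (x + t *\<^sub>R e)) has_derivative (\<lambda>t. G (t *\<^sub>R e))) (at 0)"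
        by (rule has_derivative_compose[where f = "\<lambda>t. x + t *\<^sub>R e" and g = g])
           (use G in \<open>auto intro!: derivative_eq_intros\<close>)
      then have "((\<lambda>t::real. g (x + t *\<^sub>R e)) has_vector_derivative g' x) (at 0)"
        by (simp add: has_vector_derivative_def G.scaleR G(2))
      then have "\<forall>X. (\<forall>i. X i \<in> UNIV - {0}) \<longrightarrow> X \<longlonglongrightarrow> 0 \<longrightarrow>
          (\<lambda>i. (g (x + X i *\<^sub>R e) - g (x + 0 *\<^sub>R e)) /\<^sub>R (X i - 0)) \<longlonglongrightarrow> g' x"
        unfolding has_vector_derivative_iff_sequentially .
      from this[rule_format, of s] show "(\<lambda>k. Dq k x) \<longlonglongrightarrow> g' x"
        using s LIMSEQ_inverse_real_of_nat by (simp add: Dq_def s_def[abs_def])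
    qed
  qed
  then show ?thesis unfolding int0 using LIMSEQ_unique tendsto_const by blast
qed

subsection \<open>The divergence theorem on a ball\<close>

lemma AE_not_sphere: "AE x in lborel. x \<notin> sphere (z::'a::euclidean_space) s"
  using negligible_sphere[of z s]
  by (intro AE_not_in) (auto simp: null_sets_completion_iff negligible_iff_null_sets)

text \<open>\<open>integral_directional_derivative_zero\<close> is applied to \<open>F\<close> times the cutoff; \<open>closest_point\<close>
  extends \<open>F\<close> to a Lipschitz function on the whole space.\<close>

lemma integral_shell:
  fixes F :: "real^3 \<Rightarrow> 'b::euclidean_space"
  assumes R: "0 < \<epsilon>" "\<epsilon> < R" and F: "Ck (Suc 0) (cball 0 R) F"
  shows "(LINT x:cball 0 R|lborel. max 0 (min 1 ((R - norm x) / \<epsilon>)) *\<^sub>R pd (cball 0 R) e F x) =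
    (1 / \<epsilon>) *\<^sub>R (LINT x:ball 0 R - ball 0 (R - \<epsilon>)|lborel. (sgn x \<bullet> e) *\<^sub>R F x)"
proof -
  let ?B = "cball (0::real^3) R" and ?Sh = "ball (0::real^3) R - ball 0 (R - \<epsilon>)"
  \<comment> \<open>The cutoff is 1 on the inner ball and falls linearly to 0 at radius
    \<open>R\<close>, so its gradient is \<open>- sgn x / \<epsilon>\<close> in the shell and zero
    elsewhere.\<close>
  define w where "w x = max 0 (min 1 ((R - norm x) / \<epsilon>))" for x :: "real^3"
  define g where "g x = w x *\<^sub>R F (closest_point ?B x)" for x
  define d where "d = pd ?B e F"
  have cF: "continuous_on ?B F" using F by (rule Ck_imp_continuous)
  have cd: "continuous_on ?B d" using F by (auto simp: d_def)
  have cw: "continuous_on X w" for X unfolding w_def by (intro continuous_intros) (use R in auto)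
  have cp: "closest_point ?B x \<in> ?B" for x using R by (intro closest_point_in_set) auto
  obtain M where M: "M \<ge> 0" "\<And>x. x \<in> ?B \<Longrightarrow> norm (F x) \<le> M"
    using bounded_on_compact[OF compact_cball cF] by blast
  obtain L where L: "L \<ge> 0" "\<And>x y. x \<in> ?B \<Longrightarrow> y \<in> ?B \<Longrightarrow> norm (F x - F y) \<le> L * norm (x - y)"
    using Ck_lipschitz[OF compact_cball convex_cball F] by blast
  have w01: "0 \<le> w x" "w x \<le> 1" for x by (auto simp: w_def)
  have w0: "w x = 0" if "norm x > R" for x
  proof -
    have "(R - norm x) / \<epsilon> \<le> 0" using that R by (intro divide_nonpos_pos) auto
    then show ?thesis by (simp add: w_def)
  qed
  have wlip: "\<bar>w x - w y\<bar> \<le> norm (x - y) / \<epsilon>" for x y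
  proof -
    have "\<bar>w x - w y\<bar> \<le> \<bar>(R - norm x) / \<epsilon> - (R - norm y) / \<epsilon>\<bar>"
      unfolding w_def by (auto simp: max_def min_def abs_real_def)
    also have "\<dots> = \<bar>norm x - norm y\<bar> / \<epsilon>" using R by (simp add: diff_divide_distrib[symmetric] abs_minus_commute)
    also have "\<dots> \<le> norm (x - y) / \<epsilon>" using R norm_triangle_ineq3 by (intro divide_right_mono) auto
    finally show ?thesis .
  qed
  have glip: "norm (g x - g y) \<le> (L + M / \<epsilon>) * norm (x - y)" for x y
  proof -
    let ?x = "closest_point ?B x" and ?y = "closest_point ?B y"
    have "g x - g y = w x *\<^sub>R (F ?x - F ?y) + (w x - w y) *\<^sub>R F ?y"
      by (simp add: g_def algebra_simps)
    also have "norm \<dots> \<le> \<bar>w x\<bar> * norm (F ?x - F ?y) + \<bar>w x - w y\<bar> * norm (F ?y)"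
      by (rule norm_triangle_le) simp
    also have "\<dots> \<le> 1 * (L * norm (x - y)) + (norm (x - y) / \<epsilon>) * M"
    proof (intro add_mono mult_mono)
      have "norm (F ?x - F ?y) \<le> L * norm (?x - ?y)" using L cp by blast
      also have "\<dots> \<le> L * norm (x - y)"
        using closest_point_lipschitz[of ?B x y] R L(1) by (intro mult_left_mono) (auto simp: dist_norm)
      finally show "norm (F ?x - F ?y) \<le> L * norm (x - y)" .
      show "norm (F ?y) \<le> M" using M cp by blast
    qed (use w01[of x] wlip L M R in auto)
    also have "\<dots> = (L + M / \<epsilon>) * norm (x - y)" by (simp add: algebra_simps)
    finally show ?thesis .
  qed
  \<comment> \<open>The product rule for \<open>g\<close>, valid off the two spheres where the
    cutoff has kinks; these are null sets. The second summand comes from the slope of the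
    cutoff.\<close>
  define g' where "g' x = indicator ?B x *\<^sub>R (w x *\<^sub>R d x) -
    indicator ?Sh x *\<^sub>R ((1 / \<epsilon>) *\<^sub>R ((sgn x \<bullet> e) *\<^sub>R F x))" for x
  have i1: "integrable lborel (\<lambda>x. indicator ?B x *\<^sub>R (w x *\<^sub>R d x))"
    by (intro borel_integrable_compact continuous_intros cw cd) auto
  have i2: "integrable lborel (\<lambda>x. indicator ?Sh x *\<^sub>R ((sgn x \<bullet> e) *\<^sub>R F x))"
  proof -
    have "integrable lborel (\<lambda>x. indicator (?B - ball 0 (R - \<epsilon>)) x *\<^sub>R ((sgn x \<bullet> e) *\<^sub>R F x))"
      using R cF by (intro borel_integrable_compact compact_diff continuous_intros)
        (auto intro: continuous_on_subset)
    then have "integrable lborel (\<lambda>x. indicator ?Sh x *\<^sub>R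
       (indicator (?B - ball 0 (R - \<epsilon>)) x *\<^sub>R ((sgn x \<bullet> e) *\<^sub>R F x)))"
      by (rule integrable_mult_indicator[rotated]) simp
    moreover have "indicator ?Sh x *\<^sub>R (indicator (?B - ball 0 (R - \<epsilon>)) x *\<^sub>R ((sgn x \<bullet> e) *\<^sub>R F x)) =
        indicator ?Sh x *\<^sub>R ((sgn x \<bullet> e) *\<^sub>R F x)" for x
      by (simp add: indicator_def)
    ultimately show ?thesis by (simp only:)
  qed
  have int: "integrable lborel g'" unfolding g'_def using i1 i2
    by (intro Bochner_Integration.integrable_diff integrable_scaleR_right)
      (simp_all add: scaleR_left_commute[of _ "1 / \<epsilon>"] del: scaleR_scaleR)
  note null = AE_not_sphere[of "0::real^3"]
  have "(\<integral>x. g' x \<partial>lborel) = 0"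
  proof (rule integral_directional_derivative_zero[where R = R and L = "L + M / \<epsilon>", OF _ glip])
    show "0 \<le> L + M / \<epsilon>" using L M R by auto
    show "g x = 0" if "norm x > R" for x
      using that w0 by (simp add: g_def)
    show "g' \<in> borel_measurable lborel" using int by auto
    show "AE x in lborel. \<exists>G. (g has_derivative G) (at x) \<and> G e = g' x"
      using null[of R] null[of "R - \<epsilon>"]
    proof eventually_elim
      fix x :: "real^3"
      assume "x \<notin> sphere 0 R" "x \<notin> sphere 0 (R - \<epsilon>)"
      then have x: "norm x \<noteq> R" "norm x \<noteq> R - \<epsilon>" by auto
      have DF: "(F has_derivative (\<lambda>h. pd ?B h F x)) (at x)" if "norm x < R"
        using Ck_Suc_deriv[OF F, of x] that at_within_interior[of x ?B] by auto
      consider "norm x < R - \<epsilon>" | "R - \<epsilon> < norm x" "norm x < R" | "norm x > R"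
        using x by linarith
      then show "\<exists>G. (g has_derivative G) (at x) \<and> G e = g' x"
      proof cases
        case 1
        have "(g has_derivative (\<lambda>h. pd ?B h F x)) (at x)"
        proof (rule has_derivative_transform_within_open)
          show "(F has_derivative (\<lambda>h. pd ?B h F x)) (at x)" using 1 R DF by simp
          show "F y = g y" if "y \<in> ball 0 (R - \<epsilon>)" for y
            using that R by (simp add: g_def w_def closest_point_self min_def pos_divide_le_eq field_simps)
        qed (use 1 in auto)
        moreover have "g' x = d x" using 1 R
          by (simp add: g'_def w_def min_def field_simps indicator_def)
        ultimately show ?thesis by (auto simp: d_def)
      next
        case 2
        let ?G = "\<lambda>h. ((R - norm x) / \<epsilon>) *\<^sub>R pd ?B h F x + (- (sgn x \<bullet> h) / \<epsilon>) *\<^sub>R F x"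
        have "x \<noteq> 0" using 2 R by auto
        have "(g has_derivative ?G) (at x)"
        proof (rule has_derivative_transform_within_open)
          have "((\<lambda>y. (R - norm y) / \<epsilon>) has_derivative (\<lambda>h. - (sgn x \<bullet> h) / \<epsilon>)) (at x)"
            by (rule has_derivative_eq_rhs, (rule derivative_intros has_derivative_norm[OF \<open>x \<noteq> 0\<close>])+)
               (use R in \<open>auto simp: inner_commute\<close>)
          from has_derivative_scaleR[OF this DF[OF 2(2)]]
          show "((\<lambda>y. ((R - norm y) / \<epsilon>) *\<^sub>R F y) has_derivative ?G) (at x)" .
          show "((R - norm y) / \<epsilon>) *\<^sub>R F y = g y" if "y \<in> ball 0 R - cball 0 (R - \<epsilon>)" for y
            using that R by (simp add: g_def w_def closest_point_self min_def max_def field_simps)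
        qed (use 2 in auto)
        moreover have "?G e = g' x" using 2 R
          by (auto simp: g'_def w_def min_def max_def d_def field_simps indicator_def)
        ultimately show ?thesis by blast
      next
        case 3
        have "(g has_derivative (\<lambda>_. 0)) (at x)"
        proof (rule has_derivative_transform_within_open)
          show "((\<lambda>_. 0) has_derivative (\<lambda>_. 0)) (at x)" by simp
          show "0 = g y" if "y \<in> - cball 0 R" for y
            using that w0 by (simp add: g_def)
        qed (use 3 in auto)
        moreover have "g' x = 0" using 3 by (simp add: g'_def)
        ultimately show ?thesis by auto
      qed
    qed
  qed
  also have "(\<integral>x. g' x \<partial>lborel) = (LINT x:?B|lborel. w x *\<^sub>R d x) -
     (1 / \<epsilon>) *\<^sub>R (LINT x:?Sh|lborel. (sgn x \<bullet> e) *\<^sub>R F x)"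
    unfolding g'_def set_lebesgue_integral_def scaleR_left_commute[of "indicator _ _" "1 / \<epsilon>"] using i1 i2
    by (simp del: scaleR_scaleR)
  finally show ?thesis by (simp add: w_def d_def)
qed

section \<open>Dilations, shells and integrals over spheres\<close>

lemma lborel_integral_scale:
  fixes h :: "real^3 \<Rightarrow> 'b::euclidean_space"
  assumes "s > 0" "h \<in> borel_measurable borel"
  shows "(\<integral>x. h x \<partial>lborel) = s ^ 3 *\<^sub>R (\<integral>x. h (s *\<^sub>R x) \<partial>lborel)"
proof -
  have "(\<integral>x. h x \<partial>lborel) =
      (\<integral>x. h x \<partial>density (distr lborel borel (\<lambda>x. 0 + s *\<^sub>R x)) (\<lambda>_. ennreal (s ^ 3)))"
    using assms(1) lborel_affine[of s "0::real^3"] by simp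
  also have "\<dots> = (\<integral>x. s ^ 3 *\<^sub>R h x \<partial>distr lborel borel (\<lambda>x. 0 + s *\<^sub>R x))"
    using assms by (intro integral_density) auto
  also have "\<dots> = (\<integral>x. s ^ 3 *\<^sub>R h (0 + s *\<^sub>R x) \<partial>lborel)"
    using assms by (intro integral_distr) auto
  finally show ?thesis by simp
qed


text \<open>Degree-zero homogeneity turns a dilation by \<open>t\<close> into the factor
  \<open>t ^ 3\<close>, and a shell is a difference of two balls. The constant function 1 gives the
  volume of the shell.\<close>

lemma integral_shell_homogeneous:
  fixes h :: "real^3 \<Rightarrow> 'b::euclidean_space"
  assumes s: "0 < s" "s < R" and meas: "h \<in> borel_measurable borel" and bd: "\<And>x. norm (h x) \<le> M"
    and hom: "\<And>t x. t > 0 \<Longrightarrow> h (t *\<^sub>R x) = h x"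
  shows "set_integrable lborel (ball 0 R - ball 0 s) h"
    and "(LINT x:ball 0 R - ball 0 s|lborel. h x) = (R ^ 3 - s ^ 3) *\<^sub>R (LINT x:ball 0 1|lborel. h x)"
proof -
  have int: "set_integrable lborel X h" if "X \<subseteq> ball 0 R" "X \<in> sets borel" for X
    unfolding set_integrable_def
  proof (rule Bochner_Integration.integrable_bound)
    show "integrable lborel (\<lambda>x. indicator (cball 0 R) x *\<^sub>R M)"
      by (rule borel_integrable_compact) auto
    show "(\<lambda>x. indicator X x *\<^sub>R h x) \<in> borel_measurable lborel"
      using meas that by measurable
    show "AE x in lborel. norm (indicator X x *\<^sub>R h x) \<le> norm (indicator (cball 0 R) x *\<^sub>R M)"
      using bd that by (intro AE_I2) (auto simp: indicator_def intro: order_trans[OF _ abs_ge_self])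
  qed
  have scale: "(LINT x:ball 0 t|lborel. h x) = t ^ 3 *\<^sub>R (LINT x:ball 0 1|lborel. h x)" if t: "t > 0" for t
  proof -
    have "(LINT x:ball 0 t|lborel. h x) =
        t ^ 3 *\<^sub>R (\<integral>x. indicator (ball 0 t) (t *\<^sub>R x) *\<^sub>R h (t *\<^sub>R x) \<partial>lborel)"
      unfolding set_lebesgue_integral_def using meas t
      by (intro lborel_integral_scale borel_measurable_scaleR borel_measurable_indicator) auto
    also have "(\<lambda>x. indicator (ball 0 t) (t *\<^sub>R x) *\<^sub>R h (t *\<^sub>R x)) = (\<lambda>x. indicator (ball 0 1) x *\<^sub>R h x)"
      using t hom by (auto simp: indicator_def fun_eq_iff)
    finally show ?thesis by (simp add: set_lebesgue_integral_def)
  qed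
  show "set_integrable lborel (ball 0 R - ball 0 s) h" by (rule int) auto
  have "(LINT x:ball 0 s \<union> (ball 0 R - ball 0 s)|lborel. h x) =
      (LINT x:ball 0 s|lborel. h x) + (LINT x:ball 0 R - ball 0 s|lborel. h x)"
    using s by (intro set_integral_Un int) auto
  also have "ball 0 s \<union> (ball 0 R - ball 0 s) = ball (0::real^3) R" using s by auto
  finally show "(LINT x:ball 0 R - ball 0 s|lborel. h x) = (R ^ 3 - s ^ 3) *\<^sub>R (LINT x:ball 0 1|lborel. h x)"
    using s scale[of s] scale[of R] by (simp add: scaleR_diff_left)
qed

text \<open>Change of variables for the image measure. The indicator stays in the formula because
  \<open>sgn 0 = 0\<close> sends the origin to the center, which is off the sphere when
  \<open>R > 0\<close> and where nothing is known about \<open>g\<close>. The measure is finite, so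
  the bounded integrand is integrable.\<close>

lemma sphere_integral_eq:
  fixes g :: "real^3 \<Rightarrow> 'b::euclidean_space"
  assumes "continuous_on (sphere z R) g"
  shows "(LINT x:sphere z R|sphere_measure z R. g x) =
    (3 * R\<^sup>2) *\<^sub>R (LINT y:ball 0 1|lborel. indicator (sphere z R) (z + R *\<^sub>R sgn y) *\<^sub>R g (z + R *\<^sub>R sgn y))"
    and "set_integrable (sphere_measure z R) (sphere z R) g"
proof -
  let ?N = "density lborel (\<lambda>y::real^3. ennreal (3 * R\<^sup>2) * indicator (ball 0 1) y)"
  let ?G = "\<lambda>x. indicator (sphere z R) x *\<^sub>R g x"
  have mG: "?G \<in> borel_measurable borel"
    using assms by (intro borel_measurable_continuous_on_indicator) auto
  have ms: "(\<lambda>y::real^3. z + R *\<^sub>R sgn y) \<in> ?N \<rightarrow>\<^sub>M borel"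
    using measurable_sgn_affine[of z R] by simp
  have N: "?N = density lborel (\<lambda>y::real^3. ennreal (3 * R\<^sup>2 * indicator (ball 0 1) y))"
    by (intro arg_cong[where f = "density lborel"]) (auto simp: indicator_def)
  have "(LINT x:sphere z R|sphere_measure z R. g x) = (\<integral>y. ?G (z + R *\<^sub>R sgn y) \<partial>?N)"
    unfolding set_lebesgue_integral_def sphere_measure_def by (rule integral_distr[OF ms mG])
  also have "\<dots> = (\<integral>y. (3 * R\<^sup>2 * indicator (ball 0 1) y) *\<^sub>R ?G (z + R *\<^sub>R sgn y) \<partial>lborel)"
    unfolding N using measurable_compose[OF measurable_sgn_affine[of z R] mG]
    by (intro integral_density) (auto intro!: borel_measurable_times borel_measurable_indicator)
  finally show "(LINT x:sphere z R|sphere_measure z R. g x) =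
      (3 * R\<^sup>2) *\<^sub>R (LINT y:ball 0 1|lborel. indicator (sphere z R) (z + R *\<^sub>R sgn y) *\<^sub>R g (z + R *\<^sub>R sgn y))"
    unfolding set_lebesgue_integral_def by (simp flip: scaleR_scaleR)
  have "finite_measure ?N"
  proof
    have "emeasure ?N (space ?N) = (\<integral>\<^sup>+ y. ennreal (3 * R\<^sup>2) * indicator (ball (0::real^3) 1) y \<partial>lborel)"
      by (subst emeasure_density) (auto intro!: borel_measurable_times_ennreal borel_measurable_indicator)
    also have "\<dots> = ennreal (3 * R\<^sup>2) * emeasure lborel (ball (0::real^3) 1)"
      by (rule nn_integral_cmult_indicator) auto
    also have "\<dots> \<noteq> \<infinity>" using emeasure_lborel_ball_finite[of "0::real^3" 1]
      by (simp add: ennreal_mult_eq_top_iff less_top)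
    finally show "emeasure ?N (space ?N) \<noteq> \<infinity>" .
  qed
  then interpret finite_measure "sphere_measure z R"
    unfolding sphere_measure_def by (rule finite_measure.finite_measure_distr[OF _ ms])
  obtain M where M: "M \<ge> 0" "\<And>x. x \<in> sphere z R \<Longrightarrow> norm (g x) \<le> M"
    using bounded_on_compact[OF compact_sphere assms] by blast
  show "set_integrable (sphere_measure z R) (sphere z R) g"
    unfolding set_integrable_def
  proof (rule integrable_const_bound[where B = M])
    show "AE x in sphere_measure z R. norm (?G x) \<le> M"
      using M by (intro AE_I2) (auto simp: indicator_def)
    show "?G \<in> borel_measurable (sphere_measure z R)"
      using mG by (simp add: sphere_measure_def measurable_def)
  qed
qed

text \<open>As the shell shrinks, \<open>F\<close> may be replaced there by a function \<open>h\<close> that is constant on rays, and by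
  homogeneity the shell integral of \<open>h\<close> is an integral over the unit ball as in \<open>sphere_measure\<close>.\<close>

lemma gauss_directional_0:
  fixes F :: "real^3 \<Rightarrow> 'b::euclidean_space"
  assumes R: "R > 0" and F: "Ck (Suc 0) (cball 0 R) F"
  shows "(LINT x:sphere 0 R|sphere_measure 0 R. (((1 / R) *\<^sub>R x) \<bullet> e) *\<^sub>R F x) =
     (LINT x:cball 0 R|lborel. pd (cball 0 R) e F x)"
proof -
  let ?B = "cball (0::real^3) R"
  define d where "d = pd ?B e F"
  have cF: "continuous_on ?B F" using F by (rule Ck_imp_continuous)
  have cd: "continuous_on ?B d" using F by (auto simp: d_def)
  obtain M where M: "M \<ge> 0" "\<And>x. x \<in> ?B \<Longrightarrow> norm (F x) \<le> M"
    using bounded_on_compact[OF compact_cball cF] by blast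
  obtain L where L: "L \<ge> 0" "\<And>x y. x \<in> ?B \<Longrightarrow> y \<in> ?B \<Longrightarrow> norm (F x - F y) \<le> L * norm (x - y)"
    using Ck_lipschitz[OF compact_cball convex_cball F] by blast
  \<comment> \<open>The double \<open>Suc\<close> starts the thickness at \<open>R / 2\<close>,
    which keeps it strictly below \<open>R\<close> for every \<open>k\<close>.\<close>
  define \<epsilon> where "\<epsilon> k = R * inverse (real (Suc (Suc k)))" for k
  have \<epsilon>: "0 < \<epsilon> k" "\<epsilon> k < R" for k using R by (auto simp: \<epsilon>_def field_simps add_pos_nonneg)
  have \<epsilon>0: "\<epsilon> \<longlonglongrightarrow> 0"
    using tendsto_mult_right_zero[OF LIMSEQ_Suc[OF LIMSEQ_inverse_real_of_nat], of R]
    by (simp add: \<epsilon>_def[abs_def])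
  define w where "w k x = max 0 (min 1 ((R - norm x) / \<epsilon> k))" for k and x :: "real^3"
  let ?Sh = "\<lambda>k. ball (0::real^3) R - ball 0 (R - \<epsilon> k)"
  let ?A = "\<lambda>k. LINT x:?B|lborel. w k x *\<^sub>R d x"
  have A: "?A k = (1 / \<epsilon> k) *\<^sub>R (LINT x:?Sh k|lborel. (sgn x \<bullet> e) *\<^sub>R F x)" for k
    unfolding w_def d_def using integral_shell[OF \<epsilon> F] .
  note null = AE_not_sphere[of "0::real^3" R]
  have lim1: "?A \<longlonglongrightarrow> (LINT x:?B|lborel. d x)"
    unfolding set_lebesgue_integral_def
  proof (rule integral_dominated_convergence)
    show "integrable lborel (\<lambda>x. indicator ?B x *\<^sub>R norm (d x))"
      by (intro borel_integrable_compact continuous_intros cd) auto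
    show "(\<lambda>x. indicator ?B x *\<^sub>R d x) \<in> borel_measurable lborel"
      using borel_measurable_continuous_on_indicator[OF _ cd] by simp
    show "(\<lambda>x. indicator ?B x *\<^sub>R w k x *\<^sub>R d x) \<in> borel_measurable lborel" for k
    proof -
      have "continuous_on ?B (\<lambda>x. w k x *\<^sub>R d x)"
        unfolding w_def by (intro continuous_intros cd) (use \<epsilon>(1)[of k] in auto)
      from borel_measurable_continuous_on_indicator[OF _ this] show ?thesis by simp
    qed
    show "AE x in lborel. norm (indicator ?B x *\<^sub>R w k x *\<^sub>R d x) \<le> indicator ?B x *\<^sub>R norm (d x)" for k
    proof (rule AE_I2)
      fix x
      have "\<bar>w k x\<bar> * norm (d x) \<le> 1 * norm (d x)" by (intro mult_right_mono) (auto simp: w_def)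
      then show "norm (indicator ?B x *\<^sub>R w k x *\<^sub>R d x) \<le> indicator ?B x *\<^sub>R norm (d x)"
        by (auto simp: indicator_def)
    qed
    show "AE x in lborel. (\<lambda>k. indicator ?B x *\<^sub>R w k x *\<^sub>R d x) \<longlonglongrightarrow> indicator ?B x *\<^sub>R d x"
      using null
    proof eventually_elim
      fix x :: "real^3" assume x: "x \<notin> sphere 0 R"
      show "(\<lambda>k. indicator ?B x *\<^sub>R w k x *\<^sub>R d x) \<longlonglongrightarrow> indicator ?B x *\<^sub>R d x"
      proof (cases "norm x < R")
        case True
        have "\<forall>\<^sub>F k in sequentially. \<epsilon> k < R - norm x"
          using order_tendstoD(2)[OF \<epsilon>0, of "R - norm x"] True by simp
        then have "\<forall>\<^sub>F k in sequentially. indicator ?B x *\<^sub>R w k x *\<^sub>R d x = indicator ?B x *\<^sub>R d x"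
        proof eventually_elim
          case (elim k)
          then have "(R - norm x) / \<epsilon> k \<ge> 1" using \<epsilon>(1)[of k] by (simp add: field_simps)
          then show ?case by (simp add: w_def)
        qed
        then show ?thesis by (rule tendsto_eventually)
      next
        case False
        then have "x \<notin> ?B" using x by auto
        then show ?thesis by simp
      qed
    qed
  qed
  \<comment> \<open>Uses the value of \<open>F\<close> at the radial projection onto the sphere. It
    is constant on rays and is the integrand that \<open>sphere_integral_eq\<close>
    produces.\<close>
  define h where "h x = (sgn x \<bullet> e) *\<^sub>R (indicator (sphere 0 R) (R *\<^sub>R sgn x) *\<^sub>R F (R *\<^sub>R sgn x))" for x
  have mh: "h \<in> borel_measurable borel"
  proof -
    have "continuous_on (sphere 0 R) F" using cF by (rule continuous_on_subset) auto
    from borel_measurable_continuous_on_indicator[OF _ this]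
    have [measurable]: "(\<lambda>x. indicator (sphere 0 R) x *\<^sub>R F x) \<in> borel_measurable borel" by simp
    have [measurable]: "(\<lambda>x::real^3. R *\<^sub>R sgn x) \<in> borel_measurable borel" by measurable
    have "(\<lambda>x::real^3. indicator (sphere 0 R) (R *\<^sub>R sgn x) *\<^sub>R F (R *\<^sub>R sgn x)) \<in> borel_measurable borel"
      by (rule measurable_compose[where g = "\<lambda>x. indicator (sphere 0 R) x *\<^sub>R F x"]) measurable
    moreover have "(\<lambda>x::real^3. sgn x \<bullet> e) \<in> borel_measurable borel" by measurable
    ultimately show ?thesis unfolding h_def by (rule borel_measurable_scaleR[rotated])
  qed
  have sgn_e: "\<bar>sgn x \<bullet> e\<bar> \<le> norm e" for x :: "real^3"
    using Cauchy_Schwarz_ineq2[of "sgn x" e] by (cases "x = 0") (auto simp: norm_sgn)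
  have bh: "norm (h x) \<le> norm e * M" for x
    unfolding h_def norm_scaleR using sgn_e[of x] M R
    by (intro mult_mono) (auto simp: indicator_def)
  have hh: "h (t *\<^sub>R x) = h x" if "t > 0" for t x
    using that by (simp add: h_def sgn_scaleR)
  note shell = integral_shell_homogeneous[where h = h and M = "norm e * M", OF _ _ mh bh hh]
  note shell1 = integral_shell_homogeneous[where h = "\<lambda>_. 1::real" and M = 1]
  let ?V = "LINT x:ball (0::real^3) 1|lborel. 1::real"
  let ?H = "LINT x:ball (0::real^3) 1|lborel. h x"
  \<comment> \<open>Divided by the thickness, the difference of cubes tends to
    \<open>3 * R\<^sup>2\<close>, which is the density constant in
    \<open>sphere_measure\<close>.\<close>
  have cub: "R ^ 3 - (R - \<epsilon> k) ^ 3 = \<epsilon> k * (3 * R\<^sup>2 - 3 * R * \<epsilon> k + (\<epsilon> k)\<^sup>2)" for k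
    by (simp add: power2_eq_square power3_eq_cube algebra_simps)
  let ?c = "\<lambda>k. 3 * R\<^sup>2 - 3 * R * \<epsilon> k + (\<epsilon> k)\<^sup>2"
  have lim2: "(\<lambda>k. ?c k *\<^sub>R ?H) \<longlonglongrightarrow> (3 * R\<^sup>2) *\<^sub>R ?H"
    by (rule tendsto_eq_rhs, (rule tendsto_intros \<epsilon>0)+) simp
  \<comment> \<open>A point of the shell is within \<open>\<epsilon> k\<close> of its projection, so
    \<open>F\<close> and its projected value differ by at most \<open>L * \<epsilon> k\<close>. The
    shell volume divided by \<open>\<epsilon> k\<close> stays bounded, so the whole error is of
    order \<open>\<epsilon> k\<close>.\<close>
  have diff: "norm (?A k - ?c k *\<^sub>R ?H) \<le> norm e * L * \<epsilon> k * (?c k * ?V)" for k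
  proof -
    let ?S = "?Sh k"
    have iS: "set_integrable lborel ?S h" "set_integrable lborel ?S (\<lambda>_. 1::real)"
      using shell(1)[of "R - \<epsilon> k" R] shell1(1)[of "R - \<epsilon> k" R] \<epsilon>[of k] by auto
    have iF: "set_integrable lborel ?S (\<lambda>x. (sgn x \<bullet> e) *\<^sub>R F x)"
      unfolding set_integrable_def
    proof (rule Bochner_Integration.integrable_bound)
      show "integrable lborel (\<lambda>x. indicator (cball (0::real^3) R) x *\<^sub>R (norm e * M))"
        by (rule borel_integrable_compact) auto
      have eq: "(\<lambda>x. indicator ?S x *\<^sub>R ((sgn x \<bullet> e) *\<^sub>R F x)) =
          (\<lambda>x. indicator ?S x *\<^sub>R ((sgn x \<bullet> e) *\<^sub>R (indicator ?B x *\<^sub>R F x)))"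
        by (auto simp: indicator_def fun_eq_iff)
      have m1: "(\<lambda>x. indicator ?B x *\<^sub>R F x) \<in> borel_measurable borel"
        using cF by (intro borel_measurable_continuous_on_indicator) auto
      have m2: "(\<lambda>x::real^3. sgn x \<bullet> e) \<in> borel_measurable borel" by measurable
      show "(\<lambda>x. indicator ?S x *\<^sub>R ((sgn x \<bullet> e) *\<^sub>R F x)) \<in> borel_measurable lborel"
        unfolding eq measurable_lborel2
        by (rule borel_measurable_scaleR[OF borel_measurable_indicator borel_measurable_scaleR[OF m2 m1]]) simp
      show "AE x in lborel. norm (indicator ?S x *\<^sub>R ((sgn x \<bullet> e) *\<^sub>R F x)) \<le>
          norm (indicator (cball (0::real^3) R) x *\<^sub>R (norm e * M))"
        using sgn_e M by (intro AE_I2) (auto simp: indicator_def abs_mult intro!: mult_mono)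
    qed
    have "?c k *\<^sub>R ?H = (1 / \<epsilon> k) *\<^sub>R (LINT x:?S|lborel. h x)"
      using shell(2)[of "R - \<epsilon> k" R] \<epsilon>[of k] cub[of k] by simp
    then have "?A k - ?c k *\<^sub>R ?H =
        (1 / \<epsilon> k) *\<^sub>R (LINT x:?S|lborel. (sgn x \<bullet> e) *\<^sub>R F x - h x)"
      unfolding A using iS iF by (simp add: scaleR_diff_right)
    also have "norm \<dots> \<le> (1 / \<epsilon> k) * (LINT x:?S|lborel. norm e * L * \<epsilon> k)"
    proof -
      have "norm (LINT x:?S|lborel. (sgn x \<bullet> e) *\<^sub>R F x - h x) \<le>
          (LINT x:?S|lborel. norm ((sgn x \<bullet> e) *\<^sub>R F x - h x))"
        using iS iF by (intro set_integral_norm_bound set_integral_diff)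
      also have "\<dots> \<le> (LINT x:?S|lborel. norm e * L * \<epsilon> k)"
      proof (rule set_integral_mono)
        show "set_integrable lborel ?S (\<lambda>x. norm ((sgn x \<bullet> e) *\<^sub>R F x - h x))"
          using iS iF by (intro set_integrable_norm set_integral_diff)
        show "set_integrable lborel ?S (\<lambda>x. norm e * L * \<epsilon> k)"
          by (rule set_integrable_mult_right[where f = "\<lambda>_. 1", simplified]) (use iS in simp)
        fix x assume x: "x \<in> ?S"
        then have nx: "norm x < R" "R - \<epsilon> k \<le> norm x" "x \<noteq> 0" using \<epsilon>[of k] by auto
        have sph: "R *\<^sub>R sgn x \<in> sphere 0 R" using nx R by (simp add: norm_sgn)
        have "norm x *\<^sub>R sgn x = x" using nx by (simp add: sgn_div_norm)
        then have "x - R *\<^sub>R sgn x = (norm x - R) *\<^sub>R sgn x"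
          by (simp add: scaleR_diff_left)
        then have "norm (x - R *\<^sub>R sgn x) = R - norm x" using nx by (simp add: norm_sgn)
        then have "norm (F x - F (R *\<^sub>R sgn x)) \<le> L * (R - norm x)"
          using L(2)[of x "R *\<^sub>R sgn x"] nx sph by auto
        also have "\<dots> \<le> L * \<epsilon> k" using nx L by (intro mult_left_mono) auto
        finally have "\<bar>sgn x \<bullet> e\<bar> * norm (F x - F (R *\<^sub>R sgn x)) \<le> norm e * (L * \<epsilon> k)"
          using sgn_e by (intro mult_mono) auto
        then show "norm ((sgn x \<bullet> e) *\<^sub>R F x - h x) \<le> norm e * L * \<epsilon> k"
          using sph by (simp add: h_def flip: scaleR_diff_right)
      qed
      finally have "(1 / \<epsilon> k) * norm (LINT x:?S|lborel. (sgn x \<bullet> e) *\<^sub>R F x - h x) \<le>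
          (1 / \<epsilon> k) * (LINT x:?S|lborel. norm e * L * \<epsilon> k)"
        using \<epsilon>(1)[of k] by (intro mult_left_mono) auto
      then show ?thesis using \<epsilon>(1)[of k] by (simp only: norm_scaleR abs_of_pos zero_less_divide_1_iff)
    qed
    also have "\<dots> = norm e * L * \<epsilon> k * (?c k * ?V)"
    proof -
      have "(LINT x:?S|lborel. norm e * L * \<epsilon> k) = norm e * L * \<epsilon> k * (LINT x:?S|lborel. 1)"
        by (simp flip: set_integral_mult_right)
      moreover have "(LINT x:?S|lborel. 1::real) = (R ^ 3 - (R - \<epsilon> k) ^ 3) * ?V"
        using shell1(2)[of "R - \<epsilon> k" R] \<epsilon>[of k] by simp
      moreover have "(1 / \<epsilon> k) * (norm e * L * \<epsilon> k * (\<epsilon> k * ?c k * ?V)) = norm e * L * \<epsilon> k * (?c k * ?V)"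
        using \<epsilon>(1)[of k] by simp
      ultimately show ?thesis by (simp only: cub)
    qed
    finally show ?thesis .
  qed
  have "(\<lambda>k. norm e * L * \<epsilon> k * (?c k * ?V)) \<longlonglongrightarrow> 0"
    by (rule tendsto_eq_rhs, (rule tendsto_intros \<epsilon>0)+) simp
  then have "(\<lambda>k. ?A k - ?c k *\<^sub>R ?H) \<longlonglongrightarrow> 0"
    by (rule Lim_null_comparison[rotated]) (use diff in simp)
  from tendsto_add[OF this lim2] have "?A \<longlonglongrightarrow> (3 * R\<^sup>2) *\<^sub>R ?H" by simp
  then have "(LINT x:?B|lborel. d x) = (3 * R\<^sup>2) *\<^sub>R ?H" using lim1 LIMSEQ_unique by blast
  moreover have "(LINT x:sphere 0 R|sphere_measure 0 R. (((1 / R) *\<^sub>R x) \<bullet> e) *\<^sub>R F x) = (3 * R\<^sup>2) *\<^sub>R ?H"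
  proof -
    have "continuous_on (sphere 0 R) (\<lambda>x. (((1 / R) *\<^sub>R x) \<bullet> e) *\<^sub>R F x)"
      by (intro continuous_intros continuous_on_subset[OF cF]) auto
    from sphere_integral_eq(1)[OF this] show ?thesis
      using R by (simp add: h_def mult.commute)
  qed
  ultimately show ?thesis by (simp add: d_def)
qed

lemma set_integrable_cball:
  fixes h :: "'a::euclidean_space \<Rightarrow> 'b::euclidean_space"
  assumes "continuous_on (cball z R) h"
  shows "set_integrable lborel (cball z R) h" "h integrable_on (cball z R)"
    "integral (cball z R) h = (LINT x:cball z R|lborel. h x)"
proof -
  show *: "set_integrable lborel (cball z R) h"
    unfolding set_integrable_def using assms by (intro borel_integrable_compact) auto
  show "h integrable_on (cball z R)" "integral (cball z R) h = (LINT x:cball z R|lborel. h x)"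
    using set_borel_integral_eq_integral[OF *] by auto
qed

text \<open>Brings balls with moving centers to one fixed domain, where differentiation under the
  integral sign is possible.\<close>

lemma integral_cball_shift:
  fixes h :: "'a::euclidean_space \<Rightarrow> 'b::euclidean_space"
  assumes "continuous_on (cball z R) h"
  shows "integral (cball z R) h = (LINT y:cball 0 R|lborel. h (z + y))"
proof -
  have "(\<lambda>x. indicator (cball z R) x *\<^sub>R h x) \<in> borel_measurable borel"
    using assms by (intro borel_measurable_continuous_on_indicator) auto
  from lborel_integral_shift(1)[OF this, of z]
  have "(LINT x:cball z R|lborel. h x) =
      (\<integral>y. indicator (cball z R) (y + z) *\<^sub>R h (y + z) \<partial>lborel)"
    by (simp add: set_lebesgue_integral_def)
  also have "(\<lambda>y. indicator (cball z R) (y + z) *\<^sub>R h (y + z)) =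
      (\<lambda>y. indicator (cball 0 R) y *\<^sub>R h (z + y))"
    by (auto simp: indicator_def fun_eq_iff dist_norm add.commute norm_minus_commute)
  finally show ?thesis by (simp add: set_integrable_cball[OF assms] set_lebesgue_integral_def)
qed

lemma gauss_directional:
  fixes F :: "real^3 \<Rightarrow> 'b::euclidean_space"
  assumes R: "R > 0" and F: "Ck (Suc 0) (cball z R) F"
  shows "(LINT x:sphere z R|sphere_measure z R. (((1 / R) *\<^sub>R (x - z)) \<bullet> e) *\<^sub>R F x) =
     integral (cball z R) (pd (cball z R) e F)"
proof -
  let ?F = "\<lambda>y. F (z + y)"
  have img: "(+) z ` cball 0 R \<subseteq> cball z R" by (auto simp: dist_norm)
  have G: "Ck (Suc 0) (cball 0 R) ((+) z)"
    by (intro Ck_add Ck_const Ck_id solid_cball R)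
  have pG: "pd (cball 0 R) e ((+) z) y = e" if "y \<in> cball 0 R" for y
    by (rule pd_eq[OF solid_cball[OF R] that]) (auto intro!: derivative_eq_intros)
  have F0: "Ck (Suc 0) (cball 0 R) ?F" by (rule Ck_comp[OF solid_cball[OF R] G F img])
  have c: "continuous_on (sphere z R) (\<lambda>x. (((1 / R) *\<^sub>R (x - z)) \<bullet> e) *\<^sub>R F x)"
    by (intro continuous_intros continuous_on_subset[OF Ck_imp_continuous[OF F]]) auto
  have c0: "continuous_on (sphere 0 R) (\<lambda>x. (((1 / R) *\<^sub>R x) \<bullet> e) *\<^sub>R F (z + x))"
    by (intro continuous_intros continuous_on_subset[OF Ck_imp_continuous[OF F0]]) auto
  have "(LINT x:sphere z R|sphere_measure z R. (((1 / R) *\<^sub>R (x - z)) \<bullet> e) *\<^sub>R F x) =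
     (LINT x:sphere 0 R|sphere_measure 0 R. (((1 / R) *\<^sub>R x) \<bullet> e) *\<^sub>R F (z + x))"
    unfolding sphere_integral_eq(1)[OF c] sphere_integral_eq(1)[OF c0]
    by (simp add: indicator_def dist_norm)
  also have "\<dots> = (LINT x:cball 0 R|lborel. pd (cball 0 R) e ?F x)"
    by (rule gauss_directional_0[OF R F0])
  also have "\<dots> = (LINT x:cball 0 R|lborel. pd (cball z R) e F (z + x))"
    by (rule set_lebesgue_integral_cong)
       (auto simp: pd_comp[OF solid_cball[OF R] G F img] pG)
  also have "\<dots> = integral (cball z R) (pd (cball z R) e F)"
    using F by (intro integral_cball_shift[symmetric]) auto
  finally show ?thesis .
qed

lemma divergence_theorem_ball:
  fixes F :: "3 \<Rightarrow> real^3 \<Rightarrow> 'b::euclidean_space"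
  assumes R: "R > 0" and F: "\<And>i. Ck (Suc 0) (cball z R) (F i)"
  shows "(LINT x:sphere z R|sphere_measure z R. \<Sum>i\<in>UNIV. ((1 / R) *\<^sub>R (x - z)) $ i *\<^sub>R F i x) =
     integral (cball z R) (\<lambda>x. \<Sum>i\<in>UNIV. pd (cball z R) (axis i 1) (F i) x)"
proof -
  have int: "set_integrable (sphere_measure z R) (sphere z R) (\<lambda>x. (((1 / R) *\<^sub>R (x - z)) \<bullet> axis i 1) *\<^sub>R F i x)" for i
    by (intro sphere_integral_eq(2) continuous_intros continuous_on_subset[OF Ck_imp_continuous[OF F]]) auto
  have "(LINT x:sphere z R|sphere_measure z R. \<Sum>i\<in>UNIV. ((1 / R) *\<^sub>R (x - z)) $ i *\<^sub>R F i x) =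
     (LINT x:sphere z R|sphere_measure z R. \<Sum>i\<in>UNIV. (((1 / R) *\<^sub>R (x - z)) \<bullet> axis i 1) *\<^sub>R F i x)"
    by (simp add: inner_axis)
  also have "\<dots> = (\<Sum>i\<in>UNIV. LINT x:sphere z R|sphere_measure z R. (((1 / R) *\<^sub>R (x - z)) \<bullet> axis i 1) *\<^sub>R F i x)"
    using int unfolding set_lebesgue_integral_def set_integrable_def scaleR_sum_right
    by (intro Bochner_Integration.integral_sum)
  also have "\<dots> = (\<Sum>i\<in>UNIV. integral (cball z R) (pd (cball z R) (axis i 1) (F i)))"
    by (simp only: gauss_directional[OF R F])
  also have "\<dots> = integral (cball z R) (\<lambda>x. \<Sum>i\<in>UNIV. pd (cball z R) (axis i 1) (F i) x)"
    using F by (intro integral_sum[symmetric] set_integrable_cball) auto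
  finally show ?thesis .
qed

section \<open>Integrals over a fixed ball as functions of time\<close>

lemma continuous_on_parametric_cball:
  fixes H :: "real \<times> 'a::euclidean_space \<Rightarrow> 'b::euclidean_space"
  assumes H: "continuous_on ({a..b} \<times> cball 0 R) H"
  shows "continuous_on {a..b} (\<lambda>t. LINT y:cball 0 R|lborel. H (t, y))"
  unfolding continuous_on_sequentially
proof (intro allI ballI impI, elim conjE)
  fix X t assume t: "t \<in> {a..b}" and X: "\<forall>n. X n \<in> {a..b}" "X \<longlonglongrightarrow> t"
  obtain M where M: "\<And>p. p \<in> {a..b} \<times> cball 0 R \<Longrightarrow> norm (H p) \<le> M"
    using bounded_on_compact[OF compact_Times[OF compact_Icc compact_cball] H] by blast
  have sl: "continuous_on (cball 0 R) (\<lambda>y. H (s, y))" if "s \<in> {a..b}" for s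
    by (rule continuous_on_compose2[OF H]) (use that in \<open>auto intro!: continuous_intros\<close>)
  have "(\<lambda>n. LINT y:cball 0 R|lborel. H (X n, y)) \<longlonglongrightarrow> (LINT y:cball 0 R|lborel. H (t, y))"
    unfolding set_lebesgue_integral_def
  proof (rule integral_dominated_convergence)
    show "integrable lborel (\<lambda>y::'a. indicator (cball 0 R) y *\<^sub>R M)"
      by (rule borel_integrable_compact) auto
    show "(\<lambda>y. indicator (cball 0 R) y *\<^sub>R H (t, y)) \<in> borel_measurable lborel"
      using borel_measurable_continuous_on_indicator[OF _ sl[OF t]] by simp
    show "(\<lambda>y. indicator (cball 0 R) y *\<^sub>R H (X n, y)) \<in> borel_measurable lborel" for n
      using borel_measurable_continuous_on_indicator[OF _ sl[OF X(1)[rule_format, of n]]] by simp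
    show "AE y in lborel. norm (indicator (cball 0 R) y *\<^sub>R H (X n, y)) \<le> indicator (cball 0 R) y *\<^sub>R M" for n
      using M X(1) by (intro AE_I2) (auto simp: indicator_def)
    show "AE y in lborel. (\<lambda>n. indicator (cball 0 R) y *\<^sub>R H (X n, y)) \<longlonglongrightarrow> indicator (cball 0 R) y *\<^sub>R H (t, y)"
    proof (rule AE_I2)
      fix y :: 'a
      show "(\<lambda>n. indicator (cball 0 R) y *\<^sub>R H (X n, y)) \<longlonglongrightarrow> indicator (cball 0 R) y *\<^sub>R H (t, y)"
      proof (cases "y \<in> cball 0 R")
        case True
        have "(\<lambda>n. H (X n, y)) \<longlonglongrightarrow> H (t, y)"
          by (rule continuous_on_tendsto_compose[OF H])
             (use X t True in \<open>auto intro!: tendsto_Pair\<close>)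
        then show ?thesis by (intro tendsto_scaleR tendsto_const)
      qed simp
    qed
  qed
  then show "((\<lambda>t. LINT y:cball 0 R|lborel. H (t, y)) \<circ> X) \<longlonglongrightarrow> (LINT y:cball 0 R|lborel. H (t, y))"
    by (simp add: o_def)
qed

text \<open>The box is convex and compact, so one Lipschitz constant of \<open>H\<close> dominates
  all time quotients; sequences inside the interval cover the one-sided derivatives at its
  ends.\<close>

lemma leibniz_cball:
  fixes H :: "real \<times> 'a::euclidean_space \<Rightarrow> 'b::euclidean_space"
  assumes ab: "a < b" and H: "Ck (Suc 0) ({a..b} \<times> cball 0 R) H" and t: "t \<in> {a..b}"
  shows "((\<lambda>t. LINT y:cball 0 R|lborel. H (t, y)) has_vector_derivative
     (LINT y:cball 0 R|lborel. pd ({a..b} \<times> cball 0 R) (1, 0) H (t, y))) (at t within {a..b})"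
  unfolding has_vector_derivative_iff_sequentially
proof (intro allI impI)
  let ?S = "{a..b} \<times> cball (0::'a) R"
  fix X assume X: "\<forall>i. X i \<in> {a..b} - {t}" "X \<longlonglongrightarrow> t"
  have S: "compact ?S" "convex ?S"
    by (intro compact_Times compact_Icc compact_cball convex_Times convex_cball convex_real_interval)+
  obtain L where L: "L \<ge> 0" "\<And>x y. x \<in> ?S \<Longrightarrow> y \<in> ?S \<Longrightarrow> norm (H x - H y) \<le> L * norm (x - y)"
    using Ck_lipschitz[OF S H] by blast
  have cH: "continuous_on ?S H" using H by (rule Ck_imp_continuous)
  have sl: "continuous_on (cball 0 R) (\<lambda>y. H (s, y))" if "s \<in> {a..b}" for s
    by (rule continuous_on_compose2[OF cH]) (use that in \<open>auto intro!: continuous_intros\<close>)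
  let ?D = "\<lambda>y. pd ?S (1, 0) H (t, y)"
  let ?Q = "\<lambda>i y. (H (X i, y) - H (t, y)) /\<^sub>R (X i - t)"
  have XI: "X i \<in> {a..b}" "X i \<noteq> t" for i using X by auto
  have cQ: "continuous_on (cball 0 R) (?Q i)" for i
    by (intro continuous_intros sl XI t)
  have "(\<lambda>i. LINT y:cball 0 R|lborel. ?Q i y) \<longlonglongrightarrow> (LINT y:cball 0 R|lborel. ?D y)"
    unfolding set_lebesgue_integral_def
  proof (rule integral_dominated_convergence)
    show "integrable lborel (\<lambda>y::'a. indicator (cball 0 R) y *\<^sub>R L)"
      by (rule borel_integrable_compact) auto
    show "(\<lambda>y. indicator (cball 0 R) y *\<^sub>R ?D y) \<in> borel_measurable lborel"
    proof -
      have "continuous_on ?S (pd ?S (1, 0) H)" using H by auto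
      then have "continuous_on (cball 0 R) ?D"
        by (rule continuous_on_compose2) (use t in \<open>auto intro!: continuous_intros\<close>)
      from borel_measurable_continuous_on_indicator[OF _ this] show ?thesis by simp
    qed
    show "(\<lambda>y. indicator (cball 0 R) y *\<^sub>R ?Q i y) \<in> borel_measurable lborel" for i
      using borel_measurable_continuous_on_indicator[OF _ cQ] by simp
    show "AE y in lborel. norm (indicator (cball 0 R) y *\<^sub>R ?Q i y) \<le> indicator (cball 0 R) y *\<^sub>R L" for i
    proof (rule AE_I2)
      fix y :: 'a
      show "norm (indicator (cball 0 R) y *\<^sub>R ?Q i y) \<le> indicator (cball 0 R) y *\<^sub>R L"
      proof (cases "y \<in> cball 0 R")
        case True
        have "norm (H (X i, y) - H (t, y)) \<le> L * norm ((X i, y) - (t, y))"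
          using True t XI by (intro L(2)) auto
        also have "norm ((X i, y) - (t, y)) = \<bar>X i - t\<bar>" by (simp add: norm_Pair)
        finally have "norm (H (X i, y) - H (t, y)) / \<bar>X i - t\<bar> \<le> L"
          using XI(2)[of i] by (subst pos_divide_le_eq) auto
        then show ?thesis using True by (simp add: divide_inverse mult.commute)
      qed simp
    qed
    show "AE y in lborel. (\<lambda>i. indicator (cball 0 R) y *\<^sub>R ?Q i y) \<longlonglongrightarrow> indicator (cball 0 R) y *\<^sub>R ?D y"
    proof (rule AE_I2)
      fix y :: 'a
      show "(\<lambda>i. indicator (cball 0 R) y *\<^sub>R ?Q i y) \<longlonglongrightarrow> indicator (cball 0 R) y *\<^sub>R ?D y"
      proof (cases "y \<in> cball 0 R")
        case True
        have "((\<lambda>s. (s, y)) has_derivative (\<lambda>h. (h, 0))) (at t within {a..b})"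
          by (auto intro!: derivative_eq_intros)
        moreover have "(H has_derivative (\<lambda>h. pd ?S h H (t, y))) (at (t, y) within (\<lambda>s. (s, y)) ` {a..b})"
          by (rule has_derivative_subset[OF Ck_Suc_deriv[OF H]]) (use True t in auto)
        ultimately have d: "((\<lambda>s. H (s, y)) has_derivative (\<lambda>h. pd ?S (h, 0) H (t, y))) (at t within {a..b})"
          by (rule has_derivative_in_compose)
        interpret bounded_linear "\<lambda>h. pd ?S h H (t, y)"
          by (rule has_derivative_bounded_linear[OF Ck_Suc_deriv[OF H]]) (use True t in auto)
        have "((\<lambda>s. H (s, y)) has_vector_derivative ?D y) (at t within {a..b})"
        proof -
          have e: "(\<lambda>h. pd ?S (h, 0) H (t, y)) = (\<lambda>h. h *\<^sub>R ?D y)"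
            by (rule ext, subst scaleR[symmetric]) simp
          show ?thesis using d unfolding has_vector_derivative_def e .
        qed
        then have "(\<lambda>i. ?Q i y) \<longlonglongrightarrow> ?D y"
          unfolding has_vector_derivative_iff_sequentially by (elim allE[of _ X] impE) (use X in auto)
        then show ?thesis by (intro tendsto_scaleR tendsto_const)
      qed simp
    qed
  qed
  moreover have "(LINT y:cball 0 R|lborel. ?Q i y) =
      ((LINT y:cball 0 R|lborel. H (X i, y)) - (LINT y:cball 0 R|lborel. H (t, y))) /\<^sub>R (X i - t)" for i
    using set_integrable_cball(1)[OF sl[OF XI(1)[of i]]] set_integrable_cball(1)[OF sl[OF t]] by simp
  ultimately show "(\<lambda>i. ((LINT y:cball 0 R|lborel. H (X i, y)) - (LINT y:cball 0 R|lborel. H (t, y))) /\<^sub>R (X i - t))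
      \<longlonglongrightarrow> (LINT y:cball 0 R|lborel. ?D y)" by (simp only:)
qed

subsection \<open>Moving balls\<close>

locale nls_trajectory = nls +
  assumes m_pos: "m > 0" and q_pos: "q > 0" and chi_pos: "chi > 0" and c_pos: "c > 0"
    and nonlin: "nonlinearity_condition G1'"
    and open_D: "open D" and Ck_\<phi>: "Ck 2 D \<phi>" and Ck_A: "Ck 2 D A"
    and T_less: "Tm < Tp" and traj: "trajectory Tm Tp r"
    and graph: "\<And>t. t \<in> {Tm..Tp} \<Longrightarrow> (t, r t) \<in> D"
begin

abbreviation I :: "real set" where "I \<equiv> {Tm..Tp}"

lemma solid_I: "solid I"
  using T_less by (rule solid_interval)

lemma Ck_r: "Ck 2 I r" and Ck_v: "Ck (Suc 0) I v"
  and r_deriv: "t \<in> I \<Longrightarrow> (r has_vector_derivative v t) (at t within I)"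
  and v_deriv: "t \<in> I \<Longrightarrow> (v has_vector_derivative acceleration Tm Tp r t) (at t within I)"
proof -
  show Ck_r: "Ck 2 I r" using traj by (simp add: trajectory_def)
  then have C: "Ck (Suc (Suc 0)) I r" by (simp add: numeral_2_eq_2)
  show r': "(r has_vector_derivative v t) (at t within I)" if "t \<in> I" for t
    unfolding velocity_def using C that
    by (simp add: differentiable_on_def vector_derivative_works[symmetric])
  have eq: "pd I h r t = h *\<^sub>R v t" if "t \<in> I" for h t
    using pd_eq[OF solid_I that] r'[OF that] by (simp add: has_vector_derivative_def)
  show v1: "Ck (Suc 0) I v"
    by (rule Ck_cong[where F = "pd I 1 r"]) (use C eq in auto)
  show "(v has_vector_derivative acceleration Tm Tp r t) (at t within I)" if "t \<in> I" for t
    unfolding acceleration_def using v1 that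
    by (simp add: differentiable_on_def vector_derivative_works[symmetric])
qed

lemma continuous_r: "continuous_on I r" and continuous_v: "continuous_on I v"
  using Ck_imp_continuous[OF Ck_r] Ck_imp_continuous[OF Ck_v] by auto

text \<open>A shear that takes the box of fixed balls to the curved tube. A time derivative at fixed
  box coordinates becomes a derivative along \<open>(1, v t)\<close> in the tube.\<close>

definition straighten :: "spacetime \<Rightarrow> spacetime" where
  "straighten p = (fst p, r (fst p) + snd p)"

lemma straighten_image: "straighten ` (I \<times> cball 0 R) = tube R"
proof
  show "straighten ` (I \<times> cball 0 R) \<subseteq> tube R"
    by (auto simp: straighten_def tube_def dist_norm)
  show "tube R \<subseteq> straighten ` (I \<times> cball 0 R)"
  proof
    fix p assume "p \<in> tube R"
    then have "p = straighten (fst p, snd p - r (fst p))" "(fst p, snd p - r (fst p)) \<in> I \<times> cball 0 R"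
      by (auto simp: straighten_def tube_def dist_norm norm_minus_commute)
    then show "p \<in> straighten ` (I \<times> cball 0 R)" by blast
  qed
qed

lemma straighten_deriv:
  assumes "p \<in> I \<times> X"
  shows "(straighten has_derivative (\<lambda>h. (fst h, fst h *\<^sub>R v (fst p) + snd h))) (at p within I \<times> X)"
proof -
  have "(r has_derivative (\<lambda>h. h *\<^sub>R v (fst p))) (at (fst p) within fst ` (I \<times> X))"
    using r_deriv[of "fst p"] assms unfolding has_vector_derivative_def
    by (auto intro: has_derivative_subset)
  from has_derivative_in_compose[OF has_derivative_fst[OF has_derivative_ident] this]
  have "((\<lambda>p. r (fst p)) has_derivative (\<lambda>h. fst h *\<^sub>R v (fst p))) (at p within I \<times> X)" .
  then show ?thesis unfolding straighten_def
    by (intro has_derivative_Pair has_derivative_add has_derivative_fst has_derivative_snd has_derivative_ident)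
qed

lemma continuous_straighten: "continuous_on (I \<times> X) straighten"
  by (rule has_derivative_continuous_on[OF straighten_deriv])

lemma solid_box:
  assumes "R > 0" shows "solid (I \<times> cball (0::real^3) R)"
proof (rule solid_convex)
  have "((Tm + Tp) / 2, 0) \<in> box Tm Tp \<times> ball (0::real^3) R" using T_less assms by simp
  then show "interior (I \<times> cball (0::real^3) R) \<noteq> {}"
    by (simp only: interior_Times interior_cball interior_atLeastAtMost_real box_real) blast
qed (intro convex_Times convex_cball convex_real_interval)

text \<open>The tube need not be convex; uniqueness is transported from the box by \<open>straighten\<close>.\<close>

lemma solid_tube:
  assumes "R > 0" shows "solid (tube R)"
  unfolding solid_def
proof (intro ballI allI impI)
  fix p and L :: "spacetime \<Rightarrow> real"
  assume "p \<in> tube R" and L: "((\<lambda>_. 0) has_derivative L) (at p within tube R)"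
  then obtain p0 where p0: "p0 \<in> I \<times> cball 0 R" "p = straighten p0"
    using straighten_image[of R] by blast
  have "((\<lambda>_. 0) has_derivative (\<lambda>h. L (fst h, fst h *\<^sub>R v (fst p0) + snd h))) (at p0 within I \<times> cball 0 R)"
    using has_derivative_in_compose[OF straighten_deriv[OF p0(1)], of "\<lambda>_. 0" L] L
    by (simp only: straighten_image p0(2))
  then have *: "(\<lambda>h. L (fst h, fst h *\<^sub>R v (fst p0) + snd h)) = (\<lambda>_. 0)"
    using solid_box[OF assms] p0(1) unfolding solid_def by blast
  show "L = (\<lambda>_. 0)"
  proof
    fix h :: spacetime
    \<comment> \<open>The derivative of \<open>straighten\<close> is the invertible map
      \<open>(s, y)\<close> to \<open>(s, s v + y)\<close>; the vector inserted here is the preimage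
      of \<open>h\<close>.\<close>
    show "L h = 0" using fun_cong[OF *, of "(fst h, snd h - fst h *\<^sub>R v (fst p0))"] by simp
  qed
qed

lemma tubeI: "t \<in> I \<Longrightarrow> x \<in> cball (r t) R \<Longrightarrow> (t, x) \<in> tube R"
  by (auto simp: tube_def)

lemma compact_tube: "compact (tube R)"
proof -
  show ?thesis
    using compact_continuous_image[OF continuous_straighten compact_Times[OF compact_Icc compact_cball]] straighten_image by metis
qed

text \<open>The divergence theorem differentiates within a ball, the conservation laws within the
  tube; this identifies the two kinds of spatial derivative.\<close>

lemma Ck_slice:
  fixes F :: "spacetime \<Rightarrow> 'b::euclidean_space"
  assumes R: "R > 0" and t: "t \<in> I" and F: "Ck (Suc 0) (tube R) F"
  shows "Ck (Suc 0) (cball (r t) R) (\<lambda>x. F (t, x))"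
    and "x \<in> cball (r t) R \<Longrightarrow> pd (cball (r t) R) h (\<lambda>x. F (t, x)) x = pd (tube R) (0, h) F (t, x)"
proof -
  note S = solid_cball[OF R, of "r t"]
  have d: "((\<lambda>x. (t, x)) has_derivative (\<lambda>h. (0, h))) (at x within cball (r t) R)" for x
    by (auto intro!: derivative_eq_intros)
  have G: "Ck (Suc 0) (cball (r t) R) (\<lambda>x. (t, x))"
    by (rule Ck_SucI[OF S d Ck_const[OF S]])
  have img: "(\<lambda>x. (t, x)) ` cball (r t) R \<subseteq> tube R" using t by (auto simp: tube_def)
  show "Ck (Suc 0) (cball (r t) R) (\<lambda>x. F (t, x))" by (rule Ck_comp[OF S G F img])
  show "pd (cball (r t) R) h (\<lambda>x. F (t, x)) x = pd (tube R) (0, h) F (t, x)" if "x \<in> cball (r t) R"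
    using pd_comp[OF S G F img that] pd_eq[OF S that d] by simp
qed

lemma continuous_slice:
  assumes "continuous_on (tube R) F" "t \<in> I"
  shows "continuous_on (cball (r t) R) (\<lambda>x. F (t, x))"
  by (rule continuous_on_compose2[OF assms(1)])
     (use assms(2) in \<open>auto intro!: continuous_intros simp: tube_def\<close>)

lemma ball_integrable:
  fixes F :: "spacetime \<Rightarrow> 'b::euclidean_space"
  assumes "continuous_on (tube R) F" "t \<in> I"
  shows "(\<lambda>x. F (t, x)) integrable_on cball (r t) R"
  using set_integrable_cball(2)[OF continuous_slice[OF assms]] .

text \<open>Values in an arbitrary Euclidean space, so that scalar fluxes, rows of a tensor and
  first moments are all instances.\<close>

lemma sphere_gauss:
  fixes F :: "3 \<Rightarrow> spacetime \<Rightarrow> 'b::euclidean_space"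
  assumes R: "R > 0" and t: "t \<in> I" and F: "\<And>i. Ck (Suc 0) (tube R) (F i)"
  shows "sphere_int R t (\<lambda>n p. \<Sum>i\<in>UNIV. n $ i *\<^sub>R F i p) =
    ball_int R t (\<lambda>p. \<Sum>i\<in>UNIV. dx (tube R) i (F i) p)"
proof -
  have "ball_int R t (\<lambda>p. \<Sum>i\<in>UNIV. dx (tube R) i (F i) p) =
      integral (cball (r t) R) (\<lambda>x. \<Sum>i\<in>UNIV. pd (cball (r t) R) (axis i 1) (\<lambda>x. F i (t, x)) x)"
    unfolding ball_int_def by (rule integral_cong) (simp add: dx_def Ck_slice(2)[OF R t F])
  then show ?thesis
    using divergence_theorem_ball[OF R Ck_slice(1)[OF R t F], of "\<lambda>i. i"]
    unfolding sphere_int_def by (simp only:)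
qed

lemma continuous_ball_int:
  fixes F :: "spacetime \<Rightarrow> 'b::euclidean_space"
  assumes F: "continuous_on (tube R) F"
  shows "continuous_on I (\<lambda>t. ball_int R t F)"
proof -
  have "continuous_on (I \<times> cball 0 R) (\<lambda>p. F (straighten p))"
    by (rule continuous_on_compose2[OF F continuous_straighten]) (simp add: straighten_image)
  from continuous_on_parametric_cball[OF this]
  show ?thesis
    by (rule continuous_on_eq)
       (simp add: ball_int_def integral_cball_shift[OF continuous_slice[OF F]] straighten_def)
qed

text \<open>The fields \<open>w $ i *\<^sub>R F\<close> have the flux on the left; \<open>w\<close>
  is constant, so their divergence is the derivative of \<open>F\<close> in direction
  \<open>w\<close>.\<close>

lemma sphere_transport:
  fixes F :: "spacetime \<Rightarrow> 'b::euclidean_space"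
  assumes R: "R > 0" and t: "t \<in> I" and F: "Ck (Suc 0) (tube R) F"
  shows "sphere_int R t (\<lambda>n p. (w \<bullet> n) *\<^sub>R F p) = ball_int R t (pd (tube R) (0, w) F)"
proof -
  note S = solid_tube[OF R]
  have C: "Ck (Suc 0) (tube R) (\<lambda>p. w $ i *\<^sub>R F p)" for i
    by (rule Ck_linear[OF S bounded_linear_scaleR_right F])
  have "(w \<bullet> n) *\<^sub>R F p = (\<Sum>i\<in>UNIV. n $ i *\<^sub>R (w $ i *\<^sub>R F p))" for n p
    by (simp add: inner_vec_def scaleR_sum_left mult.commute)
  then have "sphere_int R t (\<lambda>n p. (w \<bullet> n) *\<^sub>R F p) =
      ball_int R t (\<lambda>p. \<Sum>i\<in>UNIV. dx (tube R) i (\<lambda>p. w $ i *\<^sub>R F p) p)"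
    using sphere_gauss[OF R t C] by simp
  also have "\<dots> = ball_int R t (pd (tube R) (0, w) F)"
    unfolding ball_int_def
  proof (rule integral_cong)
    fix x assume "x \<in> cball (r t) R"
    then have p: "(t, x) \<in> tube R" using t by (rule tubeI[rotated])
    interpret bounded_linear "\<lambda>h. pd (tube R) h F (t, x)"
      using Ck_Suc_deriv[OF F p] by (rule has_derivative_bounded_linear)
    have "(0, w) = (\<Sum>i\<in>UNIV. w $ i *\<^sub>R (0::real, axis i (1::real)))"
      by (simp add: prod_eq_iff fst_sum snd_sum vec_eq_iff axis_def if_distrib cong: if_cong)
    then have "pd (tube R) (0, w) F (t, x) = (\<Sum>i\<in>UNIV. w $ i *\<^sub>R pd (tube R) (0, axis i 1) F (t, x))"
      by (simp only: sum scaleR)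
    then show "(\<Sum>i\<in>UNIV. dx (tube R) i (\<lambda>p. w $ i *\<^sub>R F p) (t, x)) = pd (tube R) (0, w) F (t, x)"
      by (simp add: dx_def pd_linear[OF S bounded_linear_scaleR_right F p])
  qed
  finally show ?thesis .
qed

lemma continuous_dt: "Ck (Suc 0) (tube R) F \<Longrightarrow> continuous_on (tube R) (dt (tube R) F)"
  and continuous_dx: "Ck (Suc 0) (tube R) F \<Longrightarrow> continuous_on (tube R) (dx (tube R) i F)"
  by (auto simp: dt_def dx_def)

text \<open>Reynolds transport. In straightened coordinates the ball is at rest and the integrand is
  differentiated along \<open>(1, v t)\<close>; the part along \<open>(0, v t)\<close> becomes a
  surface integral by \<open>sphere_transport\<close>.\<close>

lemma ball_transport:
  fixes F :: "spacetime \<Rightarrow> 'b::euclidean_space"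
  assumes R: "R > 0" and F: "Ck (Suc 0) (tube R) F"
  shows "t \<in> I \<Longrightarrow> ((\<lambda>t. ball_int R t F) has_vector_derivative
      ball_int R t (dt (tube R) F) + sphere_int R t (\<lambda>n p. (v t \<bullet> n) *\<^sub>R F p)) (at t within I)"
    and "continuous_on I (\<lambda>t. sphere_int R t (\<lambda>n p. (v t \<bullet> n) *\<^sub>R F p))"
proof -
  let ?S = "I \<times> cball (0::real^3) R"
  note S = solid_box[OF R]
  have cF: "continuous_on (tube R) F" using F by (rule Ck_imp_continuous)
  have dF: "((\<lambda>p. F (straighten p)) has_derivative
      (\<lambda>h. pd (tube R) (fst h, fst h *\<^sub>R v (fst p) + snd h) F (straighten p))) (at p within ?S)" if "p \<in> ?S" for p
    by (rule has_derivative_in_compose[OF straighten_deriv[OF that]], unfold straighten_image,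
        rule Ck_Suc_deriv[OF F]) (use that straighten_image[of R] in blast)
  note cs = continuous_straighten[of "cball 0 R"]
  \<comment> \<open>Splits a direction that moves with \<open>v\<close> into fixed ones, whose
    derivatives are continuous by \<open>Ck\<close>.\<close>
  have lin: "pd (tube R) (fst h, fst h *\<^sub>R v s + snd h) F (s, x) =
      fst h *\<^sub>R dt (tube R) F (s, x) + (\<Sum>b\<in>Basis. ((fst h *\<^sub>R v s + snd h) \<bullet> b) *\<^sub>R pd (tube R) (0, b) F (s, x))"
    if "(s, x) \<in> tube R" for h s x
  proof -
    interpret bounded_linear "\<lambda>h. pd (tube R) h F (s, x)"
      using Ck_Suc_deriv[OF F that] by (rule has_derivative_bounded_linear)
    have "(fst h, fst h *\<^sub>R v s + snd h) =
        fst h *\<^sub>R (1, 0) + (\<Sum>b\<in>Basis. ((fst h *\<^sub>R v s + snd h) \<bullet> b) *\<^sub>R (0, b))"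
      by (simp add: prod_eq_iff fst_sum snd_sum euclidean_representation)
    then show ?thesis by (simp only: add sum scaleR dt_def)
  qed
  have CH: "Ck (Suc 0) ?S (\<lambda>p. F (straighten p))"
  proof (rule Ck_SucI[OF S dF])
    fix h
    have "continuous_on ?S (\<lambda>p. fst h *\<^sub>R dt (tube R) F (straighten p) +
        (\<Sum>b\<in>Basis. ((fst h *\<^sub>R v (fst p) + snd h) \<bullet> b) *\<^sub>R pd (tube R) (0, b) F (straighten p)))"
    proof (intro continuous_intros)
      show "continuous_on ?S (\<lambda>p. dt (tube R) F (straighten p))"
        by (rule continuous_on_compose2[OF continuous_dt[OF F] cs]) (simp add: straighten_image)
      show "continuous_on ?S (\<lambda>p. pd (tube R) (0, b) F (straighten p))" for b
        by (rule continuous_on_compose2[OF _ cs, of "tube R"]) (use F in \<open>auto simp: straighten_image\<close>)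
      show "continuous_on ?S (\<lambda>p. v (fst p))"
        by (rule continuous_on_compose2[OF continuous_v]) (auto intro!: continuous_intros)
    qed
    then show "Ck 0 ?S (\<lambda>p. pd (tube R) (fst h, fst h *\<^sub>R v (fst p) + snd h) F (straighten p))"
      unfolding Ck.simps
      by (rule continuous_on_eq) (use straighten_image[of R] in \<open>auto simp: straighten_def intro!: lin[symmetric]\<close>)
  qed
  have shift: "ball_int R s F' = (LINT y:cball 0 R|lborel. F' (s, r s + y))"
    if "continuous_on (tube R) F'" "s \<in> I" for s and F' :: "spacetime \<Rightarrow> 'b"
    unfolding ball_int_def by (rule integral_cball_shift[OF continuous_slice[OF that]])
  have c1: "continuous_on (tube R) (\<lambda>p. pd (tube R) (0, v (fst p)) F p)"
  proof (rule continuous_on_eq)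
    show "continuous_on (tube R) (\<lambda>p. \<Sum>b\<in>Basis. (v (fst p) \<bullet> b) *\<^sub>R pd (tube R) (0, b) F p)"
    proof (intro continuous_intros)
      show "continuous_on (tube R) (\<lambda>p. v (fst p))"
        by (rule continuous_on_compose2[OF continuous_v]) (auto intro!: continuous_intros simp: tube_def)
    qed (use F in auto)
    fix p assume "p \<in> tube R"
    then show "(\<Sum>b\<in>Basis. (v (fst p) \<bullet> b) *\<^sub>R pd (tube R) (0, b) F p) = pd (tube R) (0, v (fst p)) F p"
      using lin[of "fst p" "snd p" "(0, v (fst p))"] by simp
  qed
  have sph: "sphere_int R s (\<lambda>n p. (v s \<bullet> n) *\<^sub>R F p) = ball_int R s (\<lambda>p. pd (tube R) (0, v (fst p)) F p)"
    if "s \<in> I" for s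
    unfolding sphere_transport[OF R that F] by (simp add: ball_int_def)
  show "continuous_on I (\<lambda>t. sphere_int R t (\<lambda>n p. (v t \<bullet> n) *\<^sub>R F p))"
    by (rule continuous_on_eq[OF continuous_ball_int[OF c1]]) (simp add: sph)
  assume t: "t \<in> I"
  have "((\<lambda>t. LINT y:cball 0 R|lborel. F (straighten (t, y))) has_vector_derivative
     (LINT y:cball 0 R|lborel. pd ?S (1, 0) (\<lambda>p. F (straighten p)) (t, y))) (at t within I)"
    by (rule leibniz_cball[OF T_less CH t])
  also have "(LINT y:cball 0 R|lborel. pd ?S (1, 0) (\<lambda>p. F (straighten p)) (t, y)) =
      (LINT y:cball 0 R|lborel. dt (tube R) F (t, r t + y) + pd (tube R) (0, v t) F (t, r t + y))"
  proof (rule set_lebesgue_integral_cong)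
    show "\<forall>y. y \<in> cball 0 R \<longrightarrow> pd ?S (1, 0) (\<lambda>p. F (straighten p)) (t, y) =
        dt (tube R) F (t, r t + y) + pd (tube R) (0, v t) F (t, r t + y)"
    proof (intro allI impI)
      fix y :: "real^3" assume y: "y \<in> cball 0 R"
      have p: "(t, r t + y) \<in> tube R" using t y by (intro tubeI) (auto simp: dist_norm)
      have "pd ?S (1, 0) (\<lambda>p. F (straighten p)) (t, y) = pd (tube R) (1, v t) F (t, r t + y)"
        using pd_eq[OF S _ dF, of "(t, y)" "(1, 0)"] t y by (simp add: straighten_def)
      then show "pd ?S (1, 0) (\<lambda>p. F (straighten p)) (t, y) =
          dt (tube R) F (t, r t + y) + pd (tube R) (0, v t) F (t, r t + y)"
        using lin[OF p, of "(1, 0)"] lin[OF p, of "(0, v t)"] by simp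
    qed
  qed simp
  also have "\<dots> = ball_int R t (\<lambda>p. dt (tube R) F p + pd (tube R) (0, v (fst p)) F p)"
    using shift[OF continuous_on_add[OF continuous_dt[OF F] c1] t] by simp
  also have "\<dots> = ball_int R t (dt (tube R) F) + sphere_int R t (\<lambda>n p. (v t \<bullet> n) *\<^sub>R F p)"
    unfolding sph[OF t] unfolding ball_int_def
    by (intro integral_add ball_integrable continuous_dt[OF F] c1 t)
  finally show "((\<lambda>t. ball_int R t F) has_vector_derivative
      ball_int R t (dt (tube R) F) + sphere_int R t (\<lambda>n p. (v t \<bullet> n) *\<^sub>R F p)) (at t within I)"
    by (rule has_vector_derivative_transform[OF t, rotated])
       (simp add: shift[OF cF] straighten_def)
qed

end

subsection \<open>Regularity of the densities\<close>

lemma Ck_mult: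
  fixes F G :: "'a::real_normed_vector \<Rightarrow> 'b::{real_normed_algebra, real_inner}"
  assumes "solid S" "Ck k S F" "Ck k S G"
  shows "Ck k S (\<lambda>p. F p * G p)"
  by (rule Ck_bilinear[OF assms(1) bounded_bilinear_mult assms(2,3)])

lemma Ck_scaleR:
  fixes F :: "'a::real_normed_vector \<Rightarrow> real" and G :: "'a \<Rightarrow> 'b::real_inner"
  assumes "solid S" "Ck k S F" "Ck k S G"
  shows "Ck k S (\<lambda>p. F p *\<^sub>R G p)"
  by (rule Ck_bilinear[OF assms(1) bounded_bilinear_scaleR assms(2,3)])

lemma Ck_inner:
  fixes F G :: "'a::real_normed_vector \<Rightarrow> 'b::real_inner"
  assumes "solid S" "Ck k S F" "Ck k S G"
  shows "Ck k S (\<lambda>p. F p \<bullet> G p)"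
  by (rule Ck_bilinear[OF assms(1) bounded_bilinear_inner assms(2,3)])

lemma Ck_of_real:
  fixes F :: "'a::real_normed_vector \<Rightarrow> real"
  assumes "solid S" "Ck k S F"
  shows "Ck k S (\<lambda>p. complex_of_real (F p))"
  by (rule Ck_linear[OF assms(1) bounded_linear_of_real assms(2)])

lemma Ck_Re:
  assumes "solid S" "Ck k S F"
  shows "Ck k S (\<lambda>p. Re (F p))"
  by (rule Ck_linear[OF assms(1) bounded_linear_Re assms(2)])

lemma Ck_cnj:
  assumes "solid S" "Ck k S F"
  shows "Ck k S (\<lambda>p. cnj (F p))"
  by (rule Ck_linear[OF assms(1) bounded_linear_cnj assms(2)])

lemma Ck_vec_nth:
  fixes F :: "'a::real_normed_vector \<Rightarrow> real^'n"
  assumes "solid S" "Ck k S F"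
  shows "Ck k S (\<lambda>p. F p $ i)"
  by (rule Ck_linear[OF assms(1) bounded_linear_vec_nth assms(2)])

lemma Ck_vec:
  fixes F :: "'a::real_normed_vector \<Rightarrow> real^'n"
  assumes "solid S" "\<And>i. Ck k S (\<lambda>p. F p $ i)"
  shows "Ck k S F"
proof -
  have "Ck k S (\<lambda>p. \<Sum>i\<in>UNIV. F p $ i *\<^sub>R (axis i 1 :: real^'n))"
    by (intro Ck_sum[OF assms(1)] Ck_scaleR[OF assms(1)] Ck_const[OF assms(1)] assms(2))
  moreover have "(\<Sum>i\<in>UNIV. F p $ i *\<^sub>R (axis i 1 :: real^'n)) = F p" for p
    using basis_expansion[of "F p"] by (simp add: scalar_mult_eq_scaleR)
  ultimately show ?thesis by simp
qed

lemmas Ck_intros = Ck_const Ck_id Ck_add Ck_diff Ck_minus Ck_sum Ck_mult Ck_scaleR Ck_inner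
  Ck_of_real Ck_Re Ck_cnj Ck_vec_nth

section \<open>Scaling and regularity of the nonlinear term\<close>

lemma Ga_scale:
  assumes "a > 0"
  shows "Ga G1' a s = Ga G1' 1 (a ^ 3 * s) / a ^ 5"
proof -
  have "(\<lambda>x. x / a ^ 3) ` {0..a ^ 3 * s} = {0..s}"
  proof
    show "{0..s} \<subseteq> (\<lambda>x. x / a ^ 3) ` {0..a ^ 3 * s}"
    proof
      fix x assume "x \<in> {0..s}"
      then have "x = (a ^ 3 * x) / a ^ 3" "a ^ 3 * x \<in> {0..a ^ 3 * s}" using assms by auto
      then show "x \<in> (\<lambda>x. x / a ^ 3) ` {0..a ^ 3 * s}" by blast
    qed
  qed (use assms in \<open>auto simp: divide_le_eq mult.commute\<close>)
  then have "integral {0..s} (\<lambda>x. G1' (a ^ 3 * x)) = integral {0..a ^ 3 * s} G1' / a ^ 3"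
    using integral_stretch_real[of "a ^ 3" 0 "a ^ 3 * s" G1'] assms by simp
  moreover have "Ga G1' a s = integral {0..s} (\<lambda>x. G1' (a ^ 3 * x)) / a\<^sup>2"
    using integral_mult_left[of "{0..s}" "\<lambda>x. G1' (a ^ 3 * x)" "1 / a\<^sup>2"]
    by (simp add: Ga_def Ga'_def[abs_def])
  moreover have "Ga G1' 1 (a ^ 3 * s) = integral {0..a ^ 3 * s} G1'"
    by (simp add: Ga_def Ga'_def[abs_def])
  ultimately show ?thesis by (simp add: power_add[symmetric])
qed

text \<open>The assumption on the nonlinearity concerns \<open>z\<close> mapped to \<open>G1\<close>
  of its squared modulus, so it covers zeros of the wave even if \<open>G1'\<close> is unbounded
  near 0. Scaling \<open>z\<close> by the square root of \<open>a ^ 3\<close> reduces every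
  \<open>a\<close> to \<open>a = 1\<close>.\<close>

lemma Ck_Ga:
  assumes "nonlinearity_condition G1'" "a > 0"
  shows "Ck (Suc 0) UNIV (\<lambda>z. Ga G1' a ((cmod z)\<^sup>2))"
proof -
  have 1: "Ck (Suc 0) UNIV (\<lambda>z. Ga G1' 1 ((cmod z)\<^sup>2))"
  proof (rule Ck_SucI[OF solid_UNIV, where
        F' = "\<lambda>z h. Re (nonlin_g G1' z * cnj h + cnj (nonlin_g G1' z) * h)"])
    fix z
    have "((\<lambda>z. complex_of_real (Ga G1' 1 ((cmod z)\<^sup>2))) has_derivative
        (\<lambda>h. nonlin_g G1' z * cnj h + cnj (nonlin_g G1' z) * h)) (at z)"
      using assms(1) unfolding nonlinearity_condition_def by blast
    from bounded_linear.has_derivative[OF bounded_linear_Re this]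
    show "((\<lambda>z. Ga G1' 1 ((cmod z)\<^sup>2)) has_derivative
        (\<lambda>h. Re (nonlin_g G1' z * cnj h + cnj (nonlin_g G1' z) * h))) (at z)"
      by (simp only: Re_complex_of_real)
  next
    fix h
    have "continuous_on UNIV (nonlin_g G1')" using assms(1) by (simp add: nonlinearity_condition_def)
    then show "Ck 0 UNIV (\<lambda>z. Re (nonlin_g G1' z * cnj h + cnj (nonlin_g G1' z) * h))"
      unfolding Ck.simps by (intro continuous_intros)
  qed
  define k where "k = sqrt (a ^ 3)"
  have "Ck (Suc 0) UNIV (\<lambda>z. complex_of_real k * z)"
    by (intro Ck_intros solid_UNIV)
  from Ck_comp[OF solid_UNIV this 1]
  have "Ck (Suc 0) UNIV (\<lambda>z. Ga G1' 1 ((cmod (of_real k * z))\<^sup>2) * (1 / a ^ 5))"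
    by (intro Ck_intros solid_UNIV) auto
  moreover have "(cmod (of_real k * z))\<^sup>2 = a ^ 3 * (cmod z)\<^sup>2" for z
    using assms(2) by (simp add: norm_mult power_mult_distrib k_def)
  ultimately show ?thesis by (simp add: Ga_scale[OF assms(2), symmetric])
qed

context nls_trajectory
begin

lemma Ck_fields: "Ck (Suc 0) D A" "Ck (Suc 0) D \<phi>" "Ck (Suc 0) D B" "Ck (Suc 0) D E"
proof -
  note S = solid_open[OF open_D]
  have C: "Ck (Suc (Suc 0)) D A" "Ck (Suc (Suc 0)) D \<phi>" using Ck_A Ck_\<phi> by (simp_all only: numeral_2_eq_2)
  from C[THEN Ck_Suc_imp] show "Ck (Suc 0) D A" "Ck (Suc 0) D \<phi>" .
  have A: "Ck (Suc 0) D (dx D j (\<lambda>p. A p $ k))" for j k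
    using Ck_vec_nth[OF S C(1), of k] by (simp only: Ck.simps(2)[of "Suc 0"] dx_def)
  have \<phi>: "Ck (Suc 0) D (dx D j \<phi>)" for j
    using C(2) by (simp only: Ck.simps(2)[of "Suc 0"] dx_def)
  have At: "Ck (Suc 0) D (dt D A)"
    using C(1) by (simp only: Ck.simps(2)[of "Suc 0"] dt_def)
  have B: "Ck (Suc 0) D (\<lambda>p. curl D A p $ i)" for i
    using exhaust_3[of i] by (elim disjE) (simp_all only: curl_def vector_3, (intro Ck_diff S A)+)
  then show "Ck (Suc 0) D B" unfolding B_def[abs_def] by (intro Ck_vec[OF S])
  have "Ck (Suc 0) D (grad D \<phi>)" using \<phi> by (intro Ck_vec[OF S]) (simp add: grad_def)
  then show "Ck (Suc 0) D E" unfolding E_def[abs_def] by (intro Ck_intros S At)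
qed

end

locale nls_wave = nls_trajectory +
  fixes a R :: real and \<psi> :: "spacetime \<Rightarrow> complex"
  assumes a_pos: "a > 0" and R_pos: "R > 0" and tube_D: "tube R \<subseteq> D" and Ck_\<psi>: "Ck 2 (tube R) \<psi>"
begin

lemma solid_tube_R: "solid (tube R)" using solid_tube[OF R_pos] .

lemma Ck_restrict:
  fixes F :: "spacetime \<Rightarrow> 'b::real_inner"
  assumes "Ck k D F" shows "Ck k (tube R) F"
  by (rule Ck_subset[OF solid_tube_R assms tube_D])

lemmas Ck_fields_tube = Ck_fields[THEN Ck_restrict]

lemma Ck_cov:
  assumes "Ck (Suc (Suc 0)) (tube R) F"
  shows "Ck (Suc 0) (tube R) (cov_x R j F)" "Ck (Suc 0) (tube R) (cov_x_star R j F)"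
    "Ck (Suc 0) (tube R) (cov_t R F)" "Ck (Suc 0) (tube R) (cov_t_star R F)"
proof -
  have 1: "Ck (Suc 0) (tube R) (dx (tube R) j F)" "Ck (Suc 0) (tube R) (dt (tube R) F)"
    using assms by (simp_all only: Ck.simps(2)[of "Suc 0"] dx_def dt_def)
  note 2 = Ck_Suc_imp[OF assms]
  show "Ck (Suc 0) (tube R) (cov_x R j F)" "Ck (Suc 0) (tube R) (cov_x_star R j F)"
    "Ck (Suc 0) (tube R) (cov_t R F)" "Ck (Suc 0) (tube R) (cov_t_star R F)"
    unfolding cov_x_def[abs_def] cov_x_star_def[abs_def] cov_t_def[abs_def] cov_t_star_def[abs_def]
    by (intro Ck_intros solid_tube_R Ck_fields_tube 1 2)+
qed

text \<open>Each density contains at most first derivatives of \<open>\<psi>\<close>, so class 2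
  leaves class 1, as transport and the divergence theorem require. In \<open>T\<close> the energy
  \<open>u\<close> also needs \<open>Ck_Ga\<close>.\<close>

lemma Ck_densities:
  shows "Ck (Suc 0) (tube R) (\<rho> \<psi>)" "Ck (Suc 0) (tube R) (J R \<psi>)" "Ck (Suc 0) (tube R) (P R \<psi>)"
    "Ck (Suc 0) (tube R) (T R a \<psi> i j)"
proof -
  note S = solid_tube_R
  have C: "Ck (Suc (Suc 0)) (tube R) \<psi>" using Ck_\<psi> by (simp only: numeral_2_eq_2)
  have Cc: "Ck (Suc (Suc 0)) (tube R) (cnj \<circ> \<psi>)" using Ck_cnj[OF S C] by (simp only: o_def)
  note C1 = Ck_Suc_imp[OF C] and cov = Ck_cov[OF C] Ck_cov[OF Cc]
  show "Ck (Suc 0) (tube R) (\<rho> \<psi>)" unfolding \<rho>_def[abs_def] by (intro Ck_intros S C1)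
  show "Ck (Suc 0) (tube R) (J R \<psi>)"
    by (rule Ck_vec[OF S], unfold J_def vec_lambda_beta) (intro Ck_intros S C1 cov)
  show "Ck (Suc 0) (tube R) (P R \<psi>)"
    by (rule Ck_vec[OF S], unfold P_def vec_lambda_beta) (intro Ck_intros S C1 cov)
  have Ga: "Ck (Suc 0) (tube R) (\<lambda>p. Ga G1' a ((cmod (\<psi> p))\<^sup>2))"
    by (rule Ck_comp[OF S C1 Ck_Ga[OF nonlin a_pos]]) simp
  have sq: "Ck (Suc 0) (tube R) (\<lambda>p. (cmod (cov_x R j \<psi> p))\<^sup>2)" for j
    unfolding power2_norm_eq_inner by (intro Ck_intros S cov)
  have u: "Ck (Suc 0) (tube R) (u R a \<psi>)"
    unfolding u_def[abs_def] by (intro Ck_intros S Ga sq)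
  show "Ck (Suc 0) (tube R) (T R a \<psi> i j)"
  proof (cases "i = j")
    case True
    then show ?thesis unfolding T_def[abs_def] by (simp only: simp_thms if_True if_False) (intro Ck_intros S C1 cov u)
  next
    case False
    then show ?thesis unfolding T_def[abs_def] by (simp only: simp_thms if_True if_False) (intro Ck_intros S C1 cov u)
  qed
qed

lemma continuous_force: "continuous_on (tube R) (f R \<psi>)"
  unfolding f_def[abs_def]
  using Ck_imp_continuous[OF Ck_densities(1)] Ck_imp_continuous[OF Ck_densities(2)]
    Ck_imp_continuous[OF Ck_fields_tube(3)] Ck_imp_continuous[OF Ck_fields_tube(4)]
  by (intro continuous_intros bounded_bilinear.continuous_on[OF bilinear_cross[THEN bilinear_conv_bounded_bilinear[THEN iffD1]]])

text \<open>The two brackets are opposite, so current and momentum are pointwise proportional. This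
  couples the charge law, which moves the center, to the momentum law, which contains the
  force.\<close>

lemma J_eq: "J R \<psi> p = (q / m) *\<^sub>R P R \<psi> p"
  using m_pos by (simp add: J_def P_def vec_eq_iff field_simps)

end

subsection \<open>Integrated balances\<close>

lemma Ck_divide:
  fixes g :: "'a::real_normed_vector \<Rightarrow> real"
  assumes S: "solid S" and g: "Ck (Suc 0) S g" and nz: "\<And>x. x \<in> S \<Longrightarrow> g x \<noteq> 0"
  shows "Ck (Suc 0) S (\<lambda>x. 1 / g x)"
proof (rule Ck_SucI[OF S])
  show "((\<lambda>x. 1 / g x) has_derivative (\<lambda>h. - pd S h g x / (g x)\<^sup>2)) (at x within S)" if "x \<in> S" for x
    using has_derivative_divide'[OF has_derivative_const[of 1] Ck_Suc_deriv[OF g that] nz[OF that]]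
    by (simp add: power2_eq_square)
  show "Ck 0 S (\<lambda>x. - pd S h g x / (g x)\<^sup>2)" for h
    unfolding Ck.simps using g Ck_imp_continuous[OF g] nz by (intro continuous_intros) auto
qed

lemma Ck_interval:
  fixes g :: "real \<Rightarrow> 'b::real_inner"
  assumes ab: "a < b" and g: "Ck (Suc 0) {a..b} g"
  shows "t \<in> {a..b} \<Longrightarrow> (g has_vector_derivative vector_derivative g (at t within {a..b})) (at t within {a..b})"
    and "t \<in> {a..b} \<Longrightarrow> pd {a..b} h g t = h *\<^sub>R vector_derivative g (at t within {a..b})"
    and "continuous_on {a..b} (\<lambda>t. vector_derivative g (at t within {a..b}))"
proof -
  show 1: "(g has_vector_derivative vector_derivative g (at t within {a..b})) (at t within {a..b})"
    if "t \<in> {a..b}" for t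
    using g that by (simp add: differentiable_on_def vector_derivative_works[symmetric])
  show 2: "pd {a..b} h g t = h *\<^sub>R vector_derivative g (at t within {a..b})" if "t \<in> {a..b}" for t h
    using pd_eq[OF solid_interval[OF ab] that] 1[OF that] by (simp add: has_vector_derivative_def)
  show "continuous_on {a..b} (\<lambda>t. vector_derivative g (at t within {a..b}))"
    by (rule continuous_on_eq[where f = "pd {a..b} 1 g"]) (use g 2 in auto)
qed

context nls_trajectory
begin

text \<open>The base time may be any point of the interval, so the oriented integrals also run
  backwards.\<close>

lemma interval_integrable:
  fixes g :: "real \<Rightarrow> 'b::euclidean_space"
  assumes "t0 \<in> I" "t \<in> I" "continuous_on I g"
  shows "interval_lebesgue_integrable lborel (ereal t0) (ereal t) g"
proof (cases "t0 \<le> t")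
  case True
  then show ?thesis using assms
    by (intro interval_integrable_continuous_on continuous_on_subset[OF assms(3)]) auto
next
  case False
  then have "interval_lebesgue_integrable lborel (ereal t) (ereal t0) g" using assms
    by (intro interval_integrable_continuous_on continuous_on_subset[OF assms(3)]) auto
  then show ?thesis by (subst interval_integrable_endpoints_reverse)
qed

lemma interval_FTC:
  fixes g g' :: "real \<Rightarrow> 'b::euclidean_space"
  assumes "t0 \<in> I" "t \<in> I" "continuous_on I g'"
    and "\<And>s. s \<in> I \<Longrightarrow> (g has_vector_derivative g' s) (at s within I)"
  shows "(LBINT s=ereal t0..ereal t. g' s) = g t - g t0"
proof (rule interval_integral_FTC_finite)
  have sub: "{min t0 t..max t0 t} \<subseteq> I" using assms(1,2) by auto
  show "continuous_on {min t0 t..max t0 t} g'" by (rule continuous_on_subset[OF assms(3) sub])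
  fix s assume "min t0 t \<le> s" "s \<le> max t0 t"
  then show "(g has_vector_derivative g' s) (at s within {min t0 t..max t0 t})"
    by (intro has_vector_derivative_within_subset[OF assms(4) sub]) (use sub in auto)
qed

lemma interval_cong:
  assumes "t0 \<in> I" "t \<in> I" "\<And>s. s \<in> I \<Longrightarrow> g s = h s"
  shows "(LBINT s=ereal t0..ereal t. g s) = (LBINT s=ereal t0..ereal t. h s)"
  by (rule interval_integral_cong) (use assms in \<open>auto simp: min_def max_def einterval_iff split: if_splits\<close>)

lemma ball_int_cong:
  assumes "t \<in> I" "\<And>p. p \<in> tube R \<Longrightarrow> F p = G p"
  shows "ball_int R t F = ball_int R t G"
  unfolding ball_int_def by (rule integral_cong) (use assms tubeI in blast)

lemma ball_int_add:
  fixes F G :: "spacetime \<Rightarrow> 'b::euclidean_space"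
  assumes "t \<in> I" "continuous_on (tube R) F" "continuous_on (tube R) G"
  shows "ball_int R t (\<lambda>p. F p + G p) = ball_int R t F + ball_int R t G"
  unfolding ball_int_def by (intro integral_add ball_integrable assms)

lemma ball_int_diff:
  fixes F G :: "spacetime \<Rightarrow> 'b::euclidean_space"
  assumes "t \<in> I" "continuous_on (tube R) F" "continuous_on (tube R) G"
  shows "ball_int R t (\<lambda>p. F p - G p) = ball_int R t F - ball_int R t G"
  unfolding ball_int_def by (intro integral_diff ball_integrable assms)

lemma ball_int_scaleR_right: "ball_int R t (\<lambda>p. k *\<^sub>R F p) = k *\<^sub>R ball_int R t F"
  unfolding ball_int_def by (rule integral_cmul)

lemma ball_int_scaleR_left:
  assumes "t \<in> I" "continuous_on (tube R) F"
  shows "ball_int R t (\<lambda>p. F p *\<^sub>R k) = ball_int R t F *\<^sub>R k"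
  unfolding ball_int_def
  using integral_linear[OF ball_integrable[OF assms(2,1)] bounded_linear_scaleR_left] by (simp add: o_def)

lemma Ck_ball_int:
  fixes F :: "spacetime \<Rightarrow> 'b::euclidean_space"
  assumes R: "R > 0" and F: "Ck (Suc 0) (tube R) F"
  shows "Ck (Suc 0) I (\<lambda>t. ball_int R t F)"
proof (rule Ck_SucI[OF solid_I ball_transport(1)[OF R F, unfolded has_vector_derivative_def]])
  fix h
  show "Ck 0 I (\<lambda>t. h *\<^sub>R (ball_int R t (dt (tube R) F) + sphere_int R t (\<lambda>n p. (v t \<bullet> n) *\<^sub>R F p)))"
    unfolding Ck.simps
    by (intro continuous_intros continuous_ball_int continuous_dt ball_transport(2) R F)
qed

lemma ball_balance:
  fixes F :: "spacetime \<Rightarrow> 'b::euclidean_space"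
  assumes R: "R > 0" and F: "Ck (Suc 0) (tube R) F" and I: "t0 \<in> I" "t \<in> I"
  shows "ball_int R t F - ball_int R t0 F = (LBINT s=ereal t0..ereal t. ball_int R s (dt (tube R) F))
    + (LBINT s=ereal t0..ereal t. sphere_int R s (\<lambda>n p. (v s \<bullet> n) *\<^sub>R F p))"
proof -
  note c = continuous_ball_int[OF continuous_dt[OF F]] ball_transport(2)[OF R F]
  show ?thesis
    using interval_FTC[OF I continuous_on_add[OF c] ball_transport(1)[OF R F]]
    by (simp only: interval_lebesgue_integral_add(2)[OF c[THEN interval_integrable[OF I]]])
qed

lemma sphere_tensor:
  fixes X :: "3 \<Rightarrow> 3 \<Rightarrow> spacetime \<Rightarrow> real"
  assumes R: "R > 0" and t: "t \<in> I" and X: "\<And>i j. Ck (Suc 0) (tube R) (X i j)"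
  shows "sphere_int R t (\<lambda>n p. \<chi> j. \<Sum>i\<in>UNIV. n $ i * X i j p) = ball_int R t (div_tensor (tube R) X)"
proof -
  note S = solid_tube[OF R]
  have C: "Ck (Suc 0) (tube R) (\<lambda>p. \<chi> j. X i j p)" for i
    by (rule Ck_vec[OF S]) (simp only: vec_lambda_beta X)
  have "(\<chi> j. \<Sum>i\<in>UNIV. n $ i * X i j p) = (\<Sum>i\<in>UNIV. n $ i *\<^sub>R (\<chi> j. X i j p))" for n :: "real^3" and p
    by (simp add: vec_eq_iff sum_component)
  then have "sphere_int R t (\<lambda>n p. \<chi> j. \<Sum>i\<in>UNIV. n $ i * X i j p) =
      ball_int R t (\<lambda>p. \<Sum>i\<in>UNIV. dx (tube R) i (\<lambda>p. \<chi> j. X i j p) p)"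
    using sphere_gauss[OF R t C, of "\<lambda>i. i"] by simp
  also have "\<dots> = ball_int R t (div_tensor (tube R) X)"
  proof (rule ball_int_cong[OF t])
    fix p assume p: "p \<in> tube R"
    have "dx (tube R) i (X i j) p = dx (tube R) i (\<lambda>p. \<chi> j. X i j p) p $ j" for i j
      using pd_linear[OF S bounded_linear_vec_nth C p, of _ i j] by (simp add: dx_def)
    then show "(\<Sum>i\<in>UNIV. dx (tube R) i (\<lambda>p. \<chi> j. X i j p) p) = div_tensor (tube R) X p"
      by (simp add: div_tensor_def vec_eq_iff sum_component)
  qed
  finally show ?thesis .
qed

lemma continuous_div_tensor:
  assumes "\<And>i j. Ck (Suc 0) (tube R) (X i j)"
  shows "continuous_on (tube R) (div_tensor (tube R) X)"
  unfolding div_tensor_def[abs_def]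
  by (intro continuous_on_vec_lambda continuous_on_sum continuous_dx assms)

lemma continuous_div3:
  assumes "R > 0" "Ck (Suc 0) (tube R) X"
  shows "continuous_on (tube R) (div3 (tube R) X)"
  unfolding div3_def[abs_def]
  by (intro continuous_on_sum continuous_dx Ck_vec_nth assms solid_tube)

lemma sphere_flux:
  assumes R: "R > 0" and t: "t \<in> I" and X: "Ck (Suc 0) (tube R) X"
  shows "sphere_int R t (\<lambda>n p. n \<bullet> X p) = ball_int R t (div3 (tube R) X)"
  using sphere_gauss[OF R t, of "\<lambda>i p. X p $ i"] Ck_vec_nth[OF solid_tube[OF R] X]
  by (simp add: inner_vec_def div3_def[abs_def])

text \<open>In the divergence of \<open>X $ i *\<^sub>R (x - k)\<close>, differentiating
  \<open>x - k\<close> contributes \<open>X $ i\<close> times the \<open>i\<close>-th unit vector.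
  These sum to \<open>X\<close>, which is how the total current enters the motion of the
  center.\<close>

lemma sphere_flux_moment:
  assumes R: "R > 0" and t: "t \<in> I" and X: "Ck (Suc 0) (tube R) X"
  shows "sphere_int R t (\<lambda>n p. (n \<bullet> X p) *\<^sub>R (snd p - k)) =
    ball_int R t (\<lambda>p. div3 (tube R) X p *\<^sub>R (snd p - k)) + ball_int R t X"
proof -
  note S = solid_tube[OF R]
  have C1: "Ck (Suc 0) (tube R) (\<lambda>p. X p $ i)" for i by (rule Ck_vec_nth[OF S X])
  have C2: "Ck (Suc 0) (tube R) (\<lambda>p. snd p - k)"
    by (intro Ck_diff[OF S] Ck_linear[OF S bounded_linear_snd] Ck_id[OF S] Ck_const[OF S])
  have C: "Ck (Suc 0) (tube R) (\<lambda>p. X p $ i *\<^sub>R (snd p - k))" for i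
    by (intro Ck_scaleR[OF S] C1 C2)
  have "(n \<bullet> X p) *\<^sub>R (snd p - k) = (\<Sum>i\<in>UNIV. n $ i *\<^sub>R (X p $ i *\<^sub>R (snd p - k)))" for n and p :: spacetime
    by (simp add: inner_vec_def scaleR_sum_left)
  then have "sphere_int R t (\<lambda>n p. (n \<bullet> X p) *\<^sub>R (snd p - k)) =
      ball_int R t (\<lambda>p. \<Sum>i\<in>UNIV. dx (tube R) i (\<lambda>p. X p $ i *\<^sub>R (snd p - k)) p)"
    using sphere_gauss[OF R t C, of "\<lambda>i. i"] by simp
  also have "\<dots> = ball_int R t (\<lambda>p. div3 (tube R) X p *\<^sub>R (snd p - k) + X p)"
  proof (rule ball_int_cong[OF t])
    fix p assume p: "p \<in> tube R"
    have "pd (tube R) h (\<lambda>p. snd p - k) p = snd h" for h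
      by (rule pd_eq[OF S p]) (auto intro!: derivative_eq_intros)
    then have "dx (tube R) i (\<lambda>p. X p $ i *\<^sub>R (snd p - k)) p =
        X p $ i *\<^sub>R axis i 1 + dx (tube R) i (\<lambda>p. X p $ i) p *\<^sub>R (snd p - k)" for i
      unfolding dx_def pd_bilinear[OF S bounded_bilinear_scaleR C1 C2 p] by simp
    moreover have "(\<Sum>i\<in>UNIV. X p $ i *\<^sub>R axis i 1) = X p"
      using basis_expansion[of "X p"] by (simp add: scalar_mult_eq_scaleR)
    ultimately show "(\<Sum>i\<in>UNIV. dx (tube R) i (\<lambda>p. X p $ i *\<^sub>R (snd p - k)) p) =
        div3 (tube R) X p *\<^sub>R (snd p - k) + X p"
      by (simp add: sum.distrib div3_def scaleR_sum_left)
  qed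
  also have "\<dots> = ball_int R t (\<lambda>p. div3 (tube R) X p *\<^sub>R (snd p - k)) + ball_int R t X"
    by (intro ball_int_add t continuous_intros continuous_div3 R X Ck_imp_continuous[OF X])
  finally show ?thesis .
qed

end

section \<open>Exact balances of momentum, charge and first moment\<close>

context nls_wave
begin

text \<open>Transport turns the time derivative of \<open>P\<close> into its increment minus
  \<open>Q01\<close>, the divergence theorem turns the stress into \<open>Q0\<close>, and
  \<open>Q0'\<close> is by design the sum of all primed contributions.\<close>

lemma momentum_balance:
  assumes laws: "perturbed_laws R a \<psi> \<rho>' J' P' T' f'" and I: "t0 \<in> I" "t \<in> I"
  shows "ball_int R t (P R \<psi>) - ball_int R t0 (P R \<psi>) - Q01 R \<psi> t0 t + Q0 R a \<psi> t0 t
    + Q0' R P' T' f' t0 t = (LBINT s=ereal t0..ereal t. ball_int R s (f R \<psi>))"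
proof -
  have C: "Ck (Suc 0) (tube R) P'" "\<And>i j. Ck (Suc 0) (tube R) (T' i j)" "continuous_on (tube R) f'"
    and law: "\<And>p. p \<in> tube R \<Longrightarrow> dt (tube R) (P R \<psi>) p + dt (tube R) P' p
        + div_tensor (tube R) (T R a \<psi>) p + div_tensor (tube R) T' p = f R \<psi> p + f' p"
    using laws unfolding perturbed_laws_def One_nat_def by blast+
  let ?bP = "\<lambda>s. ball_int R s (dt (tube R) (P R \<psi>))" and ?bP' = "\<lambda>s. ball_int R s (dt (tube R) P')"
  let ?sP = "\<lambda>s. sphere_int R s (\<lambda>n p. (v s \<bullet> n) *\<^sub>R P R \<psi> p)"
    and ?sP' = "\<lambda>s. sphere_int R s (\<lambda>n p. (v s \<bullet> n) *\<^sub>R P' p)"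
  let ?T = "\<lambda>s. ball_int R s (div_tensor (tube R) (T R a \<psi>))"
    and ?T' = "\<lambda>s. ball_int R s (div_tensor (tube R) T')"
  let ?f = "\<lambda>s. ball_int R s (f R \<psi>)" and ?f' = "\<lambda>s. ball_int R s f'"
  note cb = continuous_dt[OF Ck_densities(3)] continuous_dt[OF C(1)] continuous_div_tensor[OF C(2)]
    continuous_div_tensor[OF Ck_densities(4)] continuous_force C(3)
  note ii = cb[THEN continuous_ball_int, THEN interval_integrable[OF I]]
  note 1 = ball_balance[OF R_pos Ck_densities(3) I] and 2 = ball_balance[OF R_pos C(1) I]
  have 3: "Q0 R a \<psi> t0 t = (LBINT s=ereal t0..ereal t. ?T s)"
    unfolding Q0_def by (rule interval_cong[OF I]) (rule sphere_tensor[OF R_pos _ Ck_densities(4)])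
  have "?f s = ?bP s + ?bP' s + ?T s + ?T' s - ?f' s" if s: "s \<in> I" for s
  proof -
    have "?f s + ?f' s = ball_int R s (\<lambda>p. f R \<psi> p + f' p)"
      by (intro ball_int_add[symmetric] s cb)
    also have "\<dots> = ball_int R s (\<lambda>p. dt (tube R) (P R \<psi>) p + dt (tube R) P' p
        + div_tensor (tube R) (T R a \<psi>) p + div_tensor (tube R) T' p)"
      by (rule ball_int_cong[OF s]) (simp only: law)
    also have "\<dots> = ?bP s + ?bP' s + ?T s + ?T' s"
      by (simp only: ball_int_add[OF s] cb continuous_on_add)
    finally show ?thesis by (simp add: algebra_simps)
  qed
  then have "(LBINT s=ereal t0..ereal t. ?f s) =
      (LBINT s=ereal t0..ereal t. ?bP s + ?bP' s + ?T s + ?T' s - ?f' s)"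
    by (rule interval_cong[OF I])
  also have "\<dots> = (LBINT s=ereal t0..ereal t. ?bP s) + (LBINT s=ereal t0..ereal t. ?bP' s)
      + (LBINT s=ereal t0..ereal t. ?T s) + (LBINT s=ereal t0..ereal t. ?T' s)
      - (LBINT s=ereal t0..ereal t. ?f' s)"
    by (simp only: interval_lebesgue_integral_add interval_lebesgue_integral_diff ii)
  finally show ?thesis
    unfolding Q01_def Q0'_def 1 2 3 by (simp add: algebra_simps)
qed

lemma charge_balance:
  assumes laws: "perturbed_laws R a \<psi> \<rho>' J' P' T' f'" and I: "t0 \<in> I" "t \<in> I"
  shows "charge R \<psi> t - charge R \<psi> t0 - Q23 R \<psi> t0 t + Q3' R \<rho>' J' t0 t = 0"
proof -
  have C: "Ck (Suc 0) (tube R) \<rho>'" "Ck (Suc 0) (tube R) J'"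
    and law: "\<And>p. p \<in> tube R \<Longrightarrow> dt (tube R) (\<rho> \<psi>) p + dt (tube R) \<rho>' p
        + div3 (tube R) (J R \<psi>) p + div3 (tube R) J' p = 0"
    using laws unfolding perturbed_laws_def One_nat_def by blast+
  let ?b = "\<lambda>s. ball_int R s (dt (tube R) (\<rho> \<psi>))" and ?b' = "\<lambda>s. ball_int R s (dt (tube R) \<rho>')"
  let ?s = "\<lambda>s. sphere_int R s (\<lambda>n p. (v s \<bullet> n) * \<rho> \<psi> p)"
    and ?s' = "\<lambda>s. sphere_int R s (\<lambda>n p. (v s \<bullet> n) * \<rho>' p)"
  let ?J = "\<lambda>s. ball_int R s (div3 (tube R) (J R \<psi>))"
    and ?J' = "\<lambda>s. ball_int R s (div3 (tube R) J')"
  note cb = continuous_dt[OF Ck_densities(1)] continuous_dt[OF C(1)]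
    continuous_div3[OF R_pos Ck_densities(2)] continuous_div3[OF R_pos C(2)]
  note ii = cb[THEN continuous_ball_int, THEN interval_integrable[OF I]]
  have 1: "charge R \<psi> t - charge R \<psi> t0 =
      (LBINT s=ereal t0..ereal t. ?b s) + (LBINT s=ereal t0..ereal t. ?s s)"
    using ball_balance[OF R_pos Ck_densities(1) I] by (simp add: charge_def)
  have 2: "ball_int R t \<rho>' - ball_int R t0 \<rho>' =
      (LBINT s=ereal t0..ereal t. ?b' s) + (LBINT s=ereal t0..ereal t. ?s' s)"
    using ball_balance[OF R_pos C(1) I] by simp
  have 3: "(LBINT s=ereal t0..ereal t. sphere_int R s (\<lambda>n p. n \<bullet> J R \<psi> p)) = (LBINT s=ereal t0..ereal t. ?J s)"
    "(LBINT s=ereal t0..ereal t. sphere_int R s (\<lambda>n p. n \<bullet> J' p)) = (LBINT s=ereal t0..ereal t. ?J' s)"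
    by (rule interval_cong[OF I], rule sphere_flux[OF R_pos _ Ck_densities(2)], assumption)
       (rule interval_cong[OF I], rule sphere_flux[OF R_pos _ C(2)])
  have "?b s + ?b' s + ?J s + ?J' s = 0" if s: "s \<in> I" for s
  proof -
    have "?b s + ?b' s + ?J s + ?J' s = ball_int R s (\<lambda>p. dt (tube R) (\<rho> \<psi>) p + dt (tube R) \<rho>' p
        + div3 (tube R) (J R \<psi>) p + div3 (tube R) J' p)"
      by (simp only: ball_int_add[OF s] cb continuous_on_add)
    also have "\<dots> = ball_int R s (\<lambda>_. 0)"
      by (rule ball_int_cong[OF s]) (simp only: law)
    finally show ?thesis by (simp add: ball_int_def)
  qed
  then have "(LBINT s=ereal t0..ereal t. ?b s + ?b' s + ?J s + ?J' s) = (LBINT s=ereal t0..ereal t. 0)"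
    by (rule interval_cong[OF I])
  then have "(LBINT s=ereal t0..ereal t. ?b s) + (LBINT s=ereal t0..ereal t. ?b' s)
      + (LBINT s=ereal t0..ereal t. ?J s) + (LBINT s=ereal t0..ereal t. ?J' s) = 0"
    by (simp only: interval_lebesgue_integral_add interval_lebesgue_integral_diff ii) simp
  then show ?thesis
    unfolding Q23_def Q3'_def 1 2 3 by (simp add: algebra_simps)
qed

lemma Ck_moment: "Ck (Suc 0) (tube R) (\<lambda>p. \<rho> \<psi> p *\<^sub>R snd p)"
  by (intro Ck_scaleR solid_tube_R Ck_densities Ck_linear[OF _ bounded_linear_snd] Ck_id)

lemma Ck_center:
  assumes "\<And>s. s \<in> I \<Longrightarrow> charge R \<psi> s > 0"
  shows "Ck (Suc 0) I (center R \<psi>)"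
proof -
  have "Ck (Suc 0) I (charge R \<psi>)"
    unfolding charge_def[abs_def] by (rule Ck_ball_int[OF R_pos Ck_densities(1)])
  moreover have "charge R \<psi> s \<noteq> 0" if "s \<in> I" for s using assms[OF that] by simp
  ultimately show ?thesis
    unfolding center_def[abs_def]
    by (intro Ck_scaleR solid_I Ck_divide Ck_ball_int R_pos Ck_moment)
qed

lemma moment_balance:
  assumes laws: "perturbed_laws R a \<psi> \<rho>' J' P' T' f'" and t: "t \<in> I"
    and pos: "\<And>s. s \<in> I \<Longrightarrow> charge R \<psi> s > 0"
  shows "charge R \<psi> t *\<^sub>R vector_derivative (center R \<psi>) (at t within I) =
    ball_int R t (J R \<psi>) - Q20 R \<psi> t - Q22 R \<psi> t - Q2' R \<psi> \<rho>' J' t"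
proof -
  note S = solid_tube_R
  have C: "Ck (Suc 0) (tube R) \<rho>'" "Ck (Suc 0) (tube R) J'"
    and law: "\<And>p. p \<in> tube R \<Longrightarrow> dt (tube R) (\<rho> \<psi>) p + dt (tube R) \<rho>' p
        + div3 (tube R) (J R \<psi>) p + div3 (tube R) J' p = 0"
    using laws unfolding perturbed_laws_def One_nat_def by blast+
  let ?cen = "center R \<psi>" and ?y = "vector_derivative (center R \<psi>) (at t within I)"
  define k where "k = ?cen t"
  have cen: "(?cen has_vector_derivative ?y) (at t within I)"
    by (rule Ck_interval(1)[OF T_less Ck_center[OF pos] t])
  have Csnd: "Ck (Suc 0) (tube R) (\<lambda>p. snd p - k)"
    by (intro Ck_diff S Ck_linear[OF _ bounded_linear_snd] Ck_id Ck_const)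
  have dsnd: "dt (tube R) (\<lambda>p. snd p - k) p = 0" if "p \<in> tube R" for p
  proof -
    have "((\<lambda>p. snd p - k) has_derivative snd) (at p within tube R)"
      by (auto intro!: derivative_eq_intros)
    from pd_eq[OF S that this] show ?thesis by (simp add: dt_def)
  qed
  let ?F = "\<lambda>p. \<rho> \<psi> p *\<^sub>R (snd p - k)"
  have CF: "Ck (Suc 0) (tube R) ?F" by (intro Ck_scaleR S Ck_densities Csnd)
  have dF: "dt (tube R) ?F p = dt (tube R) (\<rho> \<psi>) p *\<^sub>R (snd p - k)" if "p \<in> tube R" for p
    using pd_bilinear[OF S bounded_bilinear_scaleR Ck_densities(1) Csnd that, of "(1, 0)"] dsnd[OF that]
    by (simp add: dt_def)
  have Fs: "ball_int R s ?F = charge R \<psi> s *\<^sub>R (?cen s - k)" if s: "s \<in> I" for s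
  proof -
    have "ball_int R s ?F = ball_int R s (\<lambda>p. \<rho> \<psi> p *\<^sub>R snd p - \<rho> \<psi> p *\<^sub>R k)"
      by (simp add: scaleR_diff_right)
    also have "\<dots> = ball_int R s (\<lambda>p. \<rho> \<psi> p *\<^sub>R snd p) - charge R \<psi> s *\<^sub>R k"
      unfolding charge_def
      using Ck_imp_continuous[OF Ck_densities(1)] Ck_imp_continuous[OF Ck_moment]
      by (subst ball_int_diff[OF s]) (auto intro!: continuous_intros simp: ball_int_scaleR_left[OF s])
    also have "ball_int R s (\<lambda>p. \<rho> \<psi> p *\<^sub>R snd p) = charge R \<psi> s *\<^sub>R ?cen s"
      using pos[OF s] by (simp add: center_def)
    finally show ?thesis by (simp add: scaleR_diff_right)
  qed
  have ch: "(charge R \<psi> has_vector_derivative vector_derivative (charge R \<psi>) (at t within I)) (at t within I)"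
    using Ck_ball_int[OF R_pos Ck_densities(1)]
    by (intro Ck_interval(1)[OF T_less _ t]) (simp add: charge_def[abs_def])
  have "((\<lambda>s. charge R \<psi> s *\<^sub>R (?cen s - k)) has_vector_derivative charge R \<psi> t *\<^sub>R ?y) (at t within I)"
    using bounded_bilinear.has_vector_derivative[OF bounded_bilinear_scaleR ch
        has_vector_derivative_diff[OF cen has_vector_derivative_const[of k]]]
    by (simp add: k_def)
  then have d1: "((\<lambda>s. ball_int R s ?F) has_vector_derivative charge R \<psi> t *\<^sub>R ?y) (at t within I)"
    by (rule has_vector_derivative_transform[OF t, rotated]) (simp add: Fs)
  have "charge R \<psi> t *\<^sub>R ?y = ball_int R t (dt (tube R) ?F) + sphere_int R t (\<lambda>n p. (v t \<bullet> n) *\<^sub>R ?F p)"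
    using vector_derivative_unique_within_closed_interval[unfolded box_real, OF T_less t d1 ball_transport(1)[OF R_pos CF t]] .
  also have "sphere_int R t (\<lambda>n p. (v t \<bullet> n) *\<^sub>R ?F p) = - Q20 R \<psi> t"
    by (simp add: Q20_def k_def sphere_int_def)
  also have "ball_int R t (dt (tube R) ?F) = ball_int R t (\<lambda>p. dt (tube R) (\<rho> \<psi>) p *\<^sub>R (snd p - k))"
    by (rule ball_int_cong[OF t dF])
  finally have 1: "charge R \<psi> t *\<^sub>R ?y = ball_int R t (\<lambda>p. dt (tube R) (\<rho> \<psi>) p *\<^sub>R (snd p - k)) - Q20 R \<psi> t"
    by simp
  let ?m = "\<lambda>g. ball_int R t (\<lambda>p. g p *\<^sub>R (snd p - k))"
  note cb = continuous_dt[OF Ck_densities(1)] continuous_dt[OF C(1)]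
    continuous_div3[OF R_pos Ck_densities(2)] continuous_div3[OF R_pos C(2)]
  note cm = cb[THEN continuous_on_scaleR[OF _ Ck_imp_continuous[OF Csnd]]]
  have "?m (dt (tube R) (\<rho> \<psi>)) + ?m (dt (tube R) \<rho>') + ?m (div3 (tube R) (J R \<psi>)) + ?m (div3 (tube R) J') =
     ball_int R t (\<lambda>p. dt (tube R) (\<rho> \<psi>) p *\<^sub>R (snd p - k) + dt (tube R) \<rho>' p *\<^sub>R (snd p - k)
       + div3 (tube R) (J R \<psi>) p *\<^sub>R (snd p - k) + div3 (tube R) J' p *\<^sub>R (snd p - k))"
    by (simp only: ball_int_add[OF t] cm continuous_on_add)
  also have "\<dots> = ball_int R t (\<lambda>_. 0)"
    by (rule ball_int_cong[OF t]) (simp only: law scaleR_add_left[symmetric] scaleR_zero_left)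
  finally have 2: "?m (dt (tube R) (\<rho> \<psi>)) + ?m (dt (tube R) \<rho>') + ?m (div3 (tube R) (J R \<psi>))
      + ?m (div3 (tube R) J') = 0" by (simp add: ball_int_def)
  have 3: "?m (div3 (tube R) (J R \<psi>)) = Q22 R \<psi> t - ball_int R t (J R \<psi>)"
    using sphere_flux_moment[OF R_pos t Ck_densities(2), of k] by (simp add: Q22_def k_def)
  have 4: "?m (div3 (tube R) J') = sphere_int R t (\<lambda>n p. (n \<bullet> J' p) *\<^sub>R (snd p - k)) - ball_int R t J'"
    using sphere_flux_moment[OF R_pos t C(2), of k] by simp
  \<comment> \<open>\<open>Q2'\<close> is written with the moving center. Its motion produces the
    extra term with \<open>\<rho>'\<close>, which the second summand of \<open>Q2'\<close>
    cancels.\<close>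
  have 5: "ball_int R t (dt (tube R) (\<lambda>p. \<rho>' p *\<^sub>R (snd p - ?cen (fst p)))) =
      ?m (dt (tube R) \<rho>') - ball_int R t \<rho>' *\<^sub>R ?y"
  proof -
    have img: "fst ` tube R \<subseteq> I" by (auto simp: tube_def)
    have Cfst: "Ck (Suc 0) (tube R) fst"
      by (rule Ck_linear[OF S bounded_linear_fst Ck_id[OF S]])
    have Cc: "Ck (Suc 0) (tube R) (\<lambda>p. ?cen (fst p))"
      by (rule Ck_comp[OF S Cfst Ck_center[OF pos] img])
    have Cs: "Ck (Suc 0) (tube R) (\<lambda>p. snd p - ?cen (fst p))"
      by (intro Ck_diff S Ck_linear[OF _ bounded_linear_snd] Ck_id Cc)
    have "dt (tube R) (\<lambda>p. \<rho>' p *\<^sub>R (snd p - ?cen (fst p))) (t, x) =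
        dt (tube R) \<rho>' (t, x) *\<^sub>R (x - k) - \<rho>' (t, x) *\<^sub>R ?y" if x: "x \<in> cball (r t) R" for x
    proof -
      have p: "(t, x) \<in> tube R" by (rule tubeI[OF t x])
      have "pd (tube R) (1, 0) fst (t, x) = 1"
        using pd_eq[OF S p, of fst fst "(1, 0)"] by (simp add: has_derivative_fst[OF has_derivative_ident])
      then have "pd (tube R) (1, 0) (\<lambda>p. ?cen (fst p)) (t, x) = ?y"
        using pd_comp[OF S Cfst Ck_center[OF pos] img p] Ck_interval(2)[OF T_less Ck_center[OF pos] t, of 1]
        by simp
      moreover have "pd (tube R) (1, 0) snd (t, x) = 0"
        using pd_eq[OF S p, of snd snd "(1, 0)"] by (simp add: has_derivative_snd[OF has_derivative_ident])
      moreover have "pd (tube R) (1, 0) (\<lambda>p. snd p - ?cen (fst p)) (t, x) =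
          pd (tube R) (1, 0) snd (t, x) - pd (tube R) (1, 0) (\<lambda>p. ?cen (fst p)) (t, x)"
        by (rule pd_eq[OF S p has_derivative_diff[OF Ck_Suc_deriv[OF _ p] Ck_Suc_deriv[OF Cc p]]])
           (rule Ck_linear[OF S bounded_linear_snd Ck_id[OF S]])
      ultimately show ?thesis
        using pd_bilinear[OF S bounded_bilinear_scaleR C(1) Cs p, of "(1, 0)"] by (simp add: dt_def k_def)
    qed
    then have "ball_int R t (dt (tube R) (\<lambda>p. \<rho>' p *\<^sub>R (snd p - ?cen (fst p)))) =
        ball_int R t (\<lambda>p. dt (tube R) \<rho>' p *\<^sub>R (snd p - k) - \<rho>' p *\<^sub>R ?y)"
      unfolding ball_int_def by (intro integral_cong) simp
    also have "\<dots> = ?m (dt (tube R) \<rho>') - ball_int R t \<rho>' *\<^sub>R ?y"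
      using Ck_imp_continuous[OF C(1)]
      by (subst ball_int_diff[OF t]) (auto intro!: cm continuous_intros simp: ball_int_scaleR_left[OF t])
    finally show ?thesis .
  qed
  have "?m (dt (tube R) (\<rho> \<psi>)) = (?m (dt (tube R) (\<rho> \<psi>)) + ?m (dt (tube R) \<rho>') + ?m (div3 (tube R) (J R \<psi>))
      + ?m (div3 (tube R) J')) - ?m (dt (tube R) \<rho>') - ?m (div3 (tube R) (J R \<psi>)) - ?m (div3 (tube R) J')"
    by simp
  then have 6: "?m (dt (tube R) (\<rho> \<psi>)) =
      - ?m (dt (tube R) \<rho>') - ?m (div3 (tube R) (J R \<psi>)) - ?m (div3 (tube R) J')"
    unfolding 2 by simp
  show ?thesis
    unfolding 1 6 3 4 Q2'_def 5 k_def[symmetric] by simp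
qed

end

subsection \<open>Concentration implies Newton's law\<close>

lemma bounded_bilinear_cross3: "bounded_bilinear cross3"
  using bilinear_cross by (simp add: bilinear_conv_bounded_bilinear)

lemma norm_cross3_le: "norm (cross3 x y) \<le> norm x * norm y"
proof -
  have "(norm (cross3 x y))\<^sup>2 \<le> (norm x * norm y)\<^sup>2"
    using norm_cross[of x y] by (simp add: power_mult_distrib)
  then show ?thesis by (rule power2_le_imp_le) simp
qed

lemma interval_integral_scaleR:
  fixes g :: "real \<Rightarrow> 'b::euclidean_space"
  shows "(LBINT s=x..y. k *\<^sub>R g s) = k *\<^sub>R (LBINT s=x..y. g s)"
  by (simp add: interval_lebesgue_integral_def)

context nls_trajectory
begin

section \<open>Calculus of uniform convergence to zero on the time interval\<close>

lemma tends_to_0_iff: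
  "tends_to_0 X \<longleftrightarrow> (\<forall>e>0. \<forall>\<^sub>F n in sequentially. \<forall>t\<in>I. norm (X n t) < e)"
  by (simp add: tends_to_0_def uniform_limit_iff dist_norm)

lemma tends_to_0_bound:
  assumes X: "tends_to_0 X" and le: "\<forall>\<^sub>F n in sequentially. \<forall>t\<in>I. norm (Y n t) \<le> K * norm (X n t)"
  shows "tends_to_0 Y"
  unfolding tends_to_0_iff
proof (intro allI impI)
  fix e :: real assume "e > 0"
  \<comment> \<open>\<open>K\<close> may be zero or negative; this replacement is positive and not
    smaller.\<close>
  then have "e / (\<bar>K\<bar> + 1) > 0" by simp
  with X have "\<forall>\<^sub>F n in sequentially. \<forall>t\<in>I. norm (X n t) < e / (\<bar>K\<bar> + 1)"
    unfolding tends_to_0_iff by blast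
  with le show "\<forall>\<^sub>F n in sequentially. \<forall>t\<in>I. norm (Y n t) < e"
  proof eventually_elim
    case (elim n)
    show ?case
    proof
      fix t assume t: "t \<in> I"
      have "norm (Y n t) \<le> K * norm (X n t)" using elim(1) t by blast
      also have "\<dots> \<le> (\<bar>K\<bar> + 1) * norm (X n t)" by (intro mult_right_mono) auto
      also have "\<dots> < e" using elim(2) t by (simp add: pos_less_divide_eq mult.commute)
      finally show "norm (Y n t) < e" .
    qed
  qed
qed

lemma tends_to_0_cong:
  assumes "tends_to_0 X" "\<forall>\<^sub>F n in sequentially. \<forall>t\<in>I. Y n t = X n t"
  shows "tends_to_0 Y"
  by (rule tends_to_0_bound[OF assms(1), of _ 1]) (use assms(2) in \<open>auto elim: eventually_mono\<close>)

lemma tends_to_0_add: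
  assumes "tends_to_0 X" "tends_to_0 Y" shows "tends_to_0 (\<lambda>n t. X n t + Y n t)"
  using uniform_limit_add[OF assms[unfolded tends_to_0_def]] by (simp add: tends_to_0_def)

lemma tends_to_0_linear:
  assumes "bounded_linear L" "tends_to_0 X" shows "tends_to_0 (\<lambda>n t. L (X n t))"
  using bounded_linear.uniform_limit[OF assms(1) assms(2)[unfolded tends_to_0_def]]
  by (simp add: tends_to_0_def linear_simps(3)[OF assms(1)])

lemma tends_to_0_minus: "tends_to_0 X \<Longrightarrow> tends_to_0 (\<lambda>n t. - X n t)"
  by (rule tends_to_0_linear[OF bounded_linear_minus[OF bounded_linear_ident]])

lemma tends_to_0_diff: "tends_to_0 X \<Longrightarrow> tends_to_0 Y \<Longrightarrow> tends_to_0 (\<lambda>n t. X n t - Y n t)"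
  using tends_to_0_add[OF _ tends_to_0_minus, of X Y] by simp

lemma tends_to_0_scaleR: "tends_to_0 X \<Longrightarrow> tends_to_0 (\<lambda>n t. k *\<^sub>R X n t)"
  by (rule tends_to_0_linear[OF bounded_linear_scaleR_right])

lemma tends_to_0_const: "X \<longlonglongrightarrow> 0 \<Longrightarrow> tends_to_0 (\<lambda>n t. X n)"
  unfolding tends_to_0_iff by (auto simp: tendsto_iff elim: eventually_mono)

lemma tends_to_0_at: "tends_to_0 X \<Longrightarrow> t \<in> I \<Longrightarrow> (\<lambda>n. X n t) \<longlonglongrightarrow> 0"
  unfolding tends_to_0_def using tendsto_uniform_limitI by fastforce

text \<open>The mean value inequality for an antiderivative treats both orientations of the integral
  at once.\<close>

lemma interval_bound:
  fixes g :: "real \<Rightarrow> 'b::euclidean_space"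
  assumes I: "t0 \<in> I" "t \<in> I" and g: "continuous_on I g" and e: "\<And>s. s \<in> I \<Longrightarrow> norm (g s) \<le> e"
  shows "norm (LBINT s=ereal t0..ereal t. g s) \<le> e * \<bar>t - t0\<bar>"
proof -
  obtain G where G: "\<And>s. s \<in> I \<Longrightarrow> (G has_vector_derivative g s) (at s within I)"
    using antiderivative_continuous[OF g] by blast
  have "norm (G t - G t0) \<le> e * norm (t - t0)"
  proof (rule differentiable_bound[OF convex_real_interval(5) _ _ I(2,1)])
    show "(G has_derivative (\<lambda>h. h *\<^sub>R g s)) (at s within I)" if "s \<in> I" for s
      using G[OF that] by (simp add: has_vector_derivative_def)
    show "onorm (\<lambda>h. h *\<^sub>R g s) \<le> e" if "s \<in> I" for s
    proof (rule onorm_le)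
      fix h :: real
      show "norm (h *\<^sub>R g s) \<le> e * norm h"
        using e[OF that] mult_left_mono[of "norm (g s)" e "\<bar>h\<bar>"] by (simp add: mult.commute)
    qed
  qed
  then show ?thesis using interval_FTC[OF I g G] by simp
qed

lemma tends_to_0_integral:
  fixes X :: "nat \<Rightarrow> real \<Rightarrow> 'b::euclidean_space"
  assumes X: "tends_to_0 X" and c: "\<forall>\<^sub>F n in sequentially. continuous_on I (X n)" and t0: "t0 \<in> I"
  shows "tends_to_0 (\<lambda>n t. LBINT s=ereal t0..ereal t. X n s)"
  unfolding tends_to_0_iff
proof (intro allI impI)
  fix e :: real assume e: "e > 0"
  define d where "d = e / (2 * (Tp - Tm))"
  have d: "d > 0" using e T_less by (simp add: d_def)
  with X have "\<forall>\<^sub>F n in sequentially. \<forall>t\<in>I. norm (X n t) < d"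
    unfolding tends_to_0_iff by blast
  with c show "\<forall>\<^sub>F n in sequentially. \<forall>t\<in>I. norm (LBINT s=ereal t0..ereal t. X n s) < e"
  proof eventually_elim
    case (elim n)
    show ?case
    proof
      fix t assume t: "t \<in> I"
      have "norm (LBINT s=ereal t0..ereal t. X n s) \<le> d * \<bar>t - t0\<bar>"
        by (rule interval_bound[OF t0 t elim(1)]) (use elim(2) in \<open>auto intro: less_imp_le\<close>)
      also have "\<dots> \<le> d * (Tp - Tm)" using t t0 d by (intro mult_left_mono) auto
      also have "d * (Tp - Tm) = e / 2" using T_less by (simp add: d_def field_simps)
      also have "\<dots> < e" using e by simp
      finally show "norm (LBINT s=ereal t0..ereal t. X n s) < e" .
    qed
  qed
qed

lemma \<rho>_eq: "\<rho> \<psi> p = q * (cmod (\<psi> p))\<^sup>2"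
proof -
  have "of_real q * \<psi> p * cnj (\<psi> p) = of_real (q * (cmod (\<psi> p))\<^sup>2)"
    by (simp only: mult.assoc complex_norm_square of_real_mult)
  then show ?thesis by (simp only: \<rho>_def Re_complex_of_real)
qed

lemma ball_int_linear:
  fixes F :: "spacetime \<Rightarrow> 'b::euclidean_space" and L :: "'b \<Rightarrow> 'c::euclidean_space"
  assumes "bounded_linear L" "t \<in> I" "continuous_on (tube R) F"
  shows "ball_int R t (\<lambda>p. L (F p)) = L (ball_int R t F)"
  unfolding ball_int_def
  using integral_linear[OF ball_integrable[OF assms(3,2)] assms(1)] by (simp add: o_def)

lemma tends_to_0_cross3:
  assumes X: "tends_to_0 X" and g: "continuous_on I g"
  shows "tends_to_0 (\<lambda>n t. cross3 (X n t) (g t))"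
proof -
  obtain K where K: "\<And>t. t \<in> I \<Longrightarrow> norm (g t) \<le> K"
    using bounded_on_compact[OF compact_Icc g] by blast
  show ?thesis
  proof (rule tends_to_0_bound[OF X always_eventually], intro allI ballI)
    fix n t assume "t \<in> I"
    then show "norm (cross3 (X n t) (g t)) \<le> K * norm (X n t)"
      using norm_cross3_le[of "X n t" "g t"] mult_left_mono[OF K, of t "norm (X n t)"]
      by (simp add: mult.commute)
  qed
qed

lemma ball_int_bound:
  fixes F :: "spacetime \<Rightarrow> 'b::euclidean_space"
  assumes t: "t \<in> I" and F: "continuous_on (tube R) F" and w: "continuous_on (tube R) w"
    and le: "\<And>x. x \<in> cball (r t) R \<Longrightarrow> norm (F (t, x)) \<le> w (t, x) * k"
  shows "norm (ball_int R t F) \<le> ball_int R t w * k"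
proof -
  have "ball_int R t (\<lambda>p. w p * k) = ball_int R t w * k"
    unfolding ball_int_def by (rule integral_mult_left)
  moreover have "norm (ball_int R t F) \<le> ball_int R t (\<lambda>p. w p * k)"
    unfolding ball_int_def
    by (rule integral_norm_bound_integral)
       (use le in \<open>auto intro!: ball_integrable[OF _ t] continuous_intros F w\<close>)
  ultimately show ?thesis by simp
qed

lemma continuous_E_path: "continuous_on I (\<lambda>t. E (t, r t))"
  and Ck_B_path: "Ck (Suc 0) I (\<lambda>t. B (t, r t))"
proof -
  have img: "(\<lambda>t. (t, r t)) ` I \<subseteq> D" using graph by auto
  have r1: "Ck (Suc 0) I r" using Ck_r Ck_Suc_imp[of "Suc 0" I r] by (simp only: numeral_2_eq_2)
  have path: "Ck (Suc 0) I (\<lambda>t. (t, r t))"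
  proof -
    have "Ck (Suc 0) I (\<lambda>t. (t, 0) + (0, r t))"
      by (intro Ck_add solid_I Ck_linear[OF solid_I _ Ck_id[OF solid_I], of "\<lambda>t. (t, 0)"]
          Ck_linear[OF solid_I _ r1, of "\<lambda>y. (0, y)"] bounded_linear_Pair bounded_linear_ident bounded_linear_zero)
    then show ?thesis by simp
  qed
  show "Ck (Suc 0) I (\<lambda>t. B (t, r t))" by (rule Ck_comp[OF solid_I path Ck_fields(3) img])
  show "continuous_on I (\<lambda>t. E (t, r t))"
    by (rule Ck_imp_continuous[OF Ck_comp[OF solid_I path Ck_fields(4) img]])
qed

end

context nls_wave
begin

lemma \<rho>_nonneg: "\<rho> \<psi> p \<ge> 0"
  using q_pos by (simp add: \<rho>_eq)

text \<open>The charge density is nonnegative because \<open>q > 0\<close>, so the center is an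
  average of points of the ball. This alone ties the centers to the trajectory.\<close>

lemma center_close:
  assumes t: "t \<in> I" and pos: "charge R \<psi> t > 0"
  shows "norm (center R \<psi> t - r t) \<le> R"
proof -
  note c\<rho> = Ck_imp_continuous[OF Ck_densities(1)] and cm = Ck_imp_continuous[OF Ck_moment]
  have cs: "continuous_on (tube R) (\<lambda>p. \<rho> \<psi> p *\<^sub>R r t)" by (intro continuous_intros c\<rho>)
  have "charge R \<psi> t *\<^sub>R (center R \<psi> t - r t) =
      ball_int R t (\<lambda>p. \<rho> \<psi> p *\<^sub>R snd p) - ball_int R t (\<lambda>p. \<rho> \<psi> p *\<^sub>R r t)"
    using pos ball_int_scaleR_left[OF t c\<rho>, of "r t"]
    by (simp add: center_def scaleR_diff_right charge_def)
  also have "\<dots> = ball_int R t (\<lambda>p. \<rho> \<psi> p *\<^sub>R (snd p - r t))"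
    using ball_int_diff[OF t cm cs] by (simp add: scaleR_diff_right)
  finally have "charge R \<psi> t * norm (center R \<psi> t - r t) = norm (ball_int R t (\<lambda>p. \<rho> \<psi> p *\<^sub>R (snd p - r t)))"
    using pos by (metis abs_of_pos norm_scaleR)
  also have "\<dots> \<le> ball_int R t (\<rho> \<psi>) * R"
    using \<rho>_nonneg
    by (intro ball_int_bound[OF t _ c\<rho>] continuous_intros c\<rho>)
       (auto simp: dist_norm norm_minus_commute intro!: mult_left_mono)
  finally show ?thesis using pos by (simp add: charge_def mult.commute)
qed

text \<open>The fields are frozen at the trajectory; what this neglects is exactly
  \<open>Q30 + Q31\<close>.\<close>

lemma force_split:
  assumes t: "t \<in> I"
  shows "ball_int R t (f R \<psi>) = charge R \<psi> t *\<^sub>R E (t, r t)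
    + (1 / c) *\<^sub>R cross3 (ball_int R t (J R \<psi>)) (B (t, r t)) + (Q30 R \<psi> t + Q31 R \<psi> t)"
proof -
  note cE = Ck_imp_continuous[OF Ck_fields_tube(4)] and cB = Ck_imp_continuous[OF Ck_fields_tube(3)]
    and c\<rho> = Ck_imp_continuous[OF Ck_densities(1)] and cJ = Ck_imp_continuous[OF Ck_densities(2)]
  note cc = bounded_bilinear.continuous_on[OF bounded_bilinear_cross3]
  let ?E = "E (t, r t)" and ?B = "B (t, r t)"
  have lin: "bounded_linear (\<lambda>x. (1 / c) *\<^sub>R cross3 x ?B)"
    by (intro bounded_linear_scaleR_right[THEN bounded_linear_compose]
        bounded_bilinear.bounded_linear_left[OF bounded_bilinear_cross3])
  have 1: "continuous_on (tube R) (\<lambda>p. \<rho> \<psi> p *\<^sub>R ?E)"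
    "continuous_on (tube R) (\<lambda>p. (1 / c) *\<^sub>R cross3 (J R \<psi> p) ?B)"
    "continuous_on (tube R) (\<lambda>p. \<rho> \<psi> p *\<^sub>R (E p - ?E))"
    "continuous_on (tube R) (\<lambda>p. (1 / c) *\<^sub>R cross3 (J R \<psi> p) (B p - ?B))"
    by (intro continuous_intros cc cE cB c\<rho> cJ)+
  have "f R \<psi> p = \<rho> \<psi> p *\<^sub>R ?E + (1 / c) *\<^sub>R cross3 (J R \<psi> p) ?B
      + (\<rho> \<psi> p *\<^sub>R (E p - ?E) + (1 / c) *\<^sub>R cross3 (J R \<psi> p) (B p - ?B))" for p
    by (simp add: f_def bounded_bilinear.diff_right[OF bounded_bilinear_cross3] scaleR_diff_right)
  then have "ball_int R t (f R \<psi>) = ball_int R t (\<lambda>p. \<rho> \<psi> p *\<^sub>R ?E + (1 / c) *\<^sub>R cross3 (J R \<psi> p) ?B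
      + (\<rho> \<psi> p *\<^sub>R (E p - ?E) + (1 / c) *\<^sub>R cross3 (J R \<psi> p) (B p - ?B)))"
    by (intro ball_int_cong[OF t])
  also have "\<dots> = ball_int R t (\<lambda>p. \<rho> \<psi> p *\<^sub>R ?E) + ball_int R t (\<lambda>p. (1 / c) *\<^sub>R cross3 (J R \<psi> p) ?B)
      + (Q30 R \<psi> t + Q31 R \<psi> t)"
    unfolding Q30_def Q31_def by (simp only: ball_int_add[OF t] 1 continuous_on_add)
  finally show ?thesis
    by (simp only: ball_int_scaleR_left[OF t c\<rho>] ball_int_linear[OF lin t cJ] charge_def)
qed

end

context nls_trajectory
begin

lemma concentration_imp_newton:
  assumes conc: concentration_trajectory
  shows newton_law
  using conc unfolding concentration_trajectory_def
proof (elim conjE exE, goal_cases)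
  \<comment> \<open>The existentials of the separate conjuncts are opened in rounds, so the names
    interleave: first the outermost witness of each conjunct, then the second one, and so
    on.\<close>
  case (1 a R \<psi> t0 \<rho>' C _ l J' c0 P' n0 T' f')
  have seq: "a n > 0" "R n > 0" "R \<longlonglongrightarrow> 0" "tube (R n) \<subseteq> D" "Ck 2 (tube (R n)) (\<psi> n)" for n
    using 1(2,3,5,7,8) by simp_all
  have t0: "t0 \<in> I" by fact
  have law: "perturbed_laws (R n) (a n) (\<psi> n) (\<rho>' n) (J' n) (P' n) (T' n) (f' n)" for n
    using 1 by blast
  note Q = 1(10-15) and Q' = 1(21-23)
  have C: "norm (ball_int (R n) t (P (R n) (\<psi> n))) \<le> C" if "t \<in> I" for n t using 1(16) that by blast
  have c0: "c0 > 0" "\<And>n t. n \<ge> n0 \<Longrightarrow> t \<in> I \<Longrightarrow> c0 \<le> charge (R n) (\<psi> n) t"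
    using 1(18,19) by blast+
  have l: "(\<lambda>n. charge (R n) (\<psi> n) t0) \<longlonglongrightarrow> l" by fact
  have W: "nls_wave m q chi c G1' D \<phi> A Tm Tp r (a n) (R n) (\<psi> n)" for n
    by (intro nls_wave.intro nls_trajectory_axioms nls_wave_axioms.intro seq)
  interpret W: nls_wave m q chi c G1' D \<phi> A Tm Tp r "a n" "R n" "\<psi> n" for n by (rule W)

  define ch where "ch n t = charge (R n) (\<psi> n) t" for n t
  define Jn where "Jn n t = ball_int (R n) t (J (R n) (\<psi> n))" for n t
  define Pn where "Pn n t = ball_int (R n) t (P (R n) (\<psi> n))" for n t
  define y where "y n t = vector_derivative (center (R n) (\<psi> n)) (at t within I)" for n t
  define Ei where "Ei t = E (t, r t)" for t
  define Bi where "Bi t = B (t, r t)" for t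
  have Jn_eq: "Jn n t = (q / m) *\<^sub>R Pn n t" for n t
    unfolding Jn_def Pn_def by (simp only: W.J_eq[abs_def] ball_int_scaleR_right)
  have cch: "continuous_on I (ch n)" for n
    unfolding ch_def charge_def by (intro continuous_ball_int Ck_imp_continuous[OF W.Ck_densities(1)])
  have cJn: "continuous_on I (Jn n)" for n
    unfolding Jn_def by (intro continuous_ball_int Ck_imp_continuous[OF W.Ck_densities(2)])
  have cEi: "continuous_on I Ei" unfolding Ei_def by (rule continuous_E_path)
  have CBi: "Ck (Suc 0) I Bi" unfolding Bi_def[abs_def] by (rule Ck_B_path)
  then have cBi: "continuous_on I Bi" by (rule Ck_imp_continuous)
  note cc = bounded_bilinear.continuous_on[OF bounded_bilinear_cross3]
  obtain KE where KE: "\<And>t. t \<in> I \<Longrightarrow> norm (Ei t) \<le> KE"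
    using bounded_on_compact[OF compact_Icc cEi] by blast
  define Bd where "Bd t = vector_derivative Bi (at t within I)" for t
  have cBd: "continuous_on I Bd" unfolding Bd_def by (rule Ck_interval(3)[OF T_less CBi])
  have Bd: "(Bi has_vector_derivative Bd t) (at t within I)" if "t \<in> I" for t
    unfolding Bd_def by (rule Ck_interval(1)[OF T_less CBi that])

  \<comment> \<open>Convergence of the charge is assumed at \<open>t0\<close> only; the charge
    balance spreads it uniformly over the interval, with the same constant limit.\<close>
  have ch_lim: "tends_to_0 (\<lambda>n t. ch n t - l)"
  proof (rule tends_to_0_cong)
    show "tends_to_0 (\<lambda>n t. (ch n t0 - l) + Q23 (R n) (\<psi> n) t0 t - Q3' (R n) (\<rho>' n) (J' n) t0 t)"
      using l by (intro tends_to_0_diff[OF tends_to_0_add[OF tends_to_0_const Q(5)] Q'(3)])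
        (simp add: ch_def LIM_zero)
    have "ch n t - l = (ch n t0 - l) + Q23 (R n) (\<psi> n) t0 t - Q3' (R n) (\<rho>' n) (J' n) t0 t" if "t \<in> I" for n t
      using W.charge_balance[OF law[of n] t0 that] unfolding ch_def by linarith
    then show "\<forall>\<^sub>F n in sequentially. \<forall>t\<in>I. ch n t - l =
        (ch n t0 - l) + Q23 (R n) (\<psi> n) t0 t - Q3' (R n) (\<rho>' n) (J' n) t0 t" by simp
  qed
  have l_pos: "l \<ge> c0"
    using l by (rule tendsto_lowerbound) (use c0 t0 in \<open>auto simp: eventually_sequentially\<close>)
  have pos: "charge (R n) (\<psi> n) t > 0" if "n \<ge> n0" "t \<in> I" for n t using c0 that by (meson less_le_trans)
  \<comment> \<open>The center divides by the charge, whose lower bound is available from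
    \<open>n0\<close> on. All statements on velocities are therefore eventual.\<close>
  have late: "\<forall>\<^sub>F n in sequentially. n \<ge> n0" by (rule eventually_ge_at_top)
  have cen_deriv: "(center (R n) (\<psi> n) has_vector_derivative y n t) (at t within I)" if "n \<ge> n0" "t \<in> I" for n t
    unfolding y_def using W.Ck_center pos that by (intro Ck_interval(1)[OF T_less]) auto
  have cy: "continuous_on I (y n)" if "n \<ge> n0" for n
    unfolding y_def using W.Ck_center pos that by (intro Ck_interval(3)[OF T_less]) auto

  define err where "err n t = Q20 (R n) (\<psi> n) t + Q22 (R n) (\<psi> n) t + Q2' (R n) (\<psi> n) (\<rho>' n) (J' n) t" for n t
  have err: "tends_to_0 err" unfolding err_def by (intro tends_to_0_add Q Q')
  have chy: "ch n t *\<^sub>R y n t = Jn n t - err n t" if "n \<ge> n0" "t \<in> I" for n t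
    using W.moment_balance[OF law[of n] that(2) pos[OF that(1)]]
    by (simp add: ch_def y_def Jn_def err_def algebra_simps)
  \<comment> \<open>Numerator: the bound on the total current from the momentum bound, plus 1 for
    the error, which is eventually below 1. Denominator: the lower bound on the charge.\<close>
  define Ky where "Ky = (q / m * C + 1) / c0"
  have yb: "\<forall>\<^sub>F n in sequentially. \<forall>t\<in>I. norm (y n t) \<le> Ky"
  proof -
    from err have "\<forall>\<^sub>F n in sequentially. \<forall>t\<in>I. norm (err n t) < 1"
      unfolding tends_to_0_iff by (rule allE[of _ 1]) simp
    with late show ?thesis
    proof eventually_elim
      case (elim n)
      show ?case
      proof
        fix t assume t: "t \<in> I"
        have "c0 * norm (y n t) \<le> ch n t * norm (y n t)"
          using c0(2)[OF elim(1) t] by (intro mult_right_mono) (auto simp: ch_def)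
        also have "\<dots> = norm (Jn n t - err n t)"
          unfolding chy[OF elim(1) t, symmetric] using pos[OF elim(1) t] by (simp add: ch_def)
        also have "\<dots> \<le> norm (Jn n t) + norm (err n t)" by (rule norm_triangle_ineq4)
        also have "\<dots> \<le> q / m * C + 1"
        proof (rule add_mono)
          have "norm (Jn n t) = q / m * norm (Pn n t)"
            using q_pos m_pos by (simp add: Jn_eq)
          also have "\<dots> \<le> q / m * C"
            using C[OF t, of n] q_pos m_pos by (intro mult_left_mono) (auto simp: Pn_def)
          finally show "norm (Jn n t) \<le> q / m * C" .
        qed (use elim(2) t in \<open>auto intro: less_imp_le\<close>)
        finally show "norm (y n t) \<le> Ky"
          using c0(1) by (simp add: Ky_def pos_le_divide_eq mult.commute)
      qed
    qed
  qed

  \<comment> \<open>Replaces the charge by its limit \<open>l\<close>. The difference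
    \<open>ch n t - l\<close> multiplies \<open>y n t\<close>, which is why the velocities had to be
    bounded first.\<close>
  have ly: "tends_to_0 (\<lambda>n t. Jn n t - l *\<^sub>R y n t)"
  proof (rule tends_to_0_cong)
    show "tends_to_0 (\<lambda>n t. err n t + (ch n t - l) *\<^sub>R y n t)"
    proof (rule tends_to_0_add[OF err tends_to_0_bound[OF ch_lim]])
      show "\<forall>\<^sub>F n in sequentially. \<forall>t\<in>I. norm ((ch n t - l) *\<^sub>R y n t) \<le> Ky * norm (ch n t - l)"
        using yb by eventually_elim (auto simp: mult.commute intro!: mult_right_mono)
    qed
    show "\<forall>\<^sub>F n in sequentially. \<forall>t\<in>I. Jn n t - l *\<^sub>R y n t = err n t + (ch n t - l) *\<^sub>R y n t"
      using late by eventually_elim (simp add: scaleR_diff_left chy)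
  qed

  have cen_lim: "tends_to_0 (\<lambda>n t. center (R n) (\<psi> n) t - r t)"
  proof (rule tends_to_0_bound[OF tends_to_0_const[OF seq(3)], of _ 1])
    show "\<forall>\<^sub>F n in sequentially. \<forall>t\<in>I. norm (center (R n) (\<psi> n) t - r t) \<le> 1 * norm (R n)"
      using late
    proof eventually_elim
      case (elim n)
      show ?case using W.center_close[OF _ pos[OF elim]] seq(2)[of n] by auto
    qed
  qed

  \<comment> \<open>Only the centers, not their velocities, are known to converge: integrate by parts.\<close>
  define yB where "yB n t = (LBINT s=ereal t0..ereal t. cross3 (y n s - v s) (Bi s))" for n t
  have yB: "tends_to_0 yB"
  proof (rule tends_to_0_cong)
    let ?d = "\<lambda>n t. center (R n) (\<psi> n) t - r t"
    have cd: "continuous_on I (?d n)" if "n \<ge> n0" for n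
      using Ck_imp_continuous[OF W.Ck_center] pos that by (intro continuous_intros continuous_r) auto
    note d1 = tends_to_0_cross3[OF cen_lim cBi] and d2 = tends_to_0_cross3[OF cen_lim cBd]
    have ev: "\<forall>\<^sub>F n in sequentially. continuous_on I (\<lambda>t. cross3 (?d n t) (Bd t))"
      using late by eventually_elim (intro cc cd cBd)
    show "tends_to_0 (\<lambda>n t. cross3 (?d n t) (Bi t) - cross3 (?d n t0) (Bi t0)
        - (LBINT s=ereal t0..ereal t. cross3 (?d n s) (Bd s)))"
      by (intro tends_to_0_diff d1 tends_to_0_const[OF tends_to_0_at[OF d1 t0]]
          tends_to_0_integral[OF d2 ev t0])
    show "\<forall>\<^sub>F n in sequentially. \<forall>t\<in>I. yB n t = cross3 (?d n t) (Bi t) - cross3 (?d n t0) (Bi t0)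
        - (LBINT s=ereal t0..ereal t. cross3 (?d n s) (Bd s))"
      using late
    proof eventually_elim
      case (elim n)
      show ?case
      proof
        fix t assume t: "t \<in> I"
        have c1: "continuous_on I (\<lambda>s. cross3 (?d n s) (Bd s))" "continuous_on I (\<lambda>s. cross3 (y n s - v s) (Bi s))"
          by (intro cc cd[OF elim] cBd cBi continuous_intros cy[OF elim] continuous_v)+
        have "(LBINT s=ereal t0..ereal t. cross3 (?d n s) (Bd s) + cross3 (y n s - v s) (Bi s)) =
            cross3 (?d n t) (Bi t) - cross3 (?d n t0) (Bi t0)"
        proof (rule interval_FTC[OF t0 t])
          show "continuous_on I (\<lambda>s. cross3 (?d n s) (Bd s) + cross3 (y n s - v s) (Bi s))"
            by (intro continuous_intros c1)
          fix s assume s: "s \<in> I"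
          show "((\<lambda>s. cross3 (?d n s) (Bi s)) has_vector_derivative
              cross3 (?d n s) (Bd s) + cross3 (y n s - v s) (Bi s)) (at s within I)"
            by (rule bounded_bilinear.has_vector_derivative[OF bounded_bilinear_cross3
                has_vector_derivative_diff[OF cen_deriv[OF elim s] r_deriv[OF s]] Bd[OF s]])
        qed
        moreover have "(LBINT s=ereal t0..ereal t. cross3 (?d n s) (Bd s) + cross3 (y n s - v s) (Bi s)) =
            (LBINT s=ereal t0..ereal t. cross3 (?d n s) (Bd s)) + yB n t"
          unfolding yB_def by (intro interval_lebesgue_integral_add interval_integrable t0 t c1)
        ultimately show "yB n t = cross3 (?d n t) (Bi t) - cross3 (?d n t0) (Bi t0)
            - (LBINT s=ereal t0..ereal t. cross3 (?d n s) (Bd s))" by (simp add: algebra_simps)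
      qed
    qed
  qed

  \<comment> \<open>The acceleration that Newton's law prescribes. In the momentum balance it
    appears as \<open>(l * m / q) *\<^sub>R N\<close>.\<close>
  define N where "N t = (q / m) *\<^sub>R (Ei t + (1 / c) *\<^sub>R cross3 (v t) (Bi t))" for t
  have cN: "continuous_on I N"
    unfolding N_def by (intro continuous_intros cc cEi cBi continuous_v)
  have y_lim: "tends_to_0 (\<lambda>n t. y n t - y n t0 - (LBINT s=ereal t0..ereal t. N s))"
  proof (rule tends_to_0_cong)
    let ?g1 = "\<lambda>n t. (ch n t - l) *\<^sub>R Ei t"
    let ?g2 = "\<lambda>n t. (1 / c) *\<^sub>R cross3 (Jn n t - l *\<^sub>R y n t) (Bi t)"
    \<comment> \<open>Collects the terms of the integrated momentum law that tend to zero: surface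
      and perturbation terms, variation of the fields over the ball, deviation of the charge,
      deviation of the current, and the magnetic term of the velocity difference. The identity
      proved below is then solved for the velocity.\<close>
    let ?Z = "\<lambda>n t. Q01 (R n) (\<psi> n) t0 t - Q0 (R n) (a n) (\<psi> n) t0 t - Q0' (R n) (P' n) (T' n) (f' n) t0 t
       + (LBINT s=ereal t0..ereal t. Q30 (R n) (\<psi> n) s + Q31 (R n) (\<psi> n) s)
       + (LBINT s=ereal t0..ereal t. ?g1 n s) + (LBINT s=ereal t0..ereal t. ?g2 n s) + (l / c) *\<^sub>R yB n t"
    have g1: "tends_to_0 ?g1"
      by (rule tends_to_0_bound[OF ch_lim always_eventually, of _ KE])
         (auto simp: mult.commute intro!: mult_right_mono KE)
    have cg1: "continuous_on I (?g1 n)" for n by (intro continuous_intros cch cEi)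
    have g2: "tends_to_0 ?g2" by (intro tends_to_0_scaleR tends_to_0_cross3 ly cBi)
    have cg2: "continuous_on I (?g2 n)" if "n \<ge> n0" for n
      by (intro continuous_intros cc cJn cBi cy that)
    have Z: "tends_to_0 ?Z"
      by (intro tends_to_0_add tends_to_0_diff Q Q' tends_to_0_scaleR yB
          tends_to_0_integral[OF g1 always_eventually t0] tends_to_0_integral[OF g2 _ t0] allI cg1
          eventually_mono[OF late cg2])
    show "tends_to_0 (\<lambda>n t. (1 / l) *\<^sub>R ((q / m) *\<^sub>R ?Z n t
        - (Jn n t - l *\<^sub>R y n t) + (Jn n t0 - l *\<^sub>R y n t0)))"
      by (intro tends_to_0_scaleR tends_to_0_add tends_to_0_diff Z ly tends_to_0_const[OF tends_to_0_at[OF ly t0]])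
    show "\<forall>\<^sub>F n in sequentially. \<forall>t\<in>I. y n t - y n t0 - (LBINT s=ereal t0..ereal t. N s) =
        (1 / l) *\<^sub>R ((q / m) *\<^sub>R ?Z n t - (Jn n t - l *\<^sub>R y n t) + (Jn n t0 - l *\<^sub>R y n t0))"
      using late
    proof eventually_elim
      case (elim n)
      show ?case
      proof
        fix t assume t: "t \<in> I"
        let ?Q3 = "\<lambda>s. Q30 (R n) (\<psi> n) s + Q31 (R n) (\<psi> n) s"
        let ?yB = "\<lambda>s. cross3 (y n s - v s) (Bi s)"
        have fs: "ball_int (R n) s (f (R n) (\<psi> n)) =
            ?Q3 s + ?g1 n s + ?g2 n s + (l / c) *\<^sub>R ?yB s + (l * m / q) *\<^sub>R N s" if s: "s \<in> I" for s
        proof -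
          have "(l * m / q) *\<^sub>R N s = l *\<^sub>R Ei s + (l / c) *\<^sub>R cross3 (v s) (Bi s)"
            using q_pos m_pos by (simp add: N_def scaleR_add_right)
          moreover have "?g2 n s = (1 / c) *\<^sub>R cross3 (Jn n s) (Bi s) - (l / c) *\<^sub>R cross3 (y n s) (Bi s)"
            by (simp add: bounded_bilinear.diff_left[OF bounded_bilinear_cross3]
                bounded_bilinear.scaleR_left[OF bounded_bilinear_cross3] scaleR_diff_right)
          moreover have "(l / c) *\<^sub>R ?yB s = (l / c) *\<^sub>R cross3 (y n s) (Bi s) - (l / c) *\<^sub>R cross3 (v s) (Bi s)"
            by (simp add: bounded_bilinear.diff_left[OF bounded_bilinear_cross3] scaleR_diff_right)
          ultimately show ?thesis
            using W.force_split[OF s, of n] by (simp add: ch_def Jn_def Ei_def Bi_def scaleR_diff_left)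
        qed
        have cf: "continuous_on I (\<lambda>s. ball_int (R n) s (f (R n) (\<psi> n)))"
          by (intro continuous_ball_int W.continuous_force)
        have c1: "continuous_on I (?g1 n)" "continuous_on I (?g2 n)" "continuous_on I (\<lambda>s. (l / c) *\<^sub>R ?yB s)"
          "continuous_on I (\<lambda>s. (l * m / q) *\<^sub>R N s)"
          by (intro cg1 cg2 elim continuous_intros cc cy[OF elim] continuous_v cBi cN)+
        \<comment> \<open>Read off from \<open>fs\<close>: the total force and the other four
          summands are continuous, hence so is the remaining one.\<close>
        have cQ: "continuous_on I ?Q3"
          by (rule continuous_on_eq[OF continuous_on_diff[OF continuous_on_diff[OF continuous_on_diff[OF
            continuous_on_diff[OF cf c1(1)] c1(2)] c1(3)] c1(4)]]) (simp add: fs)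
        note ii = interval_integrable[OF t0 t cQ] c1[THEN interval_integrable[OF t0 t]]
        have "Pn n t - Pn n t0 - Q01 (R n) (\<psi> n) t0 t + Q0 (R n) (a n) (\<psi> n) t0 t
            + Q0' (R n) (P' n) (T' n) (f' n) t0 t = (LBINT s=ereal t0..ereal t. ball_int (R n) s (f (R n) (\<psi> n)))"
          unfolding Pn_def by (rule W.momentum_balance[OF law t0 t])
        also have "\<dots> = (LBINT s=ereal t0..ereal t. ?Q3 s + ?g1 n s + ?g2 n s + (l / c) *\<^sub>R ?yB s + (l * m / q) *\<^sub>R N s)"
          by (rule interval_cong[OF t0 t fs])
        also have "\<dots> = (LBINT s=ereal t0..ereal t. ?Q3 s) + (LBINT s=ereal t0..ereal t. ?g1 n s)
            + (LBINT s=ereal t0..ereal t. ?g2 n s) + (l / c) *\<^sub>R yB n t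
            + (l * m / q) *\<^sub>R (LBINT s=ereal t0..ereal t. N s)"
          unfolding yB_def
          by (simp only: interval_lebesgue_integral_add ii interval_integral_scaleR)
        finally have "Pn n t - Pn n t0 = ?Z n t + (l * m / q) *\<^sub>R (LBINT s=ereal t0..ereal t. N s)"
          by (simp add: algebra_simps)
        then have "(q / m) *\<^sub>R (Pn n t - Pn n t0) =
            (q / m) *\<^sub>R ?Z n t + l *\<^sub>R (LBINT s=ereal t0..ereal t. N s)"
          using q_pos m_pos by (simp add: scaleR_add_right)
        then have "Jn n t - Jn n t0 = (q / m) *\<^sub>R ?Z n t + l *\<^sub>R (LBINT s=ereal t0..ereal t. N s)"
          by (simp only: Jn_eq scaleR_diff_right)
        then have "(q / m) *\<^sub>R ?Z n t - (Jn n t - l *\<^sub>R y n t) + (Jn n t0 - l *\<^sub>R y n t0) =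
            l *\<^sub>R (y n t - y n t0 - (LBINT s=ereal t0..ereal t. N s))"
          by (simp add: scaleR_diff_right algebra_simps)
        then show "y n t - y n t0 - (LBINT s=ereal t0..ereal t. N s) =
            (1 / l) *\<^sub>R ((q / m) *\<^sub>R ?Z n t - (Jn n t - l *\<^sub>R y n t) + (Jn n t0 - l *\<^sub>R y n t0))"
          using l_pos c0 by simp
      qed
    qed
  qed

  \<comment> \<open>\<open>F\<close> and \<open>H\<close> are first and second antiderivatives of
    \<open>N\<close>: velocities are compared with \<open>F\<close>, centers with
    \<open>H\<close>.\<close>
  obtain G where G: "\<And>t. t \<in> I \<Longrightarrow> (G has_vector_derivative N t) (at t within I)"
    using antiderivative_continuous[OF cN] by blast
  define F where "F t = G t - G t0" for t
  have F: "(F has_vector_derivative N t) (at t within I)" if "t \<in> I" for t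
    unfolding F_def using G[OF that] by (auto intro!: derivative_eq_intros)
  have cF: "continuous_on I F"
    by (rule has_derivative_continuous_on) (rule F[unfolded has_vector_derivative_def])
  have FI: "(LBINT s=ereal t0..ereal t. N s) = F t" if "t \<in> I" for t
    unfolding F_def by (rule interval_FTC[OF t0 that cN G])
  obtain H where H: "\<And>t. t \<in> I \<Longrightarrow> (H has_vector_derivative F t) (at t within I)"
    using antiderivative_continuous[OF cF] by blast
  have y_lim': "tends_to_0 (\<lambda>n t. y n t - y n t0 - F t)"
    by (rule tends_to_0_cong[OF y_lim]) (simp add: FI)
  have "\<forall>\<^sub>F n in sequentially. continuous_on I (\<lambda>t. y n t - y n t0 - F t)"
    using late by eventually_elim (intro continuous_intros cy cF)
  from tends_to_0_integral[OF y_lim' this t0]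
  have "tends_to_0 (\<lambda>n t. LBINT s=ereal t0..ereal t. y n s - y n t0 - F s)" .
  then have "tends_to_0 (\<lambda>n t. center (R n) (\<psi> n) t - center (R n) (\<psi> n) t0 - (t - t0) *\<^sub>R y n t0 - (H t - H t0))"
  proof (rule tends_to_0_cong)
    show "\<forall>\<^sub>F n in sequentially. \<forall>t\<in>I. center (R n) (\<psi> n) t - center (R n) (\<psi> n) t0 - (t - t0) *\<^sub>R y n t0 - (H t - H t0) =
        (LBINT s=ereal t0..ereal t. y n s - y n t0 - F s)"
      using late
    proof eventually_elim
      case (elim n)
      show ?case
      proof
        fix t assume t: "t \<in> I"
        have "(LBINT s=ereal t0..ereal t. y n s - y n t0 - F s) =
           (center (R n) (\<psi> n) t - t *\<^sub>R y n t0 - H t) - (center (R n) (\<psi> n) t0 - t0 *\<^sub>R y n t0 - H t0)"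
        proof (rule interval_FTC[OF t0 t])
          show "continuous_on I (\<lambda>s. y n s - y n t0 - F s)" by (intro continuous_intros cy elim cF)
          show "((\<lambda>s. center (R n) (\<psi> n) s - s *\<^sub>R y n t0 - H s) has_vector_derivative y n s - y n t0 - F s)
              (at s within I)" if "s \<in> I" for s
            using cen_deriv[OF elim that] H[OF that] by (auto intro!: derivative_eq_intros)
        qed
        then show "center (R n) (\<psi> n) t - center (R n) (\<psi> n) t0 - (t - t0) *\<^sub>R y n t0 - (H t - H t0) =
            (LBINT s=ereal t0..ereal t. y n s - y n t0 - F s)" by (simp add: algebra_simps)
      qed
    qed
  qed
  from tends_to_0_diff[OF tends_to_0_diff[OF cen_lim tends_to_0_const[OF tends_to_0_at[OF cen_lim t0]]] this]
  have lim: "tends_to_0 (\<lambda>n t. (t - t0) *\<^sub>R y n t0 - (r t - r t0 - (H t - H t0)))"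
    by (rule tends_to_0_cong) (simp add: algebra_simps)
  define X where "X t = r t - r t0 - (H t - H t0)" for t
  have X: "(\<lambda>n. (t - t0) *\<^sub>R y n t0) \<longlonglongrightarrow> X t" if "t \<in> I" for t
    unfolding X_def by (rule LIM_zero_cancel[OF tends_to_0_at[OF lim that]])
  \<comment> \<open>One time other than \<open>t0\<close> suffices: there
    \<open>(t1 - t0) *\<^sub>R y n t0\<close> converges, so the initial velocities have a limit
    \<open>y0\<close>, and the limit formula then holds with the same \<open>y0\<close> at every
    time.\<close>
  obtain t1 where t1: "t1 \<in> I" "t1 \<noteq> t0"
  proof (cases "t0 = Tm")
    case True
    then show ?thesis using that[of Tp] T_less by simp
  next
    case False
    then show ?thesis using that[of Tm] T_less by simp
  qed
  define y0 where "y0 = (1 / (t1 - t0)) *\<^sub>R X t1"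
  have "(\<lambda>n. (1 / (t1 - t0)) *\<^sub>R ((t1 - t0) *\<^sub>R y n t0)) \<longlonglongrightarrow> y0"
    unfolding y0_def by (intro tendsto_scaleR tendsto_const X t1)
  then have y0: "(\<lambda>n. y n t0) \<longlonglongrightarrow> y0" using t1 by simp
  have "X t = (t - t0) *\<^sub>R y0" if "t \<in> I" for t
    using LIMSEQ_unique[OF X[OF that] tendsto_scaleR[OF tendsto_const y0]] .
  then have r_eq: "r t = r t0 + (t - t0) *\<^sub>R y0 + (H t - H t0)" if "t \<in> I" for t
    using that by (simp add: X_def algebra_simps)
  have v_eq: "v t = y0 + F t" if t: "t \<in> I" for t
  proof -
    have "((\<lambda>t. r t0 + (t - t0) *\<^sub>R y0 + (H t - H t0)) has_vector_derivative y0 + F t) (at t within I)"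
      using H[OF t] by (auto intro!: derivative_eq_intros)
    then have "(r has_vector_derivative y0 + F t) (at t within I)"
      by (rule has_vector_derivative_transform[OF t, rotated]) (rule r_eq)
    then show ?thesis
      using vector_derivative_unique_within_closed_interval[unfolded box_real, OF T_less t r_deriv[OF t]] by blast
  qed
  show newton_law
    unfolding newton_law_def
  proof
    fix t assume t: "t \<in> I"
    have "((\<lambda>t. y0 + F t) has_vector_derivative N t) (at t within I)"
      using F[OF t] by (auto intro!: derivative_eq_intros)
    then have "(v has_vector_derivative N t) (at t within I)"
      by (rule has_vector_derivative_transform[OF t, rotated]) (rule v_eq)
    then have "acceleration Tm Tp r t = N t"
      using vector_derivative_unique_within_closed_interval[unfolded box_real, OF T_less t v_deriv[OF t]] by blast
    then show "m *\<^sub>R acceleration Tm Tp r t = q *\<^sub>R E (t, r t) + (q / c) *\<^sub>R cross3 (v t) (B (t, r t))"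
      using m_pos by (simp add: N_def Ei_def Bi_def scaleR_add_right)
  qed
qed

end

subsection \<open>Wave packets\<close>

lemma set_integral_zero:
  assumes "\<And>x. x \<in> S \<Longrightarrow> F x = 0" shows "(LINT x:S|M. F x) = 0"
proof -
  have "(\<lambda>x. indicator S x *\<^sub>R F x) = (\<lambda>_. 0)" using assms by (auto simp: indicator_def fun_eq_iff)
  then show ?thesis by (simp add: set_lebesgue_integral_def)
qed

text \<open>On the ball of half the radius the base is at least \<open>R\<^sup>2 / 2\<close>.
  Positivity makes the normalizing factor in \<open>profile\<close> meaningful.\<close>

lemma bump_integral_pos:
  assumes R: "R > 0"
  shows "(LINT y:cball (0::'a::euclidean_space) R|lborel. (R\<^sup>2 - y \<bullet> y) ^ 4) > 0"
proof -
  let ?g = "\<lambda>y::'a. (R\<^sup>2 - y \<bullet> y) ^ 4" and ?k = "(R\<^sup>2 / 2) ^ 4"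
  have cont: "continuous_on X ?g" for X by (intro continuous_intros)
  have "0 < ?k * measure lebesgue (cball (0::'a) (R / 2))"
    using R content_cball_pos[of "R / 2" "0::'a"] by (simp add: measure_completion)
  also have "\<dots> = integral (cball (0::'a) (R / 2)) (\<lambda>_. ?k)"
    using integral_mult_right[of "cball (0::'a) (R / 2)" ?k "\<lambda>_. 1"] lmeasure_integral[OF lmeasurable_cball[of "0::'a" "R / 2"]]
    by simp
  also have "\<dots> \<le> integral (cball (0::'a) (R / 2)) ?g"
  proof (rule integral_le)
    show "(\<lambda>_. ?k) integrable_on cball (0::'a) (R / 2)" by (intro integrable_on_const lmeasurable_cball)
    show "?g integrable_on cball 0 (R / 2)" by (rule set_integrable_cball(2)[OF cont])
    fix y :: 'a assume "y \<in> cball 0 (R / 2)"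
    then have "(norm y)\<^sup>2 \<le> (R / 2)\<^sup>2" by (intro power_mono) auto
    then have "y \<bullet> y \<le> R\<^sup>2 / 4" by (simp add: power2_norm_eq_inner power_divide)
    also have "\<dots> \<le> R\<^sup>2 / 2" by simp
    finally have "y \<bullet> y \<le> R\<^sup>2 / 2" .
    then show "?k \<le> ?g y" by (intro power_mono) auto
  qed
  also have "\<dots> \<le> integral (cball 0 R) ?g"
    using R by (intro integral_subset_le set_integrable_cball(2)[OF cont]) auto
  finally show ?thesis by (simp add: set_integrable_cball(3)[OF cont])
qed

locale nls_packet = nls_trajectory +
  fixes a R :: real and w :: "real \<Rightarrow> real^3"
  assumes a_pos: "a > 0" and R_pos: "R > 0" and tube_D: "tube R \<subseteq> D" and w: "polynomial_function w"
begin

lemma solid_tube': "solid (tube R)" using solid_tube[OF R_pos] .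

text \<open>The polynomial \<open>w\<close> approximates \<open>m v + (q/c) A\<close> along the trajectory, which is too rough for the
  phase of a \<open>C\<^sup>2\<close> packet.  The square in \<open>profile\<close> makes the packet and its first derivatives
  vanish on the boundary of the ball.\<close>

definition shift :: "spacetime \<Rightarrow> real^3" where
  "shift p = snd p - r (fst p)"

definition profile :: "spacetime \<Rightarrow> real" where
  "profile p = (R\<^sup>2 - shift p \<bullet> shift p)\<^sup>2 * (1 / sqrt (LINT y:cball (0::real^3) R|lborel. (R\<^sup>2 - y \<bullet> y) ^ 4))"

definition phase :: "spacetime \<Rightarrow> complex" where
  "phase p = \<i> * of_real ((w (fst p) \<bullet> shift p) * (1 / chi))"

definition packet :: "spacetime \<Rightarrow> complex" where
  "packet p = of_real (profile p) * exp (phase p)"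

lemma Ck_fst: "Ck k (tube R) fst" and fst_tube: "fst ` tube R \<subseteq> I"
  by (rule Ck_linear[OF solid_tube' bounded_linear_fst Ck_id[OF solid_tube']]) (auto simp: tube_def)

lemma Ck_shift: "Ck 2 (tube R) shift"
  unfolding shift_def[abs_def]
  by (intro Ck_diff Ck_comp[OF solid_tube' Ck_fst Ck_r fst_tube] Ck_linear[OF _ bounded_linear_snd] Ck_id solid_tube')

lemma Ck_profile: "Ck 2 (tube R) profile"
  unfolding profile_def[abs_def] power2_eq_square[of "R\<^sup>2 - _"]
  by (intro Ck_intros Ck_shift solid_tube')

lemma Ck_w: "Ck k (tube R) (\<lambda>p. w (fst p))"
  by (rule Ck_comp[OF solid_tube' Ck_fst Ck_polynomial[OF solid_I w] fst_tube])

lemma Ck_phase: "Ck 2 (tube R) phase"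
  unfolding phase_def[abs_def] by (intro Ck_intros Ck_shift Ck_w solid_tube')

lemma Ck_packet: "Ck 2 (tube R) packet"
  unfolding packet_def[abs_def]
  by (intro Ck_intros Ck_profile Ck_comp[OF solid_tube' Ck_phase Ck_exp] solid_tube') auto

lemma Ck_1: "Ck (Suc 0) (tube R) shift" "Ck (Suc 0) (tube R) profile" "Ck (Suc 0) (tube R) phase"
  "Ck (Suc 0) (tube R) packet"
  using Ck_shift Ck_profile Ck_phase Ck_packet Ck_Suc_imp[of "Suc 0" "tube R"]
  unfolding numeral_2_eq_2 by blast+

lemma shift_deriv:
  assumes p: "p \<in> tube R"
  shows "(shift has_derivative (\<lambda>h. snd h - fst h *\<^sub>R v (fst p))) (at p within tube R)"
proof -
  have "fst p \<in> I" using p by (auto simp: tube_def)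
  then have "(r has_derivative (\<lambda>h. h *\<^sub>R v (fst p))) (at (fst p) within fst ` tube R)"
    using has_derivative_subset[OF r_deriv[unfolded has_vector_derivative_def] fst_tube] by blast
  from has_derivative_in_compose[OF has_derivative_fst[OF has_derivative_ident] this]
  show ?thesis unfolding shift_def[abs_def]
    by (intro has_derivative_diff has_derivative_snd has_derivative_ident)
qed

lemma pd_shift: "p \<in> tube R \<Longrightarrow> pd (tube R) h shift p = snd h - fst h *\<^sub>R v (fst p)"
  by (rule pd_eq[OF solid_tube' _ shift_deriv])

text \<open>Two factors carry the information: the first vanishes on the boundary of the ball, the
  last vanishes in the direction \<open>(1, v)\<close> of the motion. The value of \<open>k\<close>
  never matters, so it is hidden.\<close>

lemma pd_profile:
  assumes p: "p \<in> tube R"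
  obtains k where "\<And>h. pd (tube R) h profile p =
      (R\<^sup>2 - shift p \<bullet> shift p) * k * (shift p \<bullet> (snd h - fst h *\<^sub>R v (fst p)))"
proof -
  define z where "z = 1 / sqrt (LINT y:cball (0::real^3) R|lborel. (R\<^sup>2 - y \<bullet> y) ^ 4)"
  have "(profile has_derivative (\<lambda>h. (R\<^sup>2 - shift p \<bullet> shift p) * (- 4 * z) *
      (shift p \<bullet> (snd h - fst h *\<^sub>R v (fst p))))) (at p within tube R)"
    unfolding profile_def[abs_def] z_def[symmetric]
    by (rule has_derivative_eq_rhs, (rule derivative_intros shift_deriv[OF p])+)
       (simp add: fun_eq_iff inner_commute algebra_simps)
  from pd_eq[OF solid_tube' p this] show ?thesis by (rule that)
qed

lemma pd_packet:
  assumes p: "p \<in> tube R"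
  shows "pd (tube R) h packet p =
    (of_real (pd (tube R) h profile p) + of_real (profile p) * pd (tube R) h phase p) * exp (phase p)"
proof -
  have e: "Ck (Suc 0) (tube R) (\<lambda>p. exp (phase p))"
    by (rule Ck_comp[OF solid_tube' Ck_1(3) Ck_exp]) simp
  have "pd UNIV k exp z = exp z * k" for z k :: complex
    by (rule pd_eq) (use DERIV_exp[of z] in \<open>auto simp: has_field_derivative_def\<close>)
  then have "pd (tube R) h (\<lambda>p. exp (phase p)) p = exp (phase p) * pd (tube R) h phase p"
    by (subst pd_comp[OF solid_tube' Ck_1(3) Ck_exp _ p]) auto
  moreover have "pd (tube R) h (\<lambda>p. complex_of_real (profile p)) p = of_real (pd (tube R) h profile p)"
    by (rule pd_linear[OF solid_tube' bounded_linear_of_real Ck_1(2) p])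
  ultimately show ?thesis
    unfolding packet_def[abs_def]
    by (subst pd_bilinear[OF solid_tube' bounded_bilinear_mult Ck_of_real[OF solid_tube' Ck_1(2)] e p])
       (simp add: algebra_simps)
qed

lemma pd_phase_space:
  assumes p: "p \<in> tube R"
  shows "pd (tube R) (0, k) phase p = \<i> * of_real ((w (fst p) \<bullet> k) * (1 / chi))"
proof -
  have img: "fst p \<in> I" using p by (auto simp: tube_def)
  have "pd (tube R) (0, k) fst p = 0"
    using pd_eq[OF solid_tube' p, of fst fst] by (simp add: has_derivative_fst[OF has_derivative_ident])
  then have dw: "pd (tube R) (0, k) (\<lambda>p. w (fst p)) p = 0"
    using pd_comp[OF solid_tube' Ck_fst Ck_polynomial[OF solid_I w] fst_tube p]
      Ck_interval(2)[OF T_less Ck_polynomial[OF solid_I w] img, of 0] by simp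
  have "pd (tube R) (0, k) (\<lambda>p. w (fst p) \<bullet> shift p) p = w (fst p) \<bullet> k"
    using pd_bilinear[OF solid_tube' bounded_bilinear_inner Ck_w Ck_1(1) p, of "(0, k)"] dw pd_shift[OF p]
    by simp
  moreover have C: "Ck (Suc 0) (tube R) (\<lambda>p. w (fst p) \<bullet> shift p)"
    by (intro Ck_intros Ck_w Ck_1 solid_tube')
  moreover have B: "bounded_linear (\<lambda>x. \<i> * complex_of_real (x * (1 / chi)))"
    by (intro bounded_linear_mult_right[THEN bounded_linear_compose] bounded_linear_of_real[THEN bounded_linear_compose]
        bounded_linear_mult_left)
  ultimately show ?thesis
    unfolding phase_def[abs_def] by (simp only: pd_linear[OF solid_tube' B C p])
qed

end

text \<open>Makes the regularity facts and exact balances available for the packet.\<close>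

sublocale nls_packet \<subseteq> nls_wave m q chi c G1' D \<phi> A Tm Tp r a R packet
  by unfold_locales (rule a_pos R_pos tube_D Ck_packet)+

context nls_packet
begin

lemma norm_packet: "cmod (packet p) = \<bar>profile p\<bar>"
  by (simp add: packet_def norm_mult norm_exp_eq_Re phase_def)

lemma \<rho>_packet: "\<rho> packet p = q * (profile p)\<^sup>2"
  by (simp add: \<rho>_eq norm_packet)

lemma cov_x_star_cnj:
  assumes p: "p \<in> tube R"
  shows "cov_x_star R j (cnj \<circ> packet) p = cnj (cov_x R j packet p)"
proof -
  have "dx (tube R) j (cnj \<circ> packet) p = cnj (dx (tube R) j packet p)"
    unfolding dx_def o_def by (rule pd_linear[OF solid_tube' bounded_linear_cnj Ck_1(4) p])
  then show ?thesis by (simp add: cov_x_star_def cov_x_def)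
qed

text \<open>The derivative of the real amplitude drops out of the imaginary part of
  \<open>cnj \<psi>\<close> times the covariant derivative. What remains is the phase gradient
  \<open>w / chi\<close> minus the potential, and the factor \<open>chi\<close> in the momentum
  restores \<open>w\<close>.\<close>

lemma P_packet:
  assumes p: "p \<in> tube R"
  shows "P R packet p = (profile p)\<^sup>2 *\<^sub>R (w (fst p) - (q / c) *\<^sub>R A p)"
proof -
  have "P R packet p $ j = (profile p)\<^sup>2 * (w (fst p) $ j - q / c * A p $ j)" for j
  proof -
    let ?e = "exp (phase p)" and ?d = "pd (tube R) (0, axis j 1) profile p"
    let ?b = "(w (fst p) $ j) * (1 / chi) - q / (chi * c) * A p $ j"
    have D: "cov_x R j packet p = (of_real ?d + \<i> * of_real (profile p * ?b)) * ?e"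
      unfolding cov_x_def dx_def pd_packet[OF p] pd_phase_space[OF p] packet_def
      by (simp add: inner_axis algebra_simps)
    have ee: "cnj ?e * ?e = 1"
      using complex_norm_square[of ?e] by (simp add: norm_exp_eq_Re phase_def mult.commute)
    have "cnj (packet p) * cov_x R j packet p =
        of_real (profile p) * (of_real ?d + \<i> * of_real (profile p * ?b)) * (cnj ?e * ?e)"
      unfolding D packet_def by (simp add: algebra_simps)
    then have Im: "Im (cnj (packet p) * cov_x R j packet p) = (profile p)\<^sup>2 * ?b"
      unfolding ee by (simp add: power2_eq_square)
    have "P R packet p $ j = chi * Im (cnj (packet p) * cov_x R j packet p)"
    proof -
      have "Re (\<i> * of_real k * (x * cnj y - cnj x * y)) = 2 * k * Im (cnj x * y)" for k x y
        by (simp add: algebra_simps)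
      then have "P R packet p $ j = 2 * (chi / 2) * Im (cnj (packet p) * cov_x R j packet p)"
        unfolding P_def vec_lambda_beta cov_x_star_cnj[OF p] .
      then show ?thesis by simp
    qed
    also have "\<dots> = (profile p)\<^sup>2 * (chi * ?b)" unfolding Im by (rule mult.left_commute)
    also have "chi * ?b = w (fst p) $ j - q / c * A p $ j"
      using chi_pos c_pos by (simp add: field_simps)
    finally show ?thesis .
  qed
  then show ?thesis by (simp add: vec_eq_iff)
qed

text \<open>The packet and all its first derivatives vanish there, and the nonlinear energy of a
  zero wave is an integral over \<open>{0..0}\<close>. The time derivatives in \<open>T\<close> are
  moreover multiplied by the wave itself.\<close>

lemma boundary:
  assumes t: "t \<in> I" and x: "x \<in> sphere (r t) R"
  shows "packet (t, x) = 0" "P R packet (t, x) = 0" "J R packet (t, x) = 0" "\<rho> packet (t, x) = 0"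
    "T R a packet i j (t, x) = 0"
proof -
  have p: "(t, x) \<in> tube R" using t x by (intro tubeI) auto
  have s: "R\<^sup>2 - shift (t, x) \<bullet> shift (t, x) = 0"
    using x by (simp add: shift_def dist_norm norm_minus_commute flip: power2_norm_eq_inner)
  then have pr: "profile (t, x) = 0" by (simp add: profile_def)
  then show pk: "packet (t, x) = 0" by (simp add: packet_def)
  have "pd (tube R) h packet (t, x) = 0" for h
  proof -
    have "pd (tube R) h profile (t, x) = 0" by (rule pd_profile[OF p]) (simp add: s)
    then show ?thesis by (simp add: pd_packet[OF p] pr)
  qed
  then have cov: "cov_x R j packet (t, x) = 0" for j using pk by (simp add: cov_x_def dx_def)
  show "P R packet (t, x) = 0" using P_packet[OF p] pr by simp
  then show "J R packet (t, x) = 0" by (simp add: J_eq)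
  show "\<rho> packet (t, x) = 0" by (simp add: \<rho>_packet pr)
  have "u R a packet (t, x) = 0" using pk by (simp add: u_def cov Ga_def)
  then show "T R a packet i j (t, x) = 0" using pk by (simp add: T_def cov)
qed

lemma sphere_int_zero:
  assumes "\<And>n x. x \<in> sphere (r t) R \<Longrightarrow> F n (t, x) = 0"
  shows "sphere_int R t F = 0"
  unfolding sphere_int_def by (rule set_integral_zero) (rule assms)

lemma continuous_profile2: "continuous_on (tube R) (\<lambda>p. (profile p)\<^sup>2)"
  by (intro continuous_intros Ck_imp_continuous[OF Ck_1(2)])

text \<open>The square root in \<open>profile\<close> is chosen for this:
  \<open>(R\<^sup>2 - y \<bullet> y) ^ 4\<close> is the square of the unnormalized bump.\<close>

lemma mass_profile:
  assumes t: "t \<in> I"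
  shows "ball_int R t (\<lambda>p. (profile p)\<^sup>2) = 1"
proof -
  let ?b = "LINT y:cball (0::real^3) R|lborel. (R\<^sup>2 - y \<bullet> y) ^ 4"
  have b: "?b > 0" by (rule bump_integral_pos[OF R_pos])
  have "ball_int R t (\<lambda>p. (profile p)\<^sup>2) = (LINT y:cball 0 R|lborel. (profile (t, r t + y))\<^sup>2)"
    unfolding ball_int_def by (rule integral_cball_shift[OF continuous_slice[OF continuous_profile2 t]])
  also have "\<dots> = (LINT y:cball (0::real^3) R|lborel. (1 / ?b) * (R\<^sup>2 - y \<bullet> y) ^ 4)"
    by (intro set_lebesgue_integral_cong)
      (use b in \<open>simp_all add: profile_def shift_def power_mult_distrib power_divide flip: power_mult\<close>)
  also have "\<dots> = (1 / ?b) * ?b" by (rule set_integral_mult_right)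
  finally show ?thesis using b by simp
qed

text \<open>The squared profile is a probability density on each ball, so an average against it
  stays as close to \<open>k\<close> as the values do.\<close>

lemma average_close:
  fixes g :: "spacetime \<Rightarrow> real^3"
  assumes t: "t \<in> I" and g: "continuous_on (tube R) g"
    and e: "\<And>x. x \<in> cball (r t) R \<Longrightarrow> norm (g (t, x) - k) \<le> e"
  shows "norm (ball_int R t (\<lambda>p. (profile p)\<^sup>2 *\<^sub>R g p) - k) \<le> e"
proof -
  note cp = continuous_profile2
  have c1: "continuous_on (tube R) (\<lambda>p. (profile p)\<^sup>2 *\<^sub>R g p)" by (intro continuous_on_scaleR cp g)
  have c2: "continuous_on (tube R) (\<lambda>p. (profile p)\<^sup>2 *\<^sub>R k)" by (intro continuous_on_scaleR cp continuous_on_const)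
  have c3: "continuous_on (tube R) (\<lambda>p. (profile p)\<^sup>2 *\<^sub>R (g p - k))"
    by (intro continuous_on_scaleR cp continuous_on_diff g continuous_on_const)
  have "ball_int R t (\<lambda>p. (profile p)\<^sup>2 *\<^sub>R g p) - k =
      ball_int R t (\<lambda>p. (profile p)\<^sup>2 *\<^sub>R g p) - ball_int R t (\<lambda>p. (profile p)\<^sup>2 *\<^sub>R k)"
    by (simp only: ball_int_scaleR_left[OF t cp] mass_profile[OF t] scaleR_one)
  also have "\<dots> = ball_int R t (\<lambda>p. (profile p)\<^sup>2 *\<^sub>R (g p - k))"
    by (simp only: ball_int_diff[OF t c1 c2, symmetric] scaleR_diff_right)
  also have "norm \<dots> \<le> ball_int R t (\<lambda>p. (profile p)\<^sup>2) * e"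
    by (rule ball_int_bound[OF t c3 cp]) (use e in \<open>auto intro!: mult_left_mono\<close>)
  finally show ?thesis by (simp add: mass_profile[OF t])
qed

lemma charge_packet: "t \<in> I \<Longrightarrow> charge R packet t = q"
  using ball_int_scaleR_right[of R t q "\<lambda>p. (profile p)\<^sup>2"] mass_profile[of t]
  by (simp add: charge_def \<rho>_packet[abs_def])

text \<open>The profile is rigidly carried along, so the current that truly conserves its charge is
  \<open>\<rho>\<close> times \<open>v\<close>; this is the correction from \<open>J\<close> to
  it.\<close>

definition Jpert :: "spacetime \<Rightarrow> real^3" where
  "Jpert p = \<rho> packet p *\<^sub>R v (fst p) - J R packet p"

definition fpert :: "spacetime \<Rightarrow> real^3" where
  "fpert p = dt (tube R) (P R packet) p + div_tensor (tube R) (T R a packet) p - f R packet p"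

lemma Ck_v_fst: "Ck (Suc 0) (tube R) (\<lambda>p. v (fst p))"
  by (rule Ck_comp[OF solid_tube' Ck_fst Ck_v fst_tube])

text \<open>The momentum law holds by the choice of \<open>fpert\<close>. In the charge law the
  total current is \<open>\<rho>\<close> times \<open>v\<close>, and \<open>v\<close> depends on
  time alone, so the law says that \<open>\<rho>\<close> is constant in the direction
  \<open>(1, v)\<close>.\<close>

lemma packet_laws:
  "perturbed_laws R a packet (\<lambda>_. 0) Jpert (\<lambda>_. 0) (\<lambda>_ _ _. 0) fpert"
  unfolding perturbed_laws_def One_nat_def
proof (intro conjI allI ballI)
  note S = solid_tube'
  have C\<rho>v: "Ck (Suc 0) (tube R) (\<lambda>p. \<rho> packet p *\<^sub>R v (fst p))"
    by (intro Ck_scaleR S Ck_densities Ck_v_fst)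
  show "Ck (Suc 0) (tube R) Jpert"
    unfolding Jpert_def[abs_def] by (intro Ck_diff S C\<rho>v Ck_densities)
  show "continuous_on (tube R) fpert"
    unfolding fpert_def[abs_def]
    by (intro continuous_intros continuous_dt continuous_div_tensor continuous_force Ck_densities)
  show "Ck (Suc 0) (tube R) (\<lambda>_. 0::real)" by (rule Ck_const[OF S])
  show "Ck (Suc 0) (tube R) (\<lambda>_. 0::real^3)" by (rule Ck_const[OF S])
  show "Ck (Suc 0) (tube R) (\<lambda>_. 0::real)" by (rule Ck_const[OF S])
  fix p assume p: "p \<in> tube R"
  have z: "pd (tube R) h (\<lambda>_. 0) p = (0::'b::real_inner)" for h
    by (rule pd_eq[OF S p has_derivative_const])
  show "dt (tube R) (P R packet) p + dt (tube R) (\<lambda>_. 0) p + div_tensor (tube R) (T R a packet) p +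
      div_tensor (tube R) (\<lambda>_ _ _. 0) p = f R packet p + fpert p"
    by (simp add: fpert_def dt_def div_tensor_def dx_def z vec_eq_iff)
  have img: "fst p \<in> I" using p by (auto simp: tube_def)
  have C\<rho>: "Ck (Suc 0) (tube R) (\<rho> packet)" by (rule Ck_densities)
  have vj: "pd (tube R) (0, h) (\<lambda>p. v (fst p) $ j) p = 0" for h j
  proof -
    have "pd (tube R) (0, h) fst p = 0"
      using pd_eq[OF S p, of fst fst] by (simp add: has_derivative_fst[OF has_derivative_ident])
    then have "pd (tube R) (0, h) (\<lambda>p. v (fst p)) p = 0"
      using pd_comp[OF S Ck_fst Ck_v fst_tube p] Ck_interval(2)[OF T_less Ck_v img, of 0] by simp
    then show ?thesis using pd_linear[OF S bounded_linear_vec_nth Ck_v_fst p] by simp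
  qed
  have d: "dx (tube R) j (\<lambda>p. (\<rho> packet p *\<^sub>R v (fst p)) $ j) p = v (fst p) $ j * dx (tube R) j (\<rho> packet) p" for j
    using pd_bilinear[OF S bounded_bilinear_mult C\<rho> Ck_vec_nth[OF S Ck_v_fst] p, of "(0, axis j 1)" j] vj
    by (simp add: dx_def mult.commute)
  interpret L: bounded_linear "\<lambda>h. pd (tube R) h (\<rho> packet) p"
    using Ck_Suc_deriv[OF C\<rho> p] by (rule has_derivative_bounded_linear)
  have "(1, v (fst p)) = (1, 0) + (\<Sum>j\<in>UNIV. v (fst p) $ j *\<^sub>R (0::real, axis j (1::real)))"
    by (simp add: prod_eq_iff fst_sum snd_sum vec_eq_iff axis_def if_distrib cong: if_cong)
  then have "pd (tube R) (1, v (fst p)) (\<rho> packet) p =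
      dt (tube R) (\<rho> packet) p + (\<Sum>j\<in>UNIV. v (fst p) $ j * dx (tube R) j (\<rho> packet) p)"
    by (simp only: L.add L.sum L.scaleR dt_def dx_def real_scaleR_def)
  moreover have "pd (tube R) (1, v (fst p)) (\<rho> packet) p = 0"
  proof -
    \<comment> \<open>Along \<open>(1, v)\<close> the position relative to the trajectory does not
      change: the last factor in \<open>pd_profile\<close> is zero.\<close>
    have "pd (tube R) (1, v (fst p)) profile p = 0"
      by (rule pd_profile[OF p]) simp
    then have "pd (tube R) (1, v (fst p)) (\<lambda>p. profile p * profile p) p = 0"
      by (simp add: pd_bilinear[OF S bounded_bilinear_mult Ck_1(2) Ck_1(2) p])
    then show ?thesis
      using pd_linear[OF S bounded_linear_mult_right[of q] Ck_mult[OF S Ck_1(2) Ck_1(2)] p]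
      by (simp add: \<rho>_packet[abs_def] power2_eq_square)
  qed
  ultimately have 1: "dt (tube R) (\<rho> packet) p + (\<Sum>j\<in>UNIV. v (fst p) $ j * dx (tube R) j (\<rho> packet) p) = 0"
    by simp
  have "dx (tube R) j (\<lambda>p. Jpert p $ j) p =
      v (fst p) $ j * dx (tube R) j (\<rho> packet) p - dx (tube R) j (\<lambda>p. J R packet p $ j) p" for j
  proof -
    have "dx (tube R) j (\<lambda>p. (\<rho> packet p *\<^sub>R v (fst p)) $ j - J R packet p $ j) p =
        dx (tube R) j (\<lambda>p. (\<rho> packet p *\<^sub>R v (fst p)) $ j) p - dx (tube R) j (\<lambda>p. J R packet p $ j) p"
      unfolding dx_def
      by (rule pd_eq[OF S p has_derivative_diff[OF
            Ck_Suc_deriv[OF Ck_vec_nth[OF S C\<rho>v] p] Ck_Suc_deriv[OF Ck_vec_nth[OF S Ck_densities(2)] p]]])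
    then show ?thesis unfolding d Jpert_def by (simp only: vector_minus_component)
  qed
  then show "dt (tube R) (\<rho> packet) p + dt (tube R) (\<lambda>_. 0) p + div3 (tube R) (J R packet) p +
      div3 (tube R) Jpert p = 0"
    using 1 by (simp add: div3_def dt_def z sum_subtractf)
qed

text \<open>Surface terms die with the packet on the sphere. What survives measures two defects:
  \<open>Q2'\<close> compares the mean momentum with \<open>m v\<close>, and \<open>Q0'\<close>
  compares its increment with the integrated force.\<close>

lemma packet_boundary_terms:
  assumes t0: "t0 \<in> I" and t: "t \<in> I"
  shows "Q0 R a packet t0 t = 0" "Q01 R packet t0 t = 0" "Q20 R packet t = 0" "Q22 R packet t = 0"
    "Q23 R packet t0 t = 0" "Q3' R (\<lambda>_. 0) Jpert t0 t = 0"
    "Q2' R packet (\<lambda>_. 0) Jpert t = (q / m) *\<^sub>R ball_int R t (P R packet) - q *\<^sub>R v t"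
    "Q0' R (\<lambda>_. 0) (\<lambda>_ _ _. 0) fpert t0 t =
       (LBINT s=ereal t0..ereal t. ball_int R s (f R packet)) -
       (ball_int R t (P R packet) - ball_int R t0 (P R packet))"
proof -
  have I0: "(LBINT s=ereal t0..ereal t. g s) = 0" if "\<And>s. s \<in> I \<Longrightarrow> g s = 0" for g :: "real \<Rightarrow> 'b::euclidean_space"
    using interval_cong[OF t0 t, of g "\<lambda>_. 0"] that by simp
  have Jp: "Jpert (s, x) = 0" if "s \<in> I" "x \<in> sphere (r s) R" for s x
    using boundary[OF that] by (simp add: Jpert_def)
  show a: "Q0 R a packet t0 t = 0" "Q01 R packet t0 t = 0"
    unfolding Q0_def Q01_def by (intro I0 sphere_int_zero; simp add: boundary vec_eq_iff)+
  show "Q20 R packet t = 0" "Q22 R packet t = 0"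
    unfolding Q20_def Q22_def by (subst sphere_int_zero; simp add: boundary[OF t])+
  have "(LBINT s=ereal t0..ereal t. sphere_int R s (\<lambda>n p. (v s \<bullet> n) * \<rho> packet p)) = 0"
    "(LBINT s=ereal t0..ereal t. sphere_int R s (\<lambda>n p. n \<bullet> J R packet p)) = 0"
    by (intro I0 sphere_int_zero; simp add: boundary)+
  then show "Q23 R packet t0 t = 0" by (simp add: Q23_def)
  have "(LBINT s=ereal t0..ereal t. sphere_int R s (\<lambda>n p. (v s \<bullet> n) * 0)) = 0"
    "(LBINT s=ereal t0..ereal t. sphere_int R s (\<lambda>n p. n \<bullet> Jpert p)) = 0"
    by (intro I0 sphere_int_zero; simp add: Jp)+
  then show "Q3' R (\<lambda>_. 0) Jpert t0 t = 0" by (simp add: Q3'_def ball_int_def)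
  have "ball_int R t (dt (tube R) (\<lambda>p. 0 *\<^sub>R (snd p - center R packet (fst p)))) = ball_int R t (\<lambda>_. 0)"
    by (rule ball_int_cong[OF t])
       (simp add: dt_def pd_eq[OF solid_tube' _ has_derivative_const])
  moreover have "sphere_int R t (\<lambda>n p. (n \<bullet> Jpert p) *\<^sub>R (snd p - center R packet t)) = 0"
    by (rule sphere_int_zero) (simp add: Jp[OF t])
  moreover have "ball_int R t Jpert = q *\<^sub>R v t - (q / m) *\<^sub>R ball_int R t (P R packet)"
  proof -
    note c\<rho> = Ck_imp_continuous[OF Ck_densities(1)]
    have "ball_int R t Jpert = ball_int R t (\<lambda>p. \<rho> packet p *\<^sub>R v t - J R packet p)"
      unfolding ball_int_def Jpert_def by simp
    also have "\<dots> = ball_int R t (\<rho> packet) *\<^sub>R v t - ball_int R t (J R packet)"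
      using Ck_imp_continuous[OF Ck_densities(2)]
      by (subst ball_int_diff[OF t]) (auto intro!: continuous_intros c\<rho> simp: ball_int_scaleR_left[OF t c\<rho>])
    also have "ball_int R t (J R packet) = (q / m) *\<^sub>R ball_int R t (P R packet)"
      by (simp only: J_eq[abs_def] ball_int_scaleR_right)
    finally show ?thesis using charge_packet[OF t] by (simp add: charge_def)
  qed
  ultimately show "Q2' R packet (\<lambda>_. 0) Jpert t = (q / m) *\<^sub>R ball_int R t (P R packet) - q *\<^sub>R v t"
    unfolding Q2'_def by (simp add: ball_int_def)
  \<comment> \<open>No integral of \<open>fpert\<close> is evaluated: the exact momentum balance
    with \<open>Q0\<close> and \<open>Q01\<close> equal to zero determines
    \<open>Q0'\<close>.\<close>
  show "Q0' R (\<lambda>_. 0) (\<lambda>_ _ _. 0) fpert t0 t =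
       (LBINT s=ereal t0..ereal t. ball_int R s (f R packet)) -
       (ball_int R t (P R packet) - ball_int R t0 (P R packet))"
    using momentum_balance[OF packet_laws t0 t] by (simp add: a algebra_simps)
qed

end

subsection \<open>Newton's law implies concentration\<close>

context nls_trajectory
begin

section \<open>Shrinking tubes around the trajectory\<close>

lemma tube_mono: "R \<le> S \<Longrightarrow> tube R \<subseteq> tube S"
  by (auto simp: tube_def)

text \<open>The graph is compact and disjoint from the closed complement of \<open>D\<close>, hence
  at positive distance from it; half that distance serves as the radius.\<close>

lemma tube_in_domain:
  obtains \<delta> where "\<delta> > 0" "tube \<delta> \<subseteq> D"
proof -
  let ?K = "(\<lambda>t. (t, r t)) ` I"
  have "compact ?K"
    by (intro compact_continuous_image continuous_intros continuous_r compact_Icc)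
  moreover have "closed (- D)" using open_D by (simp add: closed_def)
  moreover have "?K \<inter> - D = {}" using graph by auto
  ultimately obtain d where d: "d > 0" "\<And>x y. x \<in> ?K \<Longrightarrow> y \<in> - D \<Longrightarrow> d \<le> dist x y"
    using separate_compact_closed[of ?K "- D"] by blast
  have "tube (d / 2) \<subseteq> D"
  proof
    fix p assume "p \<in> tube (d / 2)"
    then obtain t x where p: "p = (t, x)" "t \<in> I" "dist (r t) x \<le> d / 2" by (auto simp: tube_def)
    then have "dist (t, r t) p < d" using d(1) by (simp add: dist_Pair_Pair)
    then show "p \<in> D" using d(2)[of "(t, r t)" p] p(2) by fastforce
  qed
  then show ?thesis using that[of "d / 2"] d(1) by simp
qed

text \<open>Uniform continuity on the one compact tube of radius \<open>\<delta>\<close> makes the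
  estimate uniform in time.\<close>

lemma tube_close:
  fixes g :: "spacetime \<Rightarrow> 'b::euclidean_space"
  assumes g: "continuous_on (tube \<delta>) g" and R: "R \<longlonglongrightarrow> 0" "\<And>n. 0 < R n" "\<And>n. R n \<le> \<delta>" and e: "e > 0"
  shows "\<forall>\<^sub>F n in sequentially. \<forall>t\<in>I. \<forall>x\<in>cball (r t) (R n). norm (g (t, x) - g (t, r t)) < e"
proof -
  obtain d where d: "d > 0" "\<And>x y. x \<in> tube \<delta> \<Longrightarrow> y \<in> tube \<delta> \<Longrightarrow> dist y x < d \<Longrightarrow> dist (g y) (g x) < e"
    using compact_uniformly_continuous[OF g compact_tube] e unfolding uniformly_continuous_on_def by metis
  have "\<forall>\<^sub>F n in sequentially. R n < d" using order_tendstoD(2)[OF R(1) d(1)] .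
  then show ?thesis
  proof eventually_elim
    case (elim n)
    show ?case
    proof (intro ballI)
      fix t x assume t: "t \<in> I" and x: "x \<in> cball (r t) (R n)"
      have "(t, r t) \<in> tube \<delta>" "(t, x) \<in> tube \<delta>"
        using t x R(2,3)[of n] by (auto simp: tube_def)
      moreover have "dist (t, x) (t, r t) < d"
        using x elim by (simp add: dist_Pair_Pair dist_commute)
      ultimately show "norm (g (t, x) - g (t, r t)) < e" using d(2) by (simp add: dist_norm)
    qed
  qed
qed

lemma newton_imp_concentration:
  assumes newton: newton_law
  shows concentration_trajectory
proof -
  obtain \<delta> where \<delta>: "\<delta> > 0" "tube \<delta> \<subseteq> D" by (rule tube_in_domain)
  \<comment> \<open>\<open>R n \<le> \<delta>\<close> keeps all tubes in the domain, and the extra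
    factor in \<open>a n\<close> gives the ratio \<open>R n / a n = Suc n\<close>.\<close>
  define R where "R n = \<delta> * inverse (real (Suc n))" for n
  define a where "a n = R n * inverse (real (Suc n))" for n
  have R: "R n > 0" "R n \<le> \<delta>" for n
    using \<delta>(1) mult_left_mono[of "inverse (real (Suc n))" 1 \<delta>] by (auto simp: R_def field_simps)
  have a: "a n > 0" for n using R(1)[of n] by (simp add: a_def)
  have R0: "R \<longlonglongrightarrow> 0"
    using tendsto_mult_right_zero[OF LIMSEQ_inverse_real_of_nat, of \<delta>] by (simp add: R_def[abs_def])
  have a0: "a \<longlonglongrightarrow> 0"
    using tendsto_mult_zero[OF R0 LIMSEQ_inverse_real_of_nat] by (simp add: a_def[abs_def])
  have ratio: "filterlim (\<lambda>n. R n / a n) at_top sequentially"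
  proof -
    have "R n / a n = real (Suc n)" for n using R(1)[of n] by (simp add: a_def field_simps)
    then show ?thesis
      using filterlim_compose[OF filterlim_real_sequentially filterlim_Suc] by simp
  qed
  have tubes: "tube (R n) \<subseteq> tube \<delta>" for n using R by (intro tube_mono)
  have tubeD: "tube (R n) \<subseteq> D" for n using tubes \<delta>(2) by blast
  have t0: "Tm \<in> I" using T_less by simp

  have cA: "continuous_on (tube \<delta>) A" and cB: "continuous_on (tube \<delta>) B" and cE: "continuous_on (tube \<delta>) E"
    using Ck_fields[THEN Ck_imp_continuous] \<delta>(2) by (auto intro: continuous_on_subset)
  \<comment> \<open>The canonical momentum on the trajectory: with it the potential in
    \<open>P_packet\<close> cancels there and leaves \<open>m v\<close>.\<close>
  define Wt where "Wt t = m *\<^sub>R v t + (q / c) *\<^sub>R A (t, r t)" for t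
  have cWt: "continuous_on I Wt"
    unfolding Wt_def using \<delta>(1)
    by (intro continuous_intros continuous_v continuous_on_compose2[OF cA] continuous_r) (auto simp: tube_def)
  \<comment> \<open>Closeness is required in the supremum norm only, and any null sequence would do
    as tolerance; \<open>R n\<close> is at hand.\<close>
  have "\<exists>g. polynomial_function g \<and> (\<forall>t\<in>I. norm (Wt t - g t) < R n)" for n
    using Stone_Weierstrass_polynomial_function[OF compact_Icc cWt R(1)[of n]] .
  then obtain w where w: "\<And>n. polynomial_function (w n)" "\<And>n t. t \<in> I \<Longrightarrow> norm (Wt t - w n t) < R n"
    by metis
  have "nls_packet m q chi c G1' D \<phi> A Tm Tp r (a n) (R n) (w n)" for n
    by (intro nls_packet.intro nls_trajectory_axioms nls_packet_axioms.intro a R tubeD w)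
  then interpret K: nls_packet m q chi c G1' D \<phi> A Tm Tp r "a n" "R n" "w n" for n .

  define Ei where "Ei t = E (t, r t)" for t
  define Bi where "Bi t = B (t, r t)" for t
  have cEi: "continuous_on I Ei" unfolding Ei_def by (rule continuous_E_path)
  have cBi: "continuous_on I Bi" unfolding Bi_def by (rule Ck_imp_continuous[OF Ck_B_path])
  note cc = bounded_bilinear.continuous_on[OF bounded_bilinear_cross3]
  obtain KW where KW: "\<And>t. t \<in> I \<Longrightarrow> norm (Wt t) \<le> KW"
    using bounded_on_compact[OF compact_Icc cWt] by blast
  obtain KA where KA: "\<And>p. p \<in> tube \<delta> \<Longrightarrow> norm (A p) \<le> KA"
    using bounded_on_compact[OF compact_tube cA] by blast

  let ?g = "\<lambda>n p. w n (fst p) - (q / c) *\<^sub>R A p"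
  have cg: "continuous_on (tube (R n)) (?g n)" for n
    using Ck_imp_continuous[OF K.Ck_w[of 0]] continuous_on_subset[OF cA tubes] by (intro continuous_intros)
  \<comment> \<open>\<open>KW + \<delta>\<close> bounds \<open>w n\<close> for every
    \<open>n\<close>, because \<open>w n\<close> stays within \<open>R n \<le> \<delta>\<close> of
    \<open>Wt\<close>.\<close>
  define Kg where "Kg = KW + \<delta> + q / c * KA"
  have Kg: "norm (?g n p) \<le> Kg" if p: "p \<in> tube (R n)" for n p
  proof -
    have t: "fst p \<in> I" using p by (auto simp: tube_def)
    have "norm (w n (fst p)) \<le> norm (Wt (fst p)) + norm (Wt (fst p) - w n (fst p))"
      using norm_triangle_ineq4[of "Wt (fst p)" "Wt (fst p) - w n (fst p)"] by simp
    also have "\<dots> \<le> KW + \<delta>" using KW[OF t] w(2)[OF t, of n] R(2)[of n] by linarith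
    finally have "norm (w n (fst p)) \<le> KW + \<delta>" .
    moreover have "norm ((q / c) *\<^sub>R A p) \<le> q / c * KA"
      using KA[of p] p tubes q_pos c_pos by (auto intro!: divide_right_mono mult_left_mono)
    ultimately show ?thesis
      unfolding Kg_def using norm_triangle_ineq4[of "w n (fst p)" "(q / c) *\<^sub>R A p"] by linarith
  qed
  have Kg0: "Kg \<ge> 0"
  proof -
    have "(Tm, r Tm) \<in> tube (R 0)" using R(1)[of 0] t0 by (intro tubeI) auto
    from Kg[OF this] show ?thesis using norm_ge_zero order_trans by blast
  qed

  define Pn where "Pn n t = ball_int (R n) t (P (R n) (K.packet n))" for n t
  have Pn_eq: "Pn n t = ball_int (R n) t (\<lambda>p. (K.profile n p)\<^sup>2 *\<^sub>R ?g n p)" if "t \<in> I" for n t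
    unfolding Pn_def by (rule ball_int_cong[OF that]) (rule K.P_packet)
  have Pn_bound: "norm (Pn n t) \<le> Kg" if t: "t \<in> I" for n t
  proof -
    have "norm (?g n (t, x) - 0) \<le> Kg" if "x \<in> cball (r t) (R n)" for x
      using Kg[OF tubeI[OF t that]] by simp
    from K.average_close[OF t cg this] show ?thesis by (simp add: Pn_eq[OF t])
  qed
  have Pn_lim: "tends_to_0 (\<lambda>n t. Pn n t - m *\<^sub>R v t)"
    unfolding tends_to_0_iff
  proof (intro allI impI)
    fix e :: real assume e: "e > 0"
    \<comment> \<open>The factor \<open>q / c\<close> in front of the potential turns this into
      \<open>e / 4\<close>; the error of the polynomial contributes another
      \<open>e / 4\<close>.\<close>
    have "e / 4 * (c / q) > 0" using e q_pos c_pos by simp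
    from tube_close[OF cA R0 R this]
    have "\<forall>\<^sub>F n in sequentially. \<forall>t\<in>I. \<forall>x\<in>cball (r t) (R n). norm (A (t, x) - A (t, r t)) < e / 4 * (c / q)" .
    moreover have "\<forall>\<^sub>F n in sequentially. R n < e / 4" using order_tendstoD(2)[OF R0, of "e / 4"] e by simp
    ultimately show "\<forall>\<^sub>F n in sequentially. \<forall>t\<in>I. norm (Pn n t - m *\<^sub>R v t) < e"
    proof eventually_elim
      case (elim n)
      show ?case
      proof
        fix t assume t: "t \<in> I"
        have "norm (?g n (t, x) - m *\<^sub>R v t) \<le> e / 2" if x: "x \<in> cball (r t) (R n)" for x
        proof -
          have "?g n (t, x) - m *\<^sub>R v t = - (Wt t - w n t) - (q / c) *\<^sub>R (A (t, x) - A (t, r t))"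
            by (simp add: Wt_def scaleR_diff_right)
          then have "norm (?g n (t, x) - m *\<^sub>R v t) \<le> norm (Wt t - w n t) + norm ((q / c) *\<^sub>R (A (t, x) - A (t, r t)))"
            using norm_triangle_ineq4[of "- (Wt t - w n t)" "(q / c) *\<^sub>R (A (t, x) - A (t, r t))"]
            by (simp only: norm_minus_cancel)
          also have "norm ((q / c) *\<^sub>R (A (t, x) - A (t, r t))) = q / c * norm (A (t, x) - A (t, r t))"
            using q_pos c_pos by simp
          also have "\<dots> \<le> q / c * (e / 4 * (c / q))"
            using elim(1) t x q_pos c_pos by (intro mult_left_mono) (auto intro: less_imp_le)
          also have "\<dots> = e / 4" using q_pos c_pos by simp
          finally show ?thesis using w(2)[OF t, of n] elim(2) by simp
        qed
        then have "norm (Pn n t - m *\<^sub>R v t) \<le> e / 2"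
          unfolding Pn_eq[OF t] by (rule K.average_close[OF t cg])
        then show "norm (Pn n t - m *\<^sub>R v t) < e" using e by linarith
      qed
    qed
  qed

  define Q3 where "Q3 n t = Q30 (R n) (K.packet n) t + Q31 (R n) (K.packet n) t" for n t
  \<comment> \<open>The first summand is the total charge, for \<open>Q30\<close>; the second bounds
    the total current divided by \<open>c\<close>, for \<open>Q31\<close>.\<close>
  define L where "L = q + q / m * Kg / c"
  have L: "L > 0" using q_pos m_pos c_pos Kg0 by (auto simp: L_def intro!: add_pos_nonneg)
  have Q3: "tends_to_0 Q3"
    unfolding tends_to_0_iff
  proof (intro allI impI)
    fix e :: real assume e: "e > 0"
    define d where "d = e / (2 * L)"
    have d: "d > 0" using e L by (simp add: d_def)
    from tube_close[OF cE R0 R d] tube_close[OF cB R0 R d]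
    show "\<forall>\<^sub>F n in sequentially. \<forall>t\<in>I. norm (Q3 n t) < e"
    proof eventually_elim
      case (elim n)
      show ?case
      proof
        fix t assume t: "t \<in> I"
        note c\<rho> = Ck_imp_continuous[OF K.Ck_densities(1)] and cJ = Ck_imp_continuous[OF K.Ck_densities(2)]
          and cp = K.continuous_profile2
        have cE': "continuous_on (tube (R n)) E" and cB': "continuous_on (tube (R n)) B"
          using cE cB tubes by (auto intro: continuous_on_subset)
        have "norm (Q30 (R n) (K.packet n) t) \<le> ball_int (R n) t (\<lambda>p. (K.profile n p)\<^sup>2) * (q * d)"
          unfolding Q30_def
        proof (rule ball_int_bound[OF t _ cp])
          show "continuous_on (tube (R n)) (\<lambda>p. \<rho> (K.packet n) p *\<^sub>R (E p - E (t, r t)))"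
            by (intro continuous_intros c\<rho> cE')
          fix x assume x: "x \<in> cball (r t) (R n)"
          have "(K.profile n (t, x))\<^sup>2 * (q * norm (E (t, x) - E (t, r t))) \<le> (K.profile n (t, x))\<^sup>2 * (q * d)"
            using elim(1) t x q_pos by (intro mult_left_mono) (auto intro: less_imp_le)
          then show "norm (\<rho> (K.packet n) (t, x) *\<^sub>R (E (t, x) - E (t, r t))) \<le> (K.profile n (t, x))\<^sup>2 * (q * d)"
            using q_pos by (simp add: K.\<rho>_packet abs_mult mult_ac)
        qed
        moreover have "norm (Q31 (R n) (K.packet n) t) \<le> ball_int (R n) t (\<lambda>p. (K.profile n p)\<^sup>2) * (q / m * Kg / c * d)"
          unfolding Q31_def
        proof (rule ball_int_bound[OF t _ cp])
          show "continuous_on (tube (R n)) (\<lambda>p. (1 / c) *\<^sub>R cross3 (J (R n) (K.packet n) p) (B p - B (t, r t)))"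
            by (intro continuous_intros cc cJ cB')
          fix x assume x: "x \<in> cball (r t) (R n)"
          have p: "(t, x) \<in> tube (R n)" by (rule tubeI[OF t x])
          let ?J = "J (R n) (K.packet n) (t, x)" and ?B = "B (t, x) - B (t, r t)"
          have "norm ?J = q / m * ((K.profile n (t, x))\<^sup>2 * norm (?g n (t, x)))"
            using q_pos m_pos by (simp add: K.J_eq K.P_packet[OF p])
          also have "\<dots> \<le> q / m * ((K.profile n (t, x))\<^sup>2 * Kg)"
            using Kg[OF p] q_pos m_pos by (intro mult_left_mono) auto
          finally have "norm ?J * norm ?B \<le> (q / m * ((K.profile n (t, x))\<^sup>2 * Kg)) * d"
            using elim(2) t x q_pos m_pos Kg0 by (intro mult_mono) (auto intro: less_imp_le)
          with norm_cross3_le[of ?J ?B] have "norm (cross3 ?J ?B) \<le> (q / m * ((K.profile n (t, x))\<^sup>2 * Kg)) * d"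
            by linarith
          then have "norm (cross3 ?J ?B) / c \<le> (q / m * ((K.profile n (t, x))\<^sup>2 * Kg)) * d / c"
            using c_pos by (intro divide_right_mono) auto
          then show "norm ((1 / c) *\<^sub>R cross3 ?J ?B) \<le> (K.profile n (t, x))\<^sup>2 * (q / m * Kg / c * d)"
            using c_pos by (simp add: mult_ac)
        qed
        ultimately have "norm (Q3 n t) \<le> q * d + q / m * Kg / c * d"
          unfolding Q3_def K.mass_profile[OF t] mult_1_left
          using norm_triangle_ineq[of "Q30 (R n) (K.packet n) t" "Q31 (R n) (K.packet n) t"] by linarith
        also have "\<dots> = L * d" by (simp add: L_def algebra_simps)
        also have "\<dots> = e / 2" using L by (simp add: d_def)
        finally show "norm (Q3 n t) < e" using e by linarith
      qed
    qed
  qed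

  have fs: "ball_int (R n) t (f (R n) (K.packet n)) =
      q *\<^sub>R Ei t + (q / (c * m)) *\<^sub>R cross3 (Pn n t) (Bi t) + Q3 n t" if t: "t \<in> I" for n t
  proof -
    have "ball_int (R n) t (J (R n) (K.packet n)) = (q / m) *\<^sub>R Pn n t"
      unfolding Pn_def by (simp only: K.J_eq[abs_def] ball_int_scaleR_right)
    then show ?thesis
      using K.force_split[OF t, of n] K.charge_packet[OF t, of n]
      by (simp add: Ei_def Bi_def Q3_def bounded_bilinear.scaleR_left[OF bounded_bilinear_cross3])
  qed
  have cPn: "continuous_on I (Pn n)" for n
    unfolding Pn_def by (intro continuous_ball_int Ck_imp_continuous[OF K.Ck_densities(3)])
  have cf: "continuous_on I (\<lambda>s. ball_int (R n) s (f (R n) (K.packet n)))" for n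
    by (intro continuous_ball_int K.continuous_force)
  have cQ3: "continuous_on I (Q3 n)" for n
  proof (rule continuous_on_eq)
    show "continuous_on I (\<lambda>s. ball_int (R n) s (f (R n) (K.packet n)) - q *\<^sub>R Ei s
        - (q / (c * m)) *\<^sub>R cross3 (Pn n s) (Bi s))"
      by (intro continuous_intros cf cEi cc cPn cBi)
  qed (simp add: fs)

  define M where "M t = q *\<^sub>R Ei t + (q / c) *\<^sub>R cross3 (v t) (Bi t)" for t
  have cM: "continuous_on I M" unfolding M_def by (intro continuous_intros cEi cc continuous_v cBi)
  \<comment> \<open>The place where Newton's law enters: it makes the Lorentz force on the
    trajectory the derivative of \<open>m v\<close>.\<close>
  have MI: "(LBINT s=ereal Tm..ereal t. M s) = m *\<^sub>R v t - m *\<^sub>R v Tm" if t: "t \<in> I" for t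
  proof (rule interval_FTC[OF t0 t cM])
    fix s assume s: "s \<in> I"
    have "M s = m *\<^sub>R acceleration Tm Tp r s"
      using newton s by (simp add: newton_law_def M_def Ei_def Bi_def)
    then show "((\<lambda>t. m *\<^sub>R v t) has_vector_derivative M s) (at s within I)"
      using v_deriv[OF s] by (auto intro!: derivative_eq_intros)
  qed
  \<comment> \<open>The deviation of the total force on the packet from the Lorentz force
    \<open>M\<close>; in \<open>Q0'\<close> the integral of \<open>M\<close> cancels against the
    increment of \<open>m v\<close>.\<close>
  let ?X = "\<lambda>n t. (q / (c * m)) *\<^sub>R cross3 (Pn n t - m *\<^sub>R v t) (Bi t) + Q3 n t"
  have cX: "continuous_on I (?X n)" for n
    by (intro continuous_intros cc cPn continuous_v cBi cQ3)
  have X: "tends_to_0 ?X"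
    by (intro tends_to_0_add tends_to_0_scaleR tends_to_0_cross3 Q3 Pn_lim cBi)
  have fX: "ball_int (R n) s (f (R n) (K.packet n)) = ?X n s + M s" if s: "s \<in> I" for n s
    using m_pos by (simp add: fs[OF s] M_def bounded_bilinear.diff_left[OF bounded_bilinear_cross3]
        bounded_bilinear.scaleR_left[OF bounded_bilinear_cross3] scaleR_diff_right)

  have Q0': "tends_to_0 (\<lambda>n. Q0' (R n) (\<lambda>_. 0) (\<lambda>_ _ _. 0) (K.fpert n) Tm)"
  proof (rule tends_to_0_cong)
    show "tends_to_0 (\<lambda>n t. (LBINT s=ereal Tm..ereal t. ?X n s) - (Pn n t - m *\<^sub>R v t) + (Pn n Tm - m *\<^sub>R v Tm))"
      by (intro tends_to_0_add tends_to_0_diff tends_to_0_integral[OF X always_eventually t0] allI cX Pn_lim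
          tends_to_0_const[OF tends_to_0_at[OF Pn_lim t0]])
    show "\<forall>\<^sub>F n in sequentially. \<forall>t\<in>I. Q0' (R n) (\<lambda>_. 0) (\<lambda>_ _ _. 0) (K.fpert n) Tm t =
        (LBINT s=ereal Tm..ereal t. ?X n s) - (Pn n t - m *\<^sub>R v t) + (Pn n Tm - m *\<^sub>R v Tm)"
    proof (intro always_eventually allI ballI)
      fix n t assume t: "t \<in> I"
      have "(LBINT s=ereal Tm..ereal t. ball_int (R n) s (f (R n) (K.packet n))) =
          (LBINT s=ereal Tm..ereal t. ?X n s + M s)"
        by (rule interval_cong[OF t0 t fX])
      also have "\<dots> = (LBINT s=ereal Tm..ereal t. ?X n s) + (LBINT s=ereal Tm..ereal t. M s)"
        by (intro interval_lebesgue_integral_add interval_integrable t0 t cX cM)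
      finally show "Q0' (R n) (\<lambda>_. 0) (\<lambda>_ _ _. 0) (K.fpert n) Tm t =
          (LBINT s=ereal Tm..ereal t. ?X n s) - (Pn n t - m *\<^sub>R v t) + (Pn n Tm - m *\<^sub>R v Tm)"
        unfolding K.packet_boundary_terms(8)[OF t0 t] MI[OF t] Pn_def by simp
    qed
  qed
  have Q2': "tends_to_0 (\<lambda>n. Q2' (R n) (K.packet n) (\<lambda>_. 0) (K.Jpert n))"
  proof (rule tends_to_0_cong[OF tends_to_0_scaleR[OF Pn_lim, of "q / m"]])
    show "\<forall>\<^sub>F n in sequentially. \<forall>t\<in>I. Q2' (R n) (K.packet n) (\<lambda>_. 0) (K.Jpert n) t =
        (q / m) *\<^sub>R (Pn n t - m *\<^sub>R v t)"
      using m_pos by (simp add: K.packet_boundary_terms(7)[OF t0] Pn_def scaleR_diff_right)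
  qed
  have zero: "tends_to_0 (\<lambda>_ _. 0)" using tends_to_0_const[of "\<lambda>_. 0"] by simp
  note bt = K.packet_boundary_terms[OF t0]
  have Q3': "tends_to_0 (\<lambda>n. Q3' (R n) (\<lambda>_. 0) (K.Jpert n) Tm)"
    by (rule tends_to_0_cong[OF zero]) (simp add: bt)
  have pert: "\<exists>\<rho>' J' P' T' f'.
          (\<forall>n. perturbed_laws (R n) (a n) (K.packet n) (\<rho>' n) (J' n) (P' n) (T' n) (f' n)) \<and>
          tends_to_0 (\<lambda>n. Q0' (R n) (P' n) (T' n) (f' n) Tm) \<and>
          tends_to_0 (\<lambda>n. Q2' (R n) (K.packet n) (\<rho>' n) (J' n)) \<and>
          tends_to_0 (\<lambda>n. Q3' (R n) (\<rho>' n) (J' n) Tm)"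
    using K.packet_laws Q0' Q2' Q3'
    by (intro exI[of _ "\<lambda>_ _. 0"] exI[of _ K.Jpert] exI[of _ "\<lambda>_ _ _ _. 0"] exI[of _ K.fpert]) simp
  have Pb: "\<exists>C. \<forall>n. \<forall>t\<in>I. norm (ball_int (R n) t (P (R n) (K.packet n))) \<le> C"
    using Pn_bound unfolding Pn_def by blast
  have chb: "\<exists>C c0 n0. c0 > 0 \<and> (\<forall>n\<ge>n0. \<forall>t\<in>I.
      c0 \<le> charge (R n) (K.packet n) t \<and> charge (R n) (K.packet n) t \<le> C)"
    using q_pos by (intro exI[of _ q] exI[of _ 0]) (simp add: K.charge_packet)
  have chl: "\<exists>\<rho>inf. (\<lambda>n. charge (R n) (K.packet n) Tm) \<longlonglongrightarrow> \<rho>inf"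
    by (rule exI[of _ q]) (simp add: K.charge_packet[OF t0])
  have Qb: "tends_to_0 (\<lambda>n. Q0 (R n) (a n) (K.packet n) Tm)" "tends_to_0 (\<lambda>n. Q01 (R n) (K.packet n) Tm)"
       "tends_to_0 (\<lambda>n. Q20 (R n) (K.packet n))" "tends_to_0 (\<lambda>n. Q22 (R n) (K.packet n))"
       "tends_to_0 (\<lambda>n. Q23 (R n) (K.packet n) Tm)"
    by (rule tends_to_0_cong[OF zero]; simp add: bt)+
  have Q3I: "tends_to_0 (\<lambda>n t. LBINT s=ereal Tm..ereal t. Q30 (R n) (K.packet n) s + Q31 (R n) (K.packet n) s)"
    using tends_to_0_integral[OF Q3 always_eventually t0] cQ3 by (simp add: Q3_def)
  show ?thesis
    unfolding concentration_trajectory_def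
    by (rule conjI, rule nonlin, rule exI[of _ a], rule exI[of _ R], rule exI[of _ K.packet], rule exI[of _ Tm])
       (intro conjI allI a R(1) a0 R0 ratio tubeD K.Ck_packet t0 pert Pb chb chl Qb Q3I)
qed

end

theorem theorem8:
  fixes m q chi c Tm Tp :: real
    and G1' :: "real \<Rightarrow> real"
    and D :: "spacetime set"
    and \<phi> :: "spacetime \<Rightarrow> real"
    and A :: "spacetime \<Rightarrow> real^3"
    and w :: "real \<Rightarrow> real"
    and r :: "real \<Rightarrow> real^3"
  assumes "m > 0" "q > 0" "chi > 0" "c > 0"
    and "nonlinearity_condition G1'"
    and "open D" "connected D"
    and "Ck 2 D \<phi>" "Ck 2 D A"
    and "\<forall>\<theta>\<ge>0. w \<theta> > 0"
    and "Ck 2 UNIV (\<lambda>x::real^3. w (norm x))"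
    and "steady_state G1' (\<lambda>x. w (norm x))"
    and "integrable lborel (\<lambda>x::real^3. (w (norm x))\<^sup>2)"
    and "\<exists>C. \<forall>\<^sub>F \<theta> in at_top. \<theta>\<^sup>2 * \<bar>w \<theta>\<bar> \<le> C"
    and "\<exists>C. \<forall>\<^sub>F \<theta> in at_top. \<theta> ^ 3 * \<bar>deriv w \<theta>\<bar> \<le> C"
    and "Tm < Tp"
    and "trajectory Tm Tp r"
    and "\<forall>t\<in>{Tm..Tp}. (t, r t) \<in> D"
  shows "nls.concentration_trajectory m q chi c G1' D \<phi> A Tm Tp r \<longleftrightarrow>
         nls.newton_law m q c D \<phi> A Tm Tp r"
proof -
  interpret nls_trajectory m q chi c G1' D \<phi> A Tm Tp r
    using assms by unfold_locales auto
  show ?thesis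
    using concentration_imp_newton newton_imp_concentration by blast
qed

end
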